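(* For every $N \in \mathbb{N}$ there exists a right-angled Artin group $A_\Gamma$ such that $|\mathrm{Out}(\mathrm{Aut}(A_\Gamma))| > N$. Moreover, $A_\Gamma$ can be chosen to have trivial centre, and it can also be chosen to have non-trivial centre.
   Context: For a finite simplicial graph $\Gamma=(V,E)$, the right-angled Artin group $A_\Gamma$ is the group with presentation $\langle v\in V \mid [v,w]=1 \text{ whenever } (v,w)\in E\rangle$. For a group $G$, $\mathrm{Out}(G)=\mathrm{Aut}(G)/\mathrm{Inn}(G)$. *)

theory Defs
  imports "HOL-Algebra.Algebra"
begin

definition simplicial_graph :: "'v set \<Rightarrow> ('v \<times> 'v) set \<Rightarrow> bool" where
  "simplicial_graph V E \<longleftrightarrow> finite V \<and> E \<subseteq> V \<times> V \<and> sym E \<and> irrefl E"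

text \<open>Words are lists of letters (v, b); b = True means v, b = False means v inverse.
  One elementary step either deletes an adjacent pair x x^-1, or swaps two adjacent
  letters whose underlying vertices span an edge.  A_Gamma is the set of words over V
  modulo the equivalence relation generated by these steps, with concatenation.\<close>

inductive raag_step :: "('v \<times> 'v) set \<Rightarrow> ('v \<times> bool) list \<Rightarrow> ('v \<times> bool) list \<Rightarrow> bool"
  for E where
  cancel: "raag_step E (u @ [(v, b), (v, \<not> b)] @ w) (u @ w)"
| commute: "(a, c) \<in> E \<Longrightarrow> raag_step E (u @ [(a, b), (c, d)] @ w) (u @ [(c, d), (a, b)] @ w)"

definition raag_words :: "'v set \<Rightarrow> ('v \<times> bool) list set" where
  "raag_words V = lists (V \<times> UNIV)"

definition raag_rel :: "'v set \<Rightarrow> ('v \<times> 'v) set \<Rightarrow> (('v \<times> bool) list \<times> ('v \<times> bool) list) set" where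
  "raag_rel V E = {(x, y). x \<in> raag_words V \<and> y \<in> raag_words V \<and> equivclp (raag_step E) x y}"

definition RAAG :: "'v set \<Rightarrow> ('v \<times> 'v) set \<Rightarrow> ('v \<times> bool) list set monoid" where
  "RAAG V E =
    \<lparr> carrier = raag_words V // raag_rel V E,
      monoid.mult = (\<lambda>P Q. Image (raag_rel V E) {(SOME x. x \<in> P) @ (SOME y. y \<in> Q)}),
      monoid.one = Image (raag_rel V E) {[]} \<rparr>"

definition center :: "('a, 'b) monoid_scheme \<Rightarrow> 'a set" where
  "center G = {z \<in> carrier G. \<forall>x \<in> carrier G. x \<otimes>\<^bsub>G\<^esub> z = z \<otimes>\<^bsub>G\<^esub> x}"

definition inn :: "('a, 'b) monoid_scheme \<Rightarrow> ('a \<Rightarrow> 'a) set" where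
  "inn G = {(\<lambda>x \<in> carrier G. g \<otimes>\<^bsub>G\<^esub> x \<otimes>\<^bsub>G\<^esub> inv\<^bsub>G\<^esub> g) | g. g \<in> carrier G}"

definition Out :: "('a, 'b) monoid_scheme \<Rightarrow> ('a \<Rightarrow> 'a) set monoid" where
  "Out G = AutoGroup G Mod inn G"

definition order_exceeds :: "('a, 'b) monoid_scheme \<Rightarrow> nat \<Rightarrow> bool" where
  "order_exceeds G N \<longleftrightarrow> infinite (carrier G) \<or> card (carrier G) > N"

end

theory Submission
  imports Defs
begin

text \<open>
  Let \<open>F\<^sub>i\<close> be free groups of pairwise distinct ranks \<open>\<ge> 2\<close> and let \<open>D\<close> be their direct product, over
  \<open>i < k\<close>. Centralizers in free groups are abelian, so an automorphism of \<open>D\<close> permutes the factors,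
  and by the ranks it preserves each of them.

  Without centre, take \<open>A = D * Q\<close> with \<open>Q\<close> free abelian of rank 2. Normal forms in free products show
  that every automorphism of \<open>A\<close> is uniquely an inner one followed by one that preserves both \<open>D\<close>
  and \<open>Q\<close>. The normal closure of \<open>Q\<close> is the free product of its conjugates \<open>b Q b\<inverse>\<close>, indexed
  by \<open>b \<in> D\<close>, on which \<open>Aut A\<close> acts through the holomorph of \<open>D\<close>. For every set \<open>S\<close> of indices
  the map \<open>D \<rightarrow> D\<close> that inverts the \<open>S\<close>-coordinates normalizes the holomorph, because it interchanges left and
  right translations by these coordinates, and so it induces an automorphism of \<open>Aut A\<close>. The
  \<open>S\<close>-coordinates are those for which inner automorphisms are sent to non-inner ones, so
  these automorphisms of \<open>Aut A\<close> are pairwise inequivalent modulo inner ones.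

  With centre, take \<open>A = D \<times> \<langle>z\<rangle>\<close>. Then \<open>Aut A\<close> is the semidirect product of \<open>Hom (D, \<int>)\<close>, the group of
  transvections, and \<open>Aut D \<times> {\<plusminus>1}\<close>; changing signs on the direct summands \<open>Hom (F\<^sub>i, \<int>)\<close>
  gives automorphisms, inner only if all signs agree.
\<close>

section \<open>Free products\<close>

text \<open>Inverting some coordinates of D is no automorphism of A, since inversion reverses
  products in a nonabelian factor; the symmetry appears only one level up, in Aut A. It extends
  there because Aut D respects it, and this is what the distinct ranks secure: an automorphism
  interchanging a factor in S with one outside S would destroy it. The shape of D and Q is dictated
  by the decomposition of automorphisms. With two or more direct factors D is freely indecomposable,
  and with rank 2 so is Q, without being infinite cyclic; for an infinite cyclic Q generated by c,
  fixing D and sending c to d c would be an automorphism that carries Q to no conjugate of itself.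
  In the central case, changing all signs is conjugation by the automorphism that inverts z, so one
  block keeps its sign and 2^(k-1) classes remain; without centre all 2^k survive. The facts used
  about free groups (commuting elements, nonabelian factors) are derived from the uniqueness of
  reduced words, which in turn comes from letting A act on them.\<close>

context group
begin

lemma inv_mult_cancel: "x \<in> carrier G \<Longrightarrow> y \<in> carrier G \<Longrightarrow> inv x \<otimes> (x \<otimes> y) = y"
  by (simp flip: m_assoc)

lemma mult_inv_cancel: "x \<in> carrier G \<Longrightarrow> y \<in> carrier G \<Longrightarrow> x \<otimes> (inv x \<otimes> y) = y"
  by (simp flip: m_assoc)

lemmas word_simps = m_assoc inv_mult_group inv_mult_cancel mult_inv_cancel

lemma comm_inv:
  assumes "x \<in> carrier G" "y \<in> carrier G" "x \<otimes> y = y \<otimes> x"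
  shows "inv x \<otimes> y = y \<otimes> inv x"
  using assms by (metis inv_closed inv_solve_left inv_solve_right m_assoc m_closed)

lemma comm_mult:
  assumes "x \<in> carrier G" "y \<in> carrier G" "z \<in> carrier G" "x \<otimes> z = z \<otimes> x" "y \<otimes> z = z \<otimes> y"
  shows "(x \<otimes> y) \<otimes> z = z \<otimes> (x \<otimes> y)"
  using assms by (metis m_assoc)

lemma comm_conj_iff:
  assumes "x \<in> carrier G" "y \<in> carrier G" "g \<in> carrier G"
  shows "(g \<otimes> x \<otimes> inv g) \<otimes> (g \<otimes> y \<otimes> inv g) = (g \<otimes> y \<otimes> inv g) \<otimes> (g \<otimes> x \<otimes> inv g)
    \<longleftrightarrow> x \<otimes> y = y \<otimes> x"
  using assms by (simp add: word_simps) (metis inv_closed m_assoc m_closed r_cancel)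

lemma comm_generate:
  assumes "S \<subseteq> carrier G" "x \<in> carrier G" "\<And>s. s \<in> S \<Longrightarrow> s \<otimes> x = x \<otimes> s" "y \<in> generate G S"
  shows "y \<otimes> x = x \<otimes> y"
  using assms(4)
proof (induction y rule: generate.induct)
  case (eng h1 h2)
  then show ?case using assms(1,2) generate_in_carrier comm_mult by blast
qed (use assms in \<open>auto intro: comm_inv\<close>)

lemma hom_eq_on_generate:
  assumes "group K" "f \<in> hom G K" "g \<in> hom G K" "S \<subseteq> carrier G"
    "\<And>s. s \<in> S \<Longrightarrow> f s = g s" "x \<in> generate G S"
  shows "f x = g x"
proof -
  interpret f: group_hom G K f
    using assms by (simp add: group_hom_def group_hom_axioms_def is_group)
  interpret g: group_hom G K g
    using assms by (simp add: group_hom_def group_hom_axioms_def is_group)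
  show ?thesis using assms(6)
  proof (induction rule: generate.induct)
    case (inv h) then show ?case using assms(4,5) by (metis f.hom_inv g.hom_inv subsetD)
  next
    case (eng a b) then show ?case using generate_in_carrier[OF assms(4)] by simp
  qed (use assms(4,5) in auto)
qed

lemma hom_generate_subset:
  assumes "group K" "f \<in> hom G K" "S \<subseteq> carrier G" "subgroup T K" "f ` S \<subseteq> T"
  shows "f ` generate G S \<subseteq> T"
proof -
  interpret f: group_hom G K f
    using assms by (simp add: group_hom_def group_hom_axioms_def is_group)
  have "f x \<in> T" if "x \<in> generate G S" for x using that
  proof (induction rule: generate.induct)
    case (inv h) then show ?case using assms subgroup.m_inv_closed[OF assms(4)]
      by (metis f.hom_inv image_subset_iff subsetD)
  next
    case (eng a b) then show ?case using generate_in_carrier[OF assms(3)]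
      by (simp add: subgroup.m_closed[OF assms(4)])
  qed (use assms in \<open>auto simp: subgroup.one_closed\<close>)
  then show ?thesis by blast
qed

end

text \<open>A word commuting with \<open>x\<close> is a prefix of x x x ..., hence determined by its
  length. The induction strips one copy of \<open>x\<close>, which leaves a shorter commuting
  word.\<close>

lemma commuting_lists_eq:
  "x \<noteq> [] \<Longrightarrow> length p = length q \<Longrightarrow> p @ x = x @ p \<Longrightarrow> q @ x = x @ q \<Longrightarrow> p = q"
proof (induction "length p" arbitrary: p q rule: less_induct)
  case less
  show ?case
  proof (cases "length p < length x")
    case True
    then have "p = take (length p) x" "q = take (length q) x"
      using less.prems by (metis append_eq_conv_conj nat_less_le take_all_iff take_append
          diff_is_0_eq less_or_eq_imp_le take0 append_Nil2)+
    then show ?thesis using less.prems by metis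
  next
    case False
    then have "take (length x) p = x" "take (length x) q = x"
      using less.prems by (metis append_eq_append_conv_if append_eq_conv_conj leI)+
    then obtain p' q' where pq: "p = x @ p'" "q = x @ q'"
      by (metis append_take_drop_id)
    have "p' = q'"
      by (rule less.hyps) (use less.prems pq in auto)
    then show ?thesis using pq by simp
  qed
qed

text \<open>\<open>u @ v\<close> and \<open>v @ u\<close> have the same length and both commute with
  \<open>x\<close>.\<close>

lemma commuting_lists:
  assumes "x \<noteq> []" "u @ x = x @ u" "v @ x = x @ v"
  shows "u @ v = v @ u"
proof (rule commuting_lists_eq[OF assms(1)])
  show "(u @ v) @ x = x @ u @ v" "(v @ u) @ x = x @ v @ u"
    using assms by (metis append.assoc)+
qed simp

section \<open>Reduced words over a family of subgroups\<close>

locale subgroup_family = group G for G (structure) +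
  fixes I :: "'i set" and H :: "'i \<Rightarrow> 'a set"
  assumes subgroup_H: "i \<in> I \<Longrightarrow> subgroup (H i) G"
begin

definition reduced :: "('i \<times> 'a) list \<Rightarrow> bool" where
  "reduced L \<longleftrightarrow> (\<forall>l\<in>set L. fst l \<in> I \<and> snd l \<in> H (fst l) \<and> snd l \<noteq> \<one>)
     \<and> successively (\<lambda>k l. fst k \<noteq> fst l) L"

definition letters :: "('i \<times> 'a) list \<Rightarrow> bool" where
  "letters L \<longleftrightarrow> snd ` set L \<subseteq> carrier G"

definition eval :: "('i \<times> 'a) list \<Rightarrow> 'a" where
  "eval L = foldr (\<lambda>l x. snd l \<otimes> x) L \<one>"

definition invl :: "('i \<times> 'a) list \<Rightarrow> ('i \<times> 'a) list" where
  "invl L = rev (map (\<lambda>l. (fst l, inv (snd l))) L)"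

text \<open>Left multiplication by a letter, performed on the words themselves. It is defined
  without appeal to uniqueness of normal forms, so that \<open>lact_lact\<close> yields an action
  from which uniqueness can be deduced.\<close>

definition lact :: "'i \<Rightarrow> 'a \<Rightarrow> ('i \<times> 'a) list \<Rightarrow> ('i \<times> 'a) list" where
  "lact i h L = (if h = \<one> then L else case L of [] \<Rightarrow> [(i, h)]
     | l # M \<Rightarrow> if fst l = i then if h \<otimes> snd l = \<one> then M else (i, h \<otimes> snd l) # M
                else (i, h) # L)"

lemma H_carrier: "i \<in> I \<Longrightarrow> h \<in> H i \<Longrightarrow> h \<in> carrier G"
  using subgroup_H subgroup.mem_carrier by fast

lemma H_mult: "i \<in> I \<Longrightarrow> h \<in> H i \<Longrightarrow> h' \<in> H i \<Longrightarrow> h \<otimes> h' \<in> H i"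
  using subgroup_H subgroup.m_closed by fast

lemma H_inv: "i \<in> I \<Longrightarrow> h \<in> H i \<Longrightarrow> inv h \<in> H i"
  using subgroup_H subgroup.m_inv_closed by fast

lemma H_one: "i \<in> I \<Longrightarrow> \<one> \<in> H i"
  using subgroup_H subgroup.one_closed by fast

lemma reduced_Nil [simp]: "reduced []"
  by (simp add: reduced_def)

lemma reduced_Cons: "reduced (l # L) \<longleftrightarrow> fst l \<in> I \<and> snd l \<in> H (fst l) \<and> snd l \<noteq> \<one>
    \<and> reduced L \<and> (L = [] \<or> fst l \<noteq> fst (hd L))"
  by (cases L) (auto simp: reduced_def)

lemma reduced_append: "reduced (L @ M) \<longleftrightarrow> reduced L \<and> reduced M
    \<and> (L = [] \<or> M = [] \<or> fst (last L) \<noteq> fst (hd M))"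
  by (auto simp: reduced_def successively_append_iff)

lemma reduced_letters: "reduced L \<Longrightarrow> letters L"
  using H_carrier by (auto simp: reduced_def letters_def)

lemma letters_append [simp]: "letters (L @ M) \<longleftrightarrow> letters L \<and> letters M"
  by (auto simp: letters_def)

lemma letters_Cons [simp]: "letters (l # M) \<longleftrightarrow> snd l \<in> carrier G \<and> letters M"
  by (auto simp: letters_def)

lemma letters_Nil [simp]: "letters []"
  by (auto simp: letters_def)

lemma eval_Nil [simp]: "eval [] = \<one>"
  by (simp add: eval_def)

lemma eval_Cons [simp]: "eval (l # L) = snd l \<otimes> eval L"
  by (simp add: eval_def)

lemma eval_closed: "letters L \<Longrightarrow> eval L \<in> carrier G"
  by (induction L) auto

lemma eval_append: "letters L \<Longrightarrow> letters M \<Longrightarrow> eval (L @ M) = eval L \<otimes> eval M"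
  by (induction L) (auto simp: eval_closed m_assoc)

lemma letters_replicate: "letters L \<Longrightarrow> letters (concat (replicate n L))"
  by (induction n) auto

lemma eval_replicate: "letters L \<Longrightarrow> eval (concat (replicate n L)) = eval L [^] n"
  by (induction n) (auto simp: eval_append eval_closed letters_replicate
      simp flip: nat_pow_Suc2)

lemma length_invl [simp]: "length (invl L) = length L"
  by (simp add: invl_def)

lemma invl_eq_Nil [simp]: "invl L = [] \<longleftrightarrow> L = []"
  by (simp add: invl_def)

lemma hd_invl: "L \<noteq> [] \<Longrightarrow> fst (hd (invl L)) = fst (last L)"
  by (simp add: invl_def hd_rev last_map)

lemma last_invl: "L \<noteq> [] \<Longrightarrow> fst (last (invl L)) = fst (hd L)"
  by (simp add: invl_def last_rev hd_map)

lemma invl_reduced: "reduced L \<Longrightarrow> reduced (invl L)"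
proof (induction L)
  case (Cons l L)
  have "inv (snd l) \<noteq> \<one>" using Cons.prems H_carrier by (auto simp: reduced_Cons inv_eq_1_iff)
  then have "reduced [(fst l, inv (snd l))]"
    using Cons.prems H_inv by (auto simp: reduced_Cons)
  moreover have "invl (l # L) = invl L @ [(fst l, inv (snd l))]" by (simp add: invl_def)
  ultimately show ?case using Cons by (auto simp: reduced_append reduced_Cons last_invl)
qed (simp add: invl_def)

lemma letters_invl: "letters L \<Longrightarrow> letters (invl L)"
  by (auto simp: letters_def invl_def)

lemma eval_invl: "letters L \<Longrightarrow> eval (invl L) = inv (eval L)"
proof (induction L)
  case (Cons l L)
  then have "invl (l # L) = invl L @ [(fst l, inv (snd l))]" by (simp add: invl_def)
  then show ?case using Cons
    by (simp add: eval_append letters_invl eval_closed inv_mult_group)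
qed (simp add: invl_def)

lemma lact_reduced:
  assumes "i \<in> I" "h \<in> H i" "reduced L"
  shows "reduced (lact i h L)"
  using assms by (cases L) (auto simp: lact_def reduced_Cons H_mult)

lemma eval_lact:
  assumes "i \<in> I" "h \<in> H i" "reduced L"
  shows "eval (lact i h L) = h \<otimes> eval L"
proof (cases L)
  case (Cons l M)
  then have "snd l \<in> carrier G" "h \<in> carrier G" "eval M \<in> carrier G"
    using assms by (auto simp: reduced_Cons H_carrier eval_closed reduced_letters)
  then show ?thesis using Cons by (auto simp: lact_def simp flip: m_assoc)
qed (use assms H_carrier in \<open>auto simp: lact_def\<close>)

lemma lact_one [simp]: "lact i \<one> L = L"
  by (simp add: lact_def)

text \<open>The delicate case is that \<open>h'\<close> cancels the leading letter: then
  \<open>h\<close> meets the next letter, whose index is different, and is merely prepended.\<close>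

lemma lact_lact:
  assumes "i \<in> I" "h \<in> H i" "h' \<in> H i" "reduced L"
  shows "lact i h (lact i h' L) = lact i (h \<otimes> h') L"
proof -
  have c: "h \<in> carrier G" "h' \<in> carrier G" using assms H_carrier by auto
  show ?thesis
  proof (cases L)
    case Nil then show ?thesis using c by (auto simp: lact_def)
  next
    case (Cons l M)
    have l: "snd l \<in> carrier G" "snd l \<noteq> \<one>" "M = [] \<or> fst l \<noteq> fst (hd M)"
      using assms Cons by (auto simp: reduced_Cons H_carrier)
    show ?thesis
    proof (cases "fst l = i")
      case False
      then show ?thesis using c Cons by (auto simp: lact_def)
    next
      case True
      have a: "h \<otimes> h' \<otimes> snd l = h \<otimes> (h' \<otimes> snd l)" using c l by (simp add: m_assoc)
      show ?thesis
      proof (cases "h' \<otimes> snd l = \<one>")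
        case True': True
        then have "snd l = inv h'" using c l by (metis inv_equality inv_inv)
        then have e: "h' \<otimes> inv h' = \<one>" "h \<otimes> (h' \<otimes> inv h') = h" using c by auto
        have "h \<otimes> h' = \<one> \<Longrightarrow> snd l = h"
          using c \<open>snd l = inv h'\<close> by (simp add: inv_equality)
        then show ?thesis using Cons True True' l c a \<open>snd l \<noteq> \<one>\<close>
          by (cases M) (auto simp: lact_def prod_eq_iff)
      next
        case False
        have "h \<otimes> h' = \<one> \<Longrightarrow> h \<otimes> (h' \<otimes> snd l) = snd l"
          using c l by (simp flip: m_assoc)
        then show ?thesis using Cons True False l c a
          by (auto simp: lact_def prod_eq_iff)
      qed
    qed
  qed
qed

lemma lact_Cons_reduced: "reduced (l # L) \<Longrightarrow> lact (fst l) (snd l) L = l # L"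
  by (cases L) (auto simp: lact_def reduced_Cons)

abbreviation P :: "'a set" where "P \<equiv> generate G (\<Union>i\<in>I. H i)"

lemma H_Union: "(\<Union>i\<in>I. H i) \<subseteq> carrier G"
  using H_carrier by auto

lemma P_carrier: "x \<in> P \<Longrightarrow> x \<in> carrier G"
  using generate_in_carrier H_Union by blast

lemma H_P: "i \<in> I \<Longrightarrow> h \<in> H i \<Longrightarrow> h \<in> P"
  by (auto intro: generate.incl)

text \<open>A letter multiplied from the left affects at most the leading letter, so
  \<open>Y\<close> leaves all but the first \<open>length Y\<close> letters of \<open>L\<close>
  alone. This gives normal forms for products, and in \<open>hyperbolic_absorb\<close> it protects
  the far end of a long power.\<close>

lemma mult_suffix:
  assumes "reduced Y" "reduced L"
  shows "\<exists>W. reduced (W @ drop (length Y) L) \<and> eval (W @ drop (length Y) L) = eval Y \<otimes> eval L"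
  using assms(1)
proof (induction Y)
  case Nil
  then show ?case using assms by (intro exI[of _ "[]"]) (auto simp: eval_closed reduced_letters)
next
  case (Cons y Y)
  then obtain W where W: "reduced (W @ drop (length Y) L)"
    "eval (W @ drop (length Y) L) = eval Y \<otimes> eval L" by (auto simp: reduced_Cons)
  let ?Z = "lact (fst y) (snd y) (W @ drop (length Y) L)"
  have y: "fst y \<in> I" "snd y \<in> H (fst y)" "reduced Y" using Cons.prems by (auto simp: reduced_Cons)
  have Z: "reduced ?Z" "eval ?Z = eval (y # Y) \<otimes> eval L"
    using lact_reduced[OF y(1,2) W(1)] eval_lact[OF y(1,2) W(1)] W(2) y assms(2)
    by (auto simp: m_assoc H_carrier eval_closed reduced_letters)
  have "\<exists>W'. ?Z = W' @ drop (length (y # Y)) L"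
  proof (cases W)
    case Nil
    show ?thesis
    proof (cases "drop (length Y) L")
      case Nil': Nil then show ?thesis by simp
    next
      case Cons': (Cons a M)
      then have "drop (length (y # Y)) L = M" by (metis drop_Suc length_Cons list.sel(3) tl_drop)
      then show ?thesis using Nil Cons' by (auto simp: lact_def)
    qed
  next
    case (Cons a M)
    have "\<exists>U. drop (length Y) L = U @ drop (length (y # Y)) L"
      by (rule exI[of _ "take 1 (drop (length Y) L)"])
         (metis append_take_drop_id drop_drop length_Cons plus_1_eq_Suc)
    then obtain U where U: "drop (length Y) L = U @ drop (length (y # Y)) L" by blast
    show ?thesis unfolding Cons U
      by (auto simp: lact_def)
  qed
  then show ?case using Z by metis
qed

lemma P_eval:
  assumes "x \<in> P" obtains L where "reduced L" "eval L = x"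
proof -
  have "\<exists>L. reduced L \<and> eval L = x" using assms
  proof (induction x rule: generate.induct)
    case one then show ?case by (metis eval_Nil reduced_Nil)
  next
    case (incl h)
    then obtain i where "i \<in> I" "h \<in> H i" by auto
    then show ?case using lact_reduced[of i h "[]"] eval_lact[of i h "[]"] H_carrier by force
  next
    case (inv h)
    then obtain i where "i \<in> I" "inv h \<in> H i" using H_inv by auto
    then show ?case using lact_reduced[of i "inv h" "[]"] eval_lact[of i "inv h" "[]"] H_carrier by force
  next
    case (eng x y) then show ?case using mult_suffix by metis
  qed
  then show ?thesis using that by blast
qed

end

text \<open>An internal free product: \<open>G\<close> may be larger than \<open>P\<close>. Thus the
  locale serves both for the free subgroups \<open>sub (B i)\<close> of \<open>A\<close> and for
  \<open>A\<close> itself.\<close>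

locale free_product = subgroup_family G I H
  for G (structure) and I :: "'i set" and H :: "'i \<Rightarrow> 'a set" +
  assumes eval_unique: "reduced L \<Longrightarrow> reduced M \<Longrightarrow> eval L = eval M \<Longrightarrow> L = M"
begin

section \<open>Conjugates and centralizers in a free product\<close>

lemma reduced_single: "i \<in> I \<Longrightarrow> h \<in> H i \<Longrightarrow> h \<noteq> \<one> \<Longrightarrow> reduced [(i, h)]"
  by (simp add: reduced_Cons)

lemma eval_eq_letter:
  assumes "reduced L" "eval L = h" "i \<in> I" "h \<in> H i"
  shows "L = (if h = \<one> then [] else [(i, h)])"
proof -
  have "h \<in> carrier G" using assms H_carrier by auto
  then show ?thesis
    using assms eval_unique[of L "[]"] eval_unique[of L "[(i, h)]"] reduced_single by auto
qed

lemma H_Int: "i \<in> I \<Longrightarrow> j \<in> I \<Longrightarrow> h \<in> H i \<Longrightarrow> h \<in> H j \<Longrightarrow> h \<noteq> \<one> \<Longrightarrow> i = j"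
  using eval_eq_letter[of "[(i, h)]" h j] reduced_single[of i h] H_carrier by auto

text \<open>If the normal form \<open>Y\<close> of \<open>y\<close> does not end in
  \<open>H i\<close>, then \<open>Y\<close>, \<open>h\<close> and the inverse of \<open>Y\<close>
  concatenate to a reduced word of length 2 |Y| + 1, which is a single letter only if
  \<open>Y\<close> is empty. A last letter of \<open>Y\<close> from \<open>H i\<close> is absorbed
  into \<open>h\<close> beforehand.\<close>

lemma elliptic_conj:
  assumes h: "i \<in> I" "h \<in> H i" "h \<noteq> \<one>" and y: "y \<in> P"
    and j: "j \<in> I" "y \<otimes> h \<otimes> inv y \<in> H j"
  shows "i = j \<and> y \<in> H i"
proof -
  have strip: "Y = []" if Y: "reduced Y" "Y = [] \<or> fst (last Y) \<noteq> i" and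
    k: "k \<in> H i" "k \<noteq> \<one>" "eval Y \<otimes> k \<otimes> inv (eval Y) \<in> H j" for Y k
  proof (rule ccontr)
    assume ne: "Y \<noteq> []"
    let ?L = "Y @ [(i, k)] @ invl Y"
    have kc: "k \<in> carrier G" using k h H_carrier by auto
    have r: "reduced ?L" using Y ne k h
      by (auto simp: reduced_append reduced_Cons invl_reduced hd_invl)
    have "eval ?L = eval Y \<otimes> k \<otimes> inv (eval Y)" using Y kc reduced_letters
      by (simp add: eval_append letters_invl eval_invl eval_closed m_assoc)
    then have "length ?L \<le> 1" using eval_eq_letter[OF r _ j(1) k(3)] by (auto split: if_splits)
    then show False using ne by (cases Y) auto
  qed
  obtain Y where Y: "reduced Y" "eval Y = y" using y P_eval by blast
  show ?thesis
  proof (cases "Y = [] \<or> fst (last Y) \<noteq> i")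
    case True
    then have "Y = []" using strip[OF Y(1) True h(2,3)] j Y by simp
    then have "y = \<one>" using Y by simp
    then show ?thesis using j(2) H_Int[OF h(1) j(1) h(2)] h H_one[OF h(1)] H_carrier[OF h(1,2)]
      by simp
  next
    case False
    then obtain Z a where Z: "Y = Z @ [(i, a)]"
      by (metis append_butlast_last_id prod.collapse)
    have red: "reduced Z" "Z = [] \<or> fst (last Z) \<noteq> i" "a \<in> H i" "a \<noteq> \<one>"
      using Y(1) Z by (auto simp: reduced_append reduced_Cons)
    have c: "a \<in> carrier G" "h \<in> carrier G" "eval Z \<in> carrier G"
      using red h H_carrier by (auto simp: reduced_letters eval_closed)
    have ye: "y = eval Z \<otimes> a" using Y Z c by (auto simp: eval_append reduced_letters red)
    let ?k = "a \<otimes> h \<otimes> inv a"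
    have "?k \<in> H i" using red h by (simp add: H_mult H_inv)
    moreover have "?k \<noteq> \<one>"
    proof
      assume "?k = \<one>"
      then have "inv a \<otimes> ?k \<otimes> a = inv a \<otimes> \<one> \<otimes> a" by simp
      then show False using c h(3) by (simp add: word_simps)
    qed
    moreover have "eval Z \<otimes> ?k \<otimes> inv (eval Z) = y \<otimes> h \<otimes> inv y"
      using c ye by (simp add: word_simps)
    ultimately have "Z = []" using strip[OF red(1,2)] j by simp
    then have "y \<in> H i" using ye c red by simp
    moreover then have "y \<otimes> h \<otimes> inv y \<in> H i" using h by (simp add: H_mult H_inv)
    moreover have "y \<otimes> h \<otimes> inv y = ?k" using ye \<open>Z = []\<close> c by simp
    ultimately show ?thesis using H_Int[OF h(1) j(1) _ j(2)] \<open>?k \<noteq> \<one>\<close> by simp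
  qed
qed

lemma elliptic_centralizer:
  assumes "i \<in> I" "h \<in> H i" "h \<noteq> \<one>" "y \<in> P" "y \<otimes> h = h \<otimes> y"
  shows "y \<in> H i"
proof -
  have "y \<otimes> h \<otimes> inv y = h" using assms P_carrier H_carrier by (simp add: word_simps)
  then show ?thesis using elliptic_conj assms by metis
qed

text \<open>Cyclically reduced of length at least two: every power of \<open>T\<close> is reduced as
  it stands.\<close>

definition cyclic :: "('i \<times> 'a) list \<Rightarrow> bool" where
  "cyclic T \<longleftrightarrow> reduced T \<and> T \<noteq> [] \<and> fst (hd T) \<noteq> fst (last T)"

text \<open>If the first and last letters share an index, conjugation by the first one merges them
  and shortens the word. What remains are the trivial, elliptic (conjugate into a factor) and
  hyperbolic (conjugate to a cyclically reduced word) elements.\<close>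

lemma conj_cyclic:
  assumes "x \<in> P"
  obtains g where "g \<in> P" "inv g \<otimes> x \<otimes> g = \<one>"
  | g i h where "g \<in> P" "i \<in> I" "h \<in> H i" "h \<noteq> \<one>" "inv g \<otimes> x \<otimes> g = h"
  | g T where "g \<in> P" "cyclic T" "inv g \<otimes> x \<otimes> g = eval T"
proof -
  have "\<exists>g T. g \<in> P \<and> reduced T \<and> inv g \<otimes> eval L \<otimes> g = eval T \<and>
      (T = [] \<or> (\<exists>i h. T = [(i, h)]) \<or> cyclic T)" if "reduced L" for L
    using that
  proof (induction "length L" arbitrary: L rule: less_induct)
    case less
    have Lc: "eval L \<in> carrier G" using less by (simp add: eval_closed reduced_letters)
    show ?case
    proof (cases "L = [] \<or> (\<exists>i h. L = [(i, h)]) \<or> cyclic L")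
      case True
      then show ?thesis using less Lc by (intro exI[of _ \<one>] exI[of _ L]) (auto simp: generate.one)
    next
      case False
      then have L: "L \<noteq> []" "\<not> (\<exists>i h. L = [(i, h)])" "fst (hd L) = fst (last L)"
        using less.prems by (auto simp: cyclic_def)
      then obtain i a Y where aY: "L = (i, a) # Y" by (metis hd_Cons_tl prod.collapse)
      then obtain Y' b where YL: "Y = Y' @ [(i, b)]" using L
        by (metis append_butlast_last_id fst_conv last_ConsR list.sel(1) prod.collapse)
      have red: "i \<in> I" "a \<in> H i" "a \<noteq> \<one>" "b \<in> H i" "reduced Y'" "Y' = [] \<or> fst (last Y') \<noteq> i"
        using less.prems aY YL by (auto simp: reduced_append reduced_Cons)
      let ?b = "b \<otimes> a"
      let ?M = "if ?b = \<one> then Y' else Y' @ [(i, ?b)]"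
      have c: "a \<in> carrier G" "b \<in> carrier G" "eval Y' \<in> carrier G" "letters Y'"
        using red H_carrier by (auto simp: eval_closed reduced_letters)
      have M: "reduced ?M" using red by (auto simp: reduced_append reduced_Cons H_mult)
      have "eval ?M = eval Y' \<otimes> ?b" using c by (auto simp: eval_append)
      moreover have "eval L = a \<otimes> eval Y' \<otimes> b" using aY YL c by (simp add: eval_append m_assoc)
      ultimately have e: "eval ?M = inv a \<otimes> eval L \<otimes> a" using c by (simp add: word_simps)
      have "length ?M < length L" using aY YL by auto
      then obtain g T where g: "g \<in> P" "reduced T" "inv g \<otimes> eval ?M \<otimes> g = eval T"
        "T = [] \<or> (\<exists>i h. T = [(i, h)]) \<or> cyclic T" using less.hyps M by blast
      have "inv (a \<otimes> g) \<otimes> eval L \<otimes> (a \<otimes> g) = eval T"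
        using g(3) c Lc P_carrier[OF g(1)] unfolding e by (simp add: word_simps)
      moreover have "a \<otimes> g \<in> P" using red g H_P by (simp add: generate.eng)
      ultimately show ?thesis using g by blast
    qed
  qed
  moreover obtain L where "reduced L" "eval L = x" using P_eval assms by blast
  ultimately obtain g T where "g \<in> P" "reduced T" "inv g \<otimes> x \<otimes> g = eval T"
      "T = [] \<or> (\<exists>i h. T = [(i, h)]) \<or> cyclic T" by metis
  then show ?thesis using that by (auto simp: reduced_Cons H_carrier)
qed

text \<open>Multiplying an element of the centralizer by a high power of the cyclically reduced word
  \<open>T\<close> yields a reduced word with the same first and last syllable types as \<open>T\<close>. Such words
  multiply by mere concatenation, so commutation becomes commutation in a free monoid.\<close>

lemma hyperbolic_absorb:
  assumes T: "cyclic T" and y: "y \<in> P" "y \<otimes> eval T = eval T \<otimes> y"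
  obtains Z n where "cyclic Z" "eval Z = eval T [^] (n::nat) \<otimes> y" "Z @ T = T @ Z"
proof -
  let ?x = "eval T"
  have Xr: "reduced T" "T \<noteq> []" "letters T" and xc: "?x \<in> carrier G"
    using T by (auto simp: cyclic_def reduced_letters eval_closed)
  obtain Y where Y: "reduced Y" "eval Y = y" using y P_eval by blast
  have yc: "y \<in> carrier G" "letters Y" using y P_carrier Y reduced_letters by auto
  \<comment> \<open>One copy of \<open>T\<close> more than \<open>Y\<close> has letters, so that
    multiplication by \<open>y\<close> cannot reach the far end of the power.\<close>
  define n where "n = Suc (length Y)"
  let ?Xn = "concat (replicate n T)"
  have red: "reduced (concat (replicate m T))
      \<and> (m > 0 \<longrightarrow> concat (replicate m T) \<noteq> [] \<and> hd (concat (replicate m T)) = hd T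
         \<and> last (concat (replicate m T)) = last T)" for m
    using T by (induction m) (auto simp: cyclic_def reduced_append last_append)
  have Xn: "reduced ?Xn" "?Xn \<noteq> []" "hd ?Xn = hd T" "last ?Xn = last T"
    using red[of n] by (auto simp: n_def)
  have len: "length ?Xn \<ge> n" using Xr(2) by (simp add: length_concat sum_list_replicate Suc_leI)
  have eXn: "eval ?Xn = ?x [^] n" by (simp add: eval_replicate Xr)
  have com: "y \<otimes> ?x [^] n = ?x [^] n \<otimes> y"
    using group_commutes_pow[of ?x y n] y(2) xc yc by metis
  let ?w = "?x [^] n \<otimes> y"
  have last_eq: "\<exists>W. reduced W \<and> eval W = eval U \<otimes> eval V \<and> W \<noteq> [] \<and> last W = last V"
    if uv: "reduced U" "reduced V" "length U < length V" for U V
  proof -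
    obtain W where "reduced (W @ drop (length U) V)" "eval (W @ drop (length U) V) = eval U \<otimes> eval V"
      using mult_suffix[OF uv(1,2)] by blast
    then show ?thesis using uv(3) by (intro exI[of _ "W @ drop (length U) V"]) simp
  qed
  obtain Z where Z: "reduced Z" "eval Z = ?w" "Z \<noteq> []" "last Z = last T"
    using last_eq[of Y ?Xn] Y Xn len com eXn by (auto simp: n_def)
  \<comment> \<open>The suffix argument controls only the last letter. The first letter of
    \<open>Z\<close> is controlled by applying it to the inverse of \<open>?w\<close>.\<close>
  have "eval (invl ?Xn) = inv (?x [^] n)" using eval_invl[of ?Xn] eXn Xn reduced_letters by metis
  then obtain W where W: "reduced W" "eval W = inv y \<otimes> inv (?x [^] n)" "W \<noteq> []"
    "last W = last (invl ?Xn)"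
    using last_eq[of "invl Y" "invl ?Xn"] Y yc Xn len eXn
    by (auto simp: n_def invl_reduced eval_invl reduced_letters simp del: replicate_Suc)
  have "eval (invl W) = ?w" using W xc yc
    by (simp add: eval_invl reduced_letters inv_mult_group)
  then have "Z = invl W" using eval_unique Z W invl_reduced by simp
  then have "fst (hd Z) = fst (last W)" using W by (simp add: hd_invl)
  then have hd: "fst (hd Z) = fst (hd T)" using W Xn by (simp add: last_invl)
  have cyc: "cyclic Z" using Z hd T by (auto simp: cyclic_def)
  have "eval (Z @ T) = eval (T @ Z)"
  proof -
    have "?w \<otimes> ?x = ?x \<otimes> ?w"
      using comm_mult[OF _ yc(1) xc group_commutes_pow[OF refl xc xc] y(2)] xc by blast
    then show ?thesis unfolding eval_append[OF reduced_letters[OF Z(1)] Xr(3)]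
        eval_append[OF Xr(3) reduced_letters[OF Z(1)]] Z(2) .
  qed
  moreover have "reduced (Z @ T)" "reduced (T @ Z)"
    using Z T hd by (auto simp: reduced_append cyclic_def)
  ultimately have "Z @ T = T @ Z" using eval_unique by blast
  then show ?thesis using that cyc Z by blast
qed

text \<open>After multiplication by powers of \<open>eval T\<close>, both elements are given by
  words commuting with \<open>T\<close> in the free monoid, hence with each other. The powers
  commute with \<open>y\<close> and \<open>z\<close> and cancel.\<close>

lemma hyperbolic_centralizer_comm:
  assumes T: "cyclic T" and y: "y \<in> P" "y \<otimes> eval T = eval T \<otimes> y"
    and z: "z \<in> P" "z \<otimes> eval T = eval T \<otimes> z"
  shows "y \<otimes> z = z \<otimes> y"
proof -
  let ?x = "eval T"
  have xc: "?x \<in> carrier G" using T by (auto simp: cyclic_def reduced_letters eval_closed)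
  obtain U n where U: "cyclic U" "eval U = ?x [^] (n::nat) \<otimes> y" "U @ T = T @ U"
    using hyperbolic_absorb[OF T y] by blast
  obtain V m where V: "cyclic V" "eval V = ?x [^] (m::nat) \<otimes> z" "V @ T = T @ V"
    using hyperbolic_absorb[OF T z] by blast
  have "U @ V = V @ U" using commuting_lists U V T by (metis cyclic_def)
  then have uv: "eval U \<otimes> eval V = eval V \<otimes> eval U"
    using U V eval_append by (metis cyclic_def reduced_letters)
  let ?p = "?x [^] n" and ?q = "?x [^] m"
  have c: "y \<in> carrier G" "z \<in> carrier G" "?p \<in> carrier G" "?q \<in> carrier G"
    using y z P_carrier xc by auto
  have pq: "?p \<otimes> ?q = ?q \<otimes> ?p" using xc by (simp add: nat_pow_mult add.commute)
  have py: "?p \<otimes> y = y \<otimes> ?p" "?q \<otimes> y = y \<otimes> ?q" "?p \<otimes> z = z \<otimes> ?p" "?q \<otimes> z = z \<otimes> ?q"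
    using y z c xc group_commutes_pow[of ?x y n] group_commutes_pow[of ?x y m]
      group_commutes_pow[of ?x z n] group_commutes_pow[of ?x z m] by metis+
  have "eval U \<otimes> eval V = (?p \<otimes> ?q) \<otimes> (y \<otimes> z)"
  proof -
    have "(?p \<otimes> y) \<otimes> (?q \<otimes> z) = ?p \<otimes> (y \<otimes> ?q) \<otimes> z" using c by (simp add: m_assoc)
    then show ?thesis using U V c unfolding py(2)[symmetric] by (simp add: m_assoc)
  qed
  moreover have "eval V \<otimes> eval U = (?p \<otimes> ?q) \<otimes> (z \<otimes> y)"
  proof -
    have "(?q \<otimes> z) \<otimes> (?p \<otimes> y) = ?q \<otimes> (z \<otimes> ?p) \<otimes> y" using c by (simp add: m_assoc)
    also have "\<dots> = (?q \<otimes> ?p) \<otimes> (z \<otimes> y)" using c unfolding py(3)[symmetric] by (simp add: m_assoc)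
    finally show ?thesis using U V pq by simp
  qed
  ultimately show ?thesis using uv c by simp
qed

text \<open>Commuting words are powers of a common word \<open>W\<close>, so \<open>eval T\<close>
  and \<open>y\<close> are both powers of \<open>eval W\<close>.\<close>

lemma hyperbolic_centralizer_root:
  assumes T: "cyclic T" and y: "y \<in> P" "y \<otimes> eval T = eval T \<otimes> y"
  obtains m n :: int where "m > 0" "y [^] m = eval T [^] n"
proof -
  let ?x = "eval T"
  have xc: "?x \<in> carrier G" "letters T" "T \<noteq> []"
    using T by (auto simp: cyclic_def reduced_letters eval_closed)
  have yc: "y \<in> carrier G" using y P_carrier by blast
  obtain Z n where Z: "cyclic Z" "eval Z = ?x [^] (n::nat) \<otimes> y" "Z @ T = T @ Z"
    using hyperbolic_absorb[OF T y] by blast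
  obtain a b W where W: "concat (replicate a W) = Z" "concat (replicate b W) = T"
    using comm_append_are_replicate[OF Z(3)] by blast
  have b: "b > 0" using W xc by (cases b) auto
  then have "letters W" using W(2) xc(2) by (cases b) auto
  let ?w = "eval W"
  have wc: "?w \<in> carrier G" using \<open>letters W\<close> eval_closed by blast
  have x: "?x = ?w [^] int b" using eval_replicate[OF \<open>letters W\<close>, of b] W(2) by (simp add: int_pow_int)
  have "?w [^] int a = ?x [^] int n \<otimes> y"
    using W(1) Z eval_replicate[OF \<open>letters W\<close>, of a] by (simp add: int_pow_int)
  then have "y = inv (?x [^] int n) \<otimes> ?w [^] int a" using xc yc by (simp add: inv_mult_cancel)
  also have "\<dots> = ?w [^] (int a - int b * int n)" unfolding x using wc
    by (simp add: int_pow_pow flip: int_pow_neg int_pow_mult)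
  finally have "y [^] int b = ?x [^] (int a - int b * int n)"
    unfolding x using wc by (simp add: int_pow_pow mult.commute)
  then show ?thesis using that b by (metis of_nat_0_less_iff)
qed

text \<open>Up to conjugation \<open>x\<close> is a letter, whose centralizer lies in its abelian
  factor, or a cyclically reduced word. It is applied to free groups, seen as free products of
  cyclic groups.\<close>

lemma abelian_centralizers:
  assumes ab: "\<And>i h k. i \<in> I \<Longrightarrow> h \<in> H i \<Longrightarrow> k \<in> H i \<Longrightarrow> h \<otimes> k = k \<otimes> h"
    and x: "x \<in> P" "x \<noteq> \<one>" and y: "y \<in> P" "y \<otimes> x = x \<otimes> y" and z: "z \<in> P" "z \<otimes> x = x \<otimes> z"
  shows "y \<otimes> z = z \<otimes> y"
proof -
  have conj: "y \<otimes> z = z \<otimes> y" if g: "g \<in> P" and c: "\<And>a b. a \<in> P \<Longrightarrow> b \<in> P \<Longrightarrow>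
     a \<otimes> (inv g \<otimes> x \<otimes> g) = (inv g \<otimes> x \<otimes> g) \<otimes> a \<Longrightarrow> b \<otimes> (inv g \<otimes> x \<otimes> g) = (inv g \<otimes> x \<otimes> g) \<otimes> b \<Longrightarrow>
     a \<otimes> b = b \<otimes> a" for g
  proof -
    have gc: "g \<in> carrier G" "inv g \<in> carrier G" "x \<in> carrier G" "y \<in> carrier G" "z \<in> carrier G"
      using g x y z P_carrier by auto
    have "inv g \<in> P" using g H_Union generate_m_inv_closed by blast
    then have P: "inv g \<otimes> y \<otimes> g \<in> P" "inv g \<otimes> z \<otimes> g \<in> P" using g y z by (simp_all add: generate.eng)
    note iff = comm_conj_iff[OF _ _ gc(2), unfolded inv_inv[OF gc(1)]]
    have "(inv g \<otimes> y \<otimes> g) \<otimes> (inv g \<otimes> z \<otimes> g) = (inv g \<otimes> z \<otimes> g) \<otimes> (inv g \<otimes> y \<otimes> g)"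
      by (rule c[OF P]) (simp_all only: iff[OF gc(4,3)] iff[OF gc(5,3)] y z)
    then show ?thesis by (simp only: iff[OF gc(4,5)])
  qed
  from x(1) show ?thesis
  proof (cases rule: conj_cyclic)
    case (1 g)
    have gc: "g \<in> carrier G" "x \<in> carrier G" using 1 x P_carrier by auto
    have "x = g \<otimes> (inv g \<otimes> x \<otimes> g) \<otimes> inv g" using gc by (simp add: word_simps)
    then show ?thesis using 1 gc x by simp
  next
    case (2 g i h)
    show ?thesis
    proof (rule conj[OF 2(1)], unfold 2(5))
      fix a b assume "a \<in> P" "b \<in> P" "a \<otimes> h = h \<otimes> a" "b \<otimes> h = h \<otimes> b"
      then show "a \<otimes> b = b \<otimes> a" using elliptic_centralizer[OF 2(2-4)] ab[OF 2(2)] by blast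
    qed
  next
    case (3 g T)
    show ?thesis
      by (rule conj[OF 3(1)], unfold 3(3)) (rule hyperbolic_centralizer_comm[OF 3(2)])
  qed
qed

end

section \<open>Right-angled Artin groups\<close>

lemma raag_step_append: "raag_step E x y \<Longrightarrow> raag_step E (u @ x @ w) (u @ y @ w)"
proof (induction rule: raag_step.induct)
  case (cancel u' v b w')
  show ?case using raag_step.cancel[of E "u @ u'" v b "w' @ w"] by simp
next
  case (commute a c u' b d w')
  then show ?case using raag_step.commute[of a c E "u @ u'" b d "w' @ w"] by simp
qed

lemma equivclp_raag_append:
  assumes "equivclp (raag_step E) x y"
  shows "equivclp (raag_step E) (u @ x @ w) (u @ y @ w)"
  using assms
proof (induction rule: equivclp_induct)
  case (step y z)
  then have "equivclp (raag_step E) (u @ y @ w) (u @ z @ w)"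
    using raag_step_append[of E] by (metis converse_r_into_equivclp r_into_equivclp)
  then show ?case using step.IH equivclp_trans by metis
qed simp

lemma equivclp_raag_cong:
  assumes "equivclp (raag_step E) x x'" "equivclp (raag_step E) y y'"
  shows "equivclp (raag_step E) (x @ y) (x' @ y')"
proof (rule equivclp_trans)
  show "equivclp (raag_step E) (x @ y) (x' @ y)" "equivclp (raag_step E) (x' @ y) (x' @ y')"
    using equivclp_raag_append[OF assms(1), of "[]" y] equivclp_raag_append[OF assms(2), of x' "[]"]
    by simp_all
qed

definition inv_word :: "('v \<times> bool) list \<Rightarrow> ('v \<times> bool) list" where
  "inv_word w = rev (map (\<lambda>l. (fst l, \<not> snd l)) w)"

lemma inv_word_cancel: "equivclp (raag_step E) (inv_word w @ w) []"
proof (induction w)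
  case (Cons l w)
  have "raag_step E (inv_word w @ [(fst l, \<not> snd l), (fst l, \<not> \<not> snd l)] @ w) (inv_word w @ w)"
    by (rule raag_step.cancel)
  moreover have "inv_word w @ [(fst l, \<not> snd l), (fst l, \<not> \<not> snd l)] @ w = inv_word (l # w) @ l # w"
    by (simp add: inv_word_def)
  ultimately show ?case using Cons by (metis equivclp_trans r_into_equivclp)
qed (simp add: inv_word_def)

type_synonym 'v elt = "('v \<times> bool) list set"

section \<open>The group of a graph and its universal property\<close>

locale raag =
  fixes V :: "'v set" and E :: "('v \<times> 'v) set"
  assumes E_sub: "E \<subseteq> V \<times> V"
begin

abbreviation A :: "'v elt monoid" where "A \<equiv> RAAG V E"

abbreviation mul :: "'v elt \<Rightarrow> 'v elt \<Rightarrow> 'v elt" (infixl "\<cdot>" 70) where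
  "x \<cdot> y \<equiv> x \<otimes>\<^bsub>A\<^esub> y"

abbreviation ginv :: "'v elt \<Rightarrow> 'v elt" where "ginv x \<equiv> inv\<^bsub>A\<^esub> x"

abbreviation unit :: "'v elt" ("\<epsilon>") where "\<epsilon> \<equiv> \<one>\<^bsub>A\<^esub>"

abbreviation G :: "('v elt \<Rightarrow> 'v elt) monoid" where "G \<equiv> AutoGroup A"

abbreviation am :: "('v elt \<Rightarrow> 'v elt) \<Rightarrow> ('v elt \<Rightarrow> 'v elt) \<Rightarrow> 'v elt \<Rightarrow> 'v elt"
  (infixl "\<star>" 70) where "g \<star> h \<equiv> g \<otimes>\<^bsub>G\<^esub> h"

definition cls :: "('v \<times> bool) list \<Rightarrow> 'v elt" where
  "cls w = raag_rel V E `` {w}"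

definition gen :: "'v \<Rightarrow> 'v elt" where
  "gen v = cls [(v, True)]"

lemma words_simps [simp]:
  "[] \<in> raag_words V"
  "(l # w \<in> raag_words V) = (fst l \<in> V \<and> w \<in> raag_words V)"
  "(x @ y \<in> raag_words V) = (x \<in> raag_words V \<and> y \<in> raag_words V)"
  by (auto simp: raag_words_def mem_Times_iff)

lemma inv_word_words: "w \<in> raag_words V \<Longrightarrow> inv_word w \<in> raag_words V"
  by (fastforce simp: raag_words_def inv_word_def)

lemma equiv_rel: "equiv (raag_words V) (raag_rel V E)"
  unfolding raag_rel_def
  by (intro equivI refl_onI symI transI) (auto intro: equivclp_sym equivclp_trans)

lemma cls_eq_iff:
  "x \<in> raag_words V \<Longrightarrow> y \<in> raag_words V \<Longrightarrow> cls x = cls y \<longleftrightarrow> equivclp (raag_step E) x y"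
  unfolding cls_def using eq_equiv_class_iff[OF equiv_rel] by (auto simp: raag_rel_def)

lemma carrier_A: "carrier A = cls ` raag_words V"
  by (auto simp: RAAG_def cls_def quotient_def)

lemma one_A: "\<epsilon> = cls []"
  by (simp add: RAAG_def cls_def)

lemma some_cls:
  assumes "x \<in> raag_words V"
  shows "(SOME z. z \<in> cls x) \<in> raag_words V" "equivclp (raag_step E) x (SOME z. z \<in> cls x)"
proof -
  have "x \<in> cls x" using assms by (simp add: cls_def raag_rel_def)
  then have "(SOME z. z \<in> cls x) \<in> cls x" by (rule someI)
  then show "(SOME z. z \<in> cls x) \<in> raag_words V" "equivclp (raag_step E) x (SOME z. z \<in> cls x)"
    by (auto simp: cls_def raag_rel_def)
qed

lemma mult_A:
  assumes "x \<in> raag_words V" "y \<in> raag_words V"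
  shows "cls x \<cdot> cls y = cls (x @ y)"
proof -
  have "cls x \<cdot> cls y = cls ((SOME z. z \<in> cls x) @ (SOME z. z \<in> cls y))"
    by (simp add: RAAG_def cls_def)
  also have "\<dots> = cls (x @ y)"
    by (subst cls_eq_iff)
      (use some_cls assms in \<open>auto intro: equivclp_sym equivclp_raag_cong\<close>)
  finally show ?thesis .
qed

lemma group_A: "group A"
proof (rule groupI)
  fix x assume "x \<in> carrier A"
  then obtain w where w: "w \<in> raag_words V" "x = cls w" by (auto simp: carrier_A)
  have "cls (inv_word w) \<cdot> x = \<epsilon>"
    using w inv_word_words[OF w(1)] inv_word_cancel[of E w]
    by (simp add: mult_A one_A cls_eq_iff)
  then show "\<exists>y\<in>carrier A. y \<cdot> x = \<epsilon>"
    using inv_word_words[OF w(1)] by (auto simp: carrier_A)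
qed (auto simp: carrier_A mult_A one_A)

end

sublocale raag \<subseteq> group A
  by (rule group_A)

context raag
begin

lemma group_G: "group G"
  by (rule AutoGroup)

lemma gen_carrier: "v \<in> V \<Longrightarrow> gen v \<in> carrier A"
  unfolding gen_def carrier_A by (rule imageI) simp

lemma gen_comm: "(v, w) \<in> E \<Longrightarrow> gen v \<cdot> gen w = gen w \<cdot> gen v"
proof -
  assume e: "(v, w) \<in> E"
  then have "v \<in> V" "w \<in> V" using E_sub by auto
  moreover have "raag_step E [(v, True), (w, True)] [(w, True), (v, True)]"
    using raag_step.commute[OF e, of "[]" True True "[]"] by simp
  ultimately show ?thesis
    by (simp add: gen_def mult_A cls_eq_iff r_into_equivclp)
qed

lemma cls_letter: "v \<in> V \<Longrightarrow> cls [(v, b)] = (if b then gen v else ginv (gen v))"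
proof (cases b)
  case False
  assume v: "v \<in> V"
  have "raag_step E [(v, False), (v, True)] []"
    using raag_step.cancel[of E "[]" v False "[]"] by simp
  then have "cls [(v, False)] \<cdot> gen v = \<epsilon>"
    using v by (simp add: gen_def mult_A one_A cls_eq_iff r_into_equivclp)
  then have "ginv (gen v) = cls [(v, False)]"
  proof (rule inv_equality)
    show "cls [(v, False)] \<in> carrier A" unfolding carrier_A by (rule imageI) (use v in simp)
  qed (rule gen_carrier[OF v])
  then show ?thesis using False by simp
qed (simp add: gen_def)

lemma carrier_generate: "carrier A = generate A (gen ` V)"
proof
  have "cls w \<in> generate A (gen ` V)" if "w \<in> raag_words V" for w using that
  proof (induction w)
    case Nil then show ?case using generate.one[of A] by (simp add: one_A)
  next
    case (Cons l w)
    have "cls [l] \<in> generate A (gen ` V)"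
      using cls_letter[of "fst l" "snd l"] Cons.prems
      by (auto intro: generate.incl generate.inv)
    moreover have "cls (l # w) = cls [l] \<cdot> cls w" using Cons.prems by (simp add: mult_A)
    ultimately show ?case using Cons by (simp add: generate.eng)
  qed
  then show "carrier A \<subseteq> generate A (gen ` V)" by (auto simp: carrier_A)
  show "generate A (gen ` V) \<subseteq> carrier A" by (rule generate_incl) (auto simp: gen_carrier)
qed

text \<open>The universal property of the presentation. It is the source of retractions, exponent
  sums, partial conjugations and the action behind normal forms.\<close>

lemma lift_ex:
  assumes K: "group K" and f: "\<And>v. v \<in> V \<Longrightarrow> f v \<in> carrier K"
    and comm: "\<And>v w. (v, w) \<in> E \<Longrightarrow> f v \<otimes>\<^bsub>K\<^esub> f w = f w \<otimes>\<^bsub>K\<^esub> f v"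
  shows "\<exists>h \<in> hom A K. \<forall>v \<in> V. h (gen v) = f v"
proof -
  interpret K: group K by fact
  \<comment> \<open>A chain of steps between two words over \<open>V\<close> may pass through
    letters outside \<open>V\<close>. Sending these to the unit keeps \<open>ev\<close> constant
    along the chain.\<close>
  define l where "l p = (if fst p \<in> V then if snd p then f (fst p) else inv\<^bsub>K\<^esub> f (fst p) else \<one>\<^bsub>K\<^esub>)"
    for p :: "'v \<times> bool"
  define ev where "ev w = foldr (\<lambda>p x. l p \<otimes>\<^bsub>K\<^esub> x) w \<one>\<^bsub>K\<^esub>" for w
  have l: "l p \<in> carrier K" for p using f by (auto simp: l_def)
  have ev_closed: "ev w \<in> carrier K" for w
    by (induction w) (use l in \<open>auto simp: ev_def\<close>)
  have ev_append: "ev (x @ y) = ev x \<otimes>\<^bsub>K\<^esub> ev y" for x y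
    using l ev_closed by (induction x) (auto simp: ev_def K.m_assoc)
  have ev2: "ev [p, q] = l p \<otimes>\<^bsub>K\<^esub> l q" for p q using l by (simp add: ev_def)
  have step: "ev x = ev y" if "raag_step E x y" for x y using that
  proof (induction rule: raag_step.induct)
    case (cancel u v b w)
    have "ev [(v, b), (v, \<not> b)] = \<one>\<^bsub>K\<^esub>" unfolding ev2 using f by (auto simp: l_def)
    then show ?case unfolding ev_append by (simp add: ev_closed)
  next
    case (commute a c u b d w)
    then have v: "a \<in> V" "c \<in> V" using E_sub by auto
    note fc = f[OF v(1)] f[OF v(2)]
    have i: "f a \<otimes>\<^bsub>K\<^esub> f c = f c \<otimes>\<^bsub>K\<^esub> f a" using comm commute by blast
    have j: "f a \<otimes>\<^bsub>K\<^esub> inv\<^bsub>K\<^esub> f c = inv\<^bsub>K\<^esub> f c \<otimes>\<^bsub>K\<^esub> f a"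
      using K.comm_inv[OF fc(2,1) i[symmetric]] by simp
    have "l (a, b) \<otimes>\<^bsub>K\<^esub> l (c, d) = l (c, d) \<otimes>\<^bsub>K\<^esub> l (a, b)"
      using i K.comm_inv[OF fc i] j K.comm_inv[OF fc(1) K.inv_closed[OF fc(2)] j]
      by (cases b; cases d) (simp_all only: l_def fst_conv snd_conv v if_True if_False)
    then have "ev [(a, b), (c, d)] = ev [(c, d), (a, b)]" by (simp add: ev2)
    then show ?case unfolding ev_append by simp
  qed
  have eqv: "ev x = ev y" if "equivclp (raag_step E) x y" for x y
    using that by (induction rule: equivclp_induct) (auto dest: step)
  define h where "h C = ev (SOME w. w \<in> C)" for C
  have h: "h (cls w) = ev w" if "w \<in> raag_words V" for w
    using some_cls[OF that] eqv by (simp add: h_def)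
  show ?thesis
  proof (intro bexI ballI)
    show "h \<in> hom A K"
      by (rule homI) (auto simp: carrier_A h ev_closed mult_A ev_append)
    show "h (gen v) = f v" if "v \<in> V" for v
      using that f by (simp add: gen_def h) (simp add: ev_def l_def)
  qed
qed

lemma hom_eq_gens:
  assumes "group K" "f \<in> hom A K" "g \<in> hom A K" "\<And>v. v \<in> V \<Longrightarrow> f (gen v) = g (gen v)"
    "x \<in> carrier A"
  shows "f x = g x"
proof (rule hom_eq_on_generate[OF assms(1-3)])
  show "x \<in> generate A (gen ` V)" using assms(5) unfolding carrier_generate .
  show "gen ` V \<subseteq> carrier A" using gen_carrier by blast
qed (use assms(4) in blast)

section \<open>Subgroups generated by vertices, and retractions onto them\<close>

definition sub :: "'v set \<Rightarrow> 'v elt set" where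
  "sub U = generate A (gen ` U)"

lemma gens_carrier: "U \<subseteq> V \<Longrightarrow> gen ` U \<subseteq> carrier A"
  using gen_carrier by auto

lemma subgroup_sub: "U \<subseteq> V \<Longrightarrow> subgroup (sub U) A"
  unfolding sub_def by (rule generate_is_subgroup[OF gens_carrier])

lemma sub_carrier: "U \<subseteq> V \<Longrightarrow> x \<in> sub U \<Longrightarrow> x \<in> carrier A"
  by (rule subgroup.mem_carrier[OF subgroup_sub])

lemma sub_V: "sub V = carrier A"
  unfolding sub_def by (rule carrier_generate[symmetric])

lemma gen_sub: "v \<in> U \<Longrightarrow> gen v \<in> sub U"
  unfolding sub_def by (rule generate.incl[OF imageI])

lemma sub_mono: "U \<subseteq> W \<Longrightarrow> sub U \<subseteq> sub W"
  unfolding sub_def by (rule mono_generate[OF image_mono])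

lemma sub_closed:
  assumes "U \<subseteq> V" "x \<in> sub U" "y \<in> sub U"
  shows "x \<cdot> y \<in> sub U" "ginv x \<in> sub U"
  using subgroup.m_closed[OF subgroup_sub[OF assms(1)] assms(2,3)]
    subgroup.m_inv_closed[OF subgroup_sub[OF assms(1)] assms(2)] .

lemma sub_one: "\<epsilon> \<in> sub U"
  unfolding sub_def by (rule generate.one)

lemma sub_comm:
  assumes "U \<subseteq> V" "W \<subseteq> V" "\<And>u w. u \<in> U \<Longrightarrow> w \<in> W \<Longrightarrow> u = w \<or> (u, w) \<in> E"
    "x \<in> sub U" "y \<in> sub W"
  shows "x \<cdot> y = y \<cdot> x"
proof -
  have "gen u \<cdot> y = y \<cdot> gen u" if "u \<in> U" for u
  proof (rule comm_generate[OF gens_carrier[OF assms(2)], symmetric])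
    show "gen u \<in> carrier A" "y \<in> generate A (gen ` W)"
      using that assms(1,5) gen_carrier by (auto simp: sub_def)
    show "s \<cdot> gen u = gen u \<cdot> s" if "s \<in> gen ` W" for s
    proof -
      from that obtain w where w: "w \<in> W" "s = gen w" by blast
      then show ?thesis using assms(3)[OF \<open>u \<in> U\<close> w(1)] gen_comm[of u w] by auto
    qed
  qed
  then show ?thesis
    by (intro comm_generate[OF gens_carrier[OF assms(1)] sub_carrier[OF assms(2,5)] _
        assms(4)[unfolded sub_def]]) blast
qed

text \<open>It exists for every \<open>U\<close>, because a commutation relation stays true when one
  of its two generators is killed.\<close>

definition retr :: "'v set \<Rightarrow> 'v elt \<Rightarrow> 'v elt" where
  "retr U = (SOME h. h \<in> hom A A \<and> (\<forall>v\<in>V. h (gen v) = (if v \<in> U then gen v else \<epsilon>)))"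

lemma retr: "retr U \<in> hom A A" "v \<in> V \<Longrightarrow> retr U (gen v) = (if v \<in> U then gen v else \<epsilon>)"
proof -
  have "\<exists>h\<in>hom A A. \<forall>v\<in>V. h (gen v) = (if v \<in> U then gen v else \<epsilon>)"
  proof (rule lift_ex[OF group_A])
    fix v w assume "(v, w) \<in> E"
    then have "v \<in> V" "w \<in> V" "gen v \<cdot> gen w = gen w \<cdot> gen v" using E_sub gen_comm by auto
    then show "(if v \<in> U then gen v else \<epsilon>) \<cdot> (if w \<in> U then gen w else \<epsilon>)
      = (if w \<in> U then gen w else \<epsilon>) \<cdot> (if v \<in> U then gen v else \<epsilon>)"
      by (simp add: gen_carrier)
  qed (simp add: gen_carrier)
  then have "\<exists>h. h \<in> hom A A \<and> (\<forall>v\<in>V. h (gen v) = (if v \<in> U then gen v else \<epsilon>))" by blast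
  from someI_ex[OF this] show "retr U \<in> hom A A"
    "v \<in> V \<Longrightarrow> retr U (gen v) = (if v \<in> U then gen v else \<epsilon>)"
    unfolding retr_def by blast+
qed

lemma retr_carrier: "x \<in> carrier A \<Longrightarrow> retr U x \<in> carrier A"
  by (rule hom_in_carrier[OF retr(1)])

lemma retr_mult: "x \<in> carrier A \<Longrightarrow> y \<in> carrier A \<Longrightarrow> retr U (x \<cdot> y) = retr U x \<cdot> retr U y"
  by (rule hom_mult[OF retr(1)])

lemma retr_one: "retr U \<epsilon> = \<epsilon>"
  using hom_one[OF retr(1) group_A group_A] .

lemma retr_inv: "x \<in> carrier A \<Longrightarrow> retr U (ginv x) = ginv (retr U x)"
  using group_hom.hom_inv[of A A "retr U"] retr(1) group_A
  by (simp add: group_hom_def group_hom_axioms_def)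

lemma retr_sub: "U \<subseteq> V \<Longrightarrow> x \<in> carrier A \<Longrightarrow> retr U x \<in> sub U"
proof -
  assume U: "U \<subseteq> V" and x: "x \<in> carrier A"
  have "retr U ` gen ` V \<subseteq> sub U"
    using U retr(2)[of _ U] gen_sub sub_one by (auto split: if_splits)
  then have "retr U ` carrier A \<subseteq> sub U"
    using hom_generate_subset[OF group_A retr(1) gens_carrier[OF order_refl] subgroup_sub[OF U]]
    unfolding carrier_generate by blast
  then show ?thesis using x by blast
qed

lemma retr_retr:
  assumes "x \<in> carrier A" shows "retr U (retr W x) = retr (U \<inter> W) x"
proof -
  have "(retr U \<circ> retr W) x = retr (U \<inter> W) x"
    by (rule hom_eq_gens[OF group_A Group.hom_compose[OF retr(1) retr(1)] retr(1) _ assms])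
       (auto simp: retr(2) retr_one)
  then show ?thesis by simp
qed

lemma retr_id:
  assumes "U \<subseteq> W" "W \<subseteq> V" "x \<in> sub U" shows "retr W x = x"
proof -
  have "retr W x = (\<lambda>x. x) x"
    by (rule hom_eq_on_generate[OF group_A retr(1), of _ "gen ` U"])
       (use assms gen_carrier in \<open>auto simp: sub_def hom_def retr(2) subset_iff\<close>)
  then show ?thesis by simp
qed

lemma retr_empty: "x \<in> carrier A \<Longrightarrow> retr {} x = \<epsilon>"
proof -
  assume "x \<in> carrier A"
  then show ?thesis
    by (rule hom_eq_gens[OF group_A retr(1), of "\<lambda>_. \<epsilon>", rotated 2])
       (simp_all add: retr(2) hom_def)
qed

lemma retr_kill:
  assumes "U \<subseteq> V" "U \<inter> W = {}" "x \<in> sub U" shows "retr W x = \<epsilon>"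
proof -
  have x: "x \<in> carrier A" using sub_carrier assms by blast
  have "retr W x = retr W (retr U x)" by (simp only: retr_id[OF order_refl assms(1,3)])
  also have "\<dots> = retr {} x" using retr_retr[OF x] assms(2) by (metis Int_commute)
  finally show ?thesis using retr_empty[OF x] by simp
qed

text \<open>Two homomorphisms with commuting images multiply to a homomorphism, and the edges
  between \<open>U\<close> and \<open>W\<close> make the images commute.\<close>

lemma retr_Un:
  assumes "U \<union> W \<subseteq> V" "U \<inter> W = {}" "\<And>u w. u \<in> U \<Longrightarrow> w \<in> W \<Longrightarrow> (u, w) \<in> E" "x \<in> carrier A"
  shows "retr (U \<union> W) x = retr U x \<cdot> retr W x"
proof (rule hom_eq_gens[OF group_A retr(1) _ _ assms(4)])
  have UW: "U \<subseteq> V" "W \<subseteq> V" using assms by auto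
  show "(\<lambda>x. retr U x \<cdot> retr W x) \<in> hom A A"
  proof (rule homI)
    fix x y assume xy: "x \<in> carrier A" "y \<in> carrier A"
    have "retr U y \<cdot> retr W x = retr W x \<cdot> retr U y"
      using sub_comm[OF UW disjI2[OF assms(3)] retr_sub[OF UW(1) xy(2)] retr_sub[OF UW(2) xy(1)]] .
    then have "retr U x \<cdot> (retr U y \<cdot> retr W x) \<cdot> retr W y
        = retr U x \<cdot> (retr W x \<cdot> retr U y) \<cdot> retr W y" by simp
    then show "retr U (x \<cdot> y) \<cdot> retr W (x \<cdot> y)
        = retr U x \<cdot> retr W x \<cdot> (retr U y \<cdot> retr W y)"
      using xy retr_carrier by (simp add: retr_mult m_assoc)
  qed (simp add: retr_carrier)
  show "retr (U \<union> W) (gen v) = retr U (gen v) \<cdot> retr W (gen v)" if "v \<in> V" for v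
    using that assms(2) gen_carrier by (auto simp: retr(2))
qed

end

context raag
begin

text \<open>Van der Waerden's argument. Letters act on reduced words by \<open>lact\<close>; as
  edges within \<open>U\<close> stay inside blocks, this is an action of \<open>A\<close>. The
  element \<open>eval L\<close> carries the empty word to \<open>L\<close>, so \<open>L\<close> can
  be read off from its value.\<close>

lemma free_product_blocks:
  assumes U: "U \<subseteq> V" and blk: "\<And>u w. u \<in> U \<Longrightarrow> w \<in> U \<Longrightarrow> (u, w) \<in> E \<Longrightarrow> blk u = blk w"
    and H: "\<And>i. i \<in> I \<Longrightarrow> H i = sub {u \<in> U. blk u = i}"
  shows "free_product A I H"
proof -
  interpret subgroup_family A I H
  proof (intro subgroup_family.intro subgroup_family_axioms.intro group_A)
    fix i assume "i \<in> I"
    then show "subgroup (H i) A" unfolding H[OF \<open>i \<in> I\<close>] by (intro subgroup_sub) (use U in blast)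
  qed
  define R where "R = {L. reduced L}"
  define act where "act i h = restrict (lact i h) R" for i h
  let ?B = "BijGroup R"
  interpret B: group ?B by (rule group_BijGroup)
  have act_R: "act i h L \<in> R" if "i \<in> I" "h \<in> H i" "L \<in> R" for i h L
    using that lact_reduced by (simp add: act_def R_def)
  have act_act: "act i h (act i h' L) = act i (h \<cdot> h') L"
    if "i \<in> I" "h \<in> H i" "h' \<in> H i" "L \<in> R" for i h h' L
    using that lact_reduced lact_lact by (simp add: act_def R_def)
  have act_one: "act i \<epsilon> L = L" if "L \<in> R" for i L
    using that by (simp add: act_def)
  have act_Bij: "act i h \<in> Bij R" if i: "i \<in> I" "h \<in> H i" for i h
  proof -
    have "bij_betw (act i h) R R"
      by (rule bij_betw_byWitness[where f' = "act i (ginv h)"])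
         (use i act_R H_inv in \<open>auto simp: act_act act_one H_carrier\<close>)
    then show ?thesis by (simp add: Bij_def act_def)
  qed
  have carr: "act i h \<in> carrier ?B" if "i \<in> I" "h \<in> H i" for i h
    using act_Bij[OF that] by (simp add: BijGroup_def)
  have mult_act: "act i h \<otimes>\<^bsub>?B\<^esub> act i h' = act i (h \<cdot> h')"
    if "i \<in> I" "h \<in> H i" "h' \<in> H i" for i h h'
  proof
    fix L show "(act i h \<otimes>\<^bsub>?B\<^esub> act i h') L = act i (h \<cdot> h') L"
    proof (cases "L \<in> R")
      case True
      then show ?thesis using that act_Bij act_act
        by (simp add: BijGroup_def compose_def)
    next
      case False
      then show ?thesis using that act_Bij by (simp add: BijGroup_def compose_def act_def)
    qed
  qed
  have one_act: "act i \<epsilon> = \<one>\<^bsub>?B\<^esub>" for i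
    by (auto simp: BijGroup_def act_def fun_eq_iff restrict_def)
  \<comment> \<open>Generators outside the chosen blocks act trivially, which extends the action to
    all of \<open>A\<close>.\<close>
  define f where "f v = (if v \<in> U \<and> blk v \<in> I then act (blk v) (gen v) else \<one>\<^bsub>?B\<^esub>)" for v
  have gH: "gen u \<in> H (blk u)" if "u \<in> U" "blk u \<in> I" for u
    unfolding H[OF that(2)] by (rule gen_sub) (use that in simp)
  have fc: "f v \<in> carrier ?B" for v
    using carr gH by (simp add: f_def)
  have "\<exists>h\<in>hom A ?B. \<forall>v\<in>V. h (gen v) = f v"
  proof (rule lift_ex[OF B.is_group fc])
    fix v w assume e: "(v, w) \<in> E"
    show "f v \<otimes>\<^bsub>?B\<^esub> f w = f w \<otimes>\<^bsub>?B\<^esub> f v"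
    proof (cases "v \<in> U \<and> blk v \<in> I \<and> w \<in> U \<and> blk w \<in> I")
      case True
      then have b: "blk w = blk v" using blk e by metis
      then have "f v \<otimes>\<^bsub>?B\<^esub> f w = act (blk v) (gen v \<cdot> gen w)"
        using True mult_act gH by (metis f_def)
      moreover have "f w \<otimes>\<^bsub>?B\<^esub> f v = act (blk v) (gen w \<cdot> gen v)"
        using True mult_act gH b by (metis f_def)
      ultimately show ?thesis using gen_comm[OF e] by simp
    next
      case False
      then have "f v = \<one>\<^bsub>?B\<^esub> \<or> f w = \<one>\<^bsub>?B\<^esub>" unfolding f_def by argo
      then show ?thesis using fc[of v] fc[of w] by auto
    qed
  qed
  then obtain \<Phi> where \<Phi>: "\<Phi> \<in> hom A ?B" "\<And>v. v \<in> V \<Longrightarrow> \<Phi> (gen v) = f v" by blast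
  interpret h: group_hom A ?B \<Phi>
    by unfold_locales (rule \<Phi>(1))
  have \<Phi>_act: "\<Phi> h = act i h" if i: "i \<in> I" and "h \<in> H i" for i h
  proof -
    have UV: "{u \<in> U. blk u = i} \<subseteq> V" using U by blast
    from \<open>h \<in> H i\<close> have "h \<in> generate A (gen ` {u \<in> U. blk u = i})" by (simp add: H[OF i] sub_def)
    then have "h \<in> H i \<and> \<Phi> h = act i h"
    proof (induction h rule: generate.induct)
      case one show ?case using one_act H_one[OF i] by simp
    next
      case (incl h)
      then obtain u where u: "u \<in> U" "blk u = i" "h = gen u" by blast
      then show ?case using \<Phi>(2)[of u] U i gH[of u] by (auto simp: f_def)
    next
      case (inv h)
      then obtain u where u: "u \<in> U" "blk u = i" "h = gen u" by blast
      then have h: "h \<in> H i" "\<Phi> h = act i h" using \<Phi>(2)[of u] U i gH[of u] by (auto simp: f_def)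
      have hi: "ginv h \<in> H i" using h(1) H_inv[OF i] by simp
      have "act i (ginv h) \<otimes>\<^bsub>?B\<^esub> \<Phi> h = \<one>\<^bsub>?B\<^esub>"
        using mult_act[OF i hi h(1)] h one_act H_carrier[OF i h(1)] by simp
      then have "inv\<^bsub>?B\<^esub> (\<Phi> h) = act i (ginv h)"
        using B.inv_equality carr[OF i hi] carr[OF i h(1)] h(2) by simp
      then show ?case using hi h.hom_inv[OF H_carrier[OF i h(1)]] by simp
    next
      case (eng a b)
      then show ?case
        using mult_act[OF i, of a b] H_mult[OF i] H_carrier[OF i] by simp
    qed
    then show ?thesis by blast
  qed
  have eval_act: "\<Phi> (eval L) [] = L" if "reduced L" for L using that
  proof (induction L)
    case Nil
    then show ?case by (simp add: BijGroup_def R_def)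
  next
    case (Cons l L)
    then have l: "fst l \<in> I" "snd l \<in> H (fst l)" "reduced L" by (auto simp: reduced_Cons)
    have e: "eval L \<in> carrier A" using l eval_closed reduced_letters by blast
    have "\<Phi> (eval (l # L)) = act (fst l) (snd l) \<otimes>\<^bsub>?B\<^esub> \<Phi> (eval L)"
      using \<Phi>_act[OF l(1,2)] h.hom_mult[OF H_carrier[OF l(1,2)] e] by simp
    moreover have "\<Phi> (eval L) \<in> Bij R" using h.hom_closed[OF e] by (simp add: BijGroup_def)
    ultimately have "\<Phi> (eval (l # L)) [] = act (fst l) (snd l) (\<Phi> (eval L) [])"
      using act_Bij[OF l(1,2)] by (simp add: BijGroup_def compose_def R_def)
    also have "\<dots> = l # L" using Cons.IH[OF l(3)] l(3) lact_Cons_reduced[OF Cons.prems]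
      by (simp add: act_def R_def)
    finally show ?case .
  qed
  show ?thesis
    by unfold_locales (metis eval_act)
qed

lemma generate_blocks:
  assumes "U \<subseteq> V" "blk ` U \<subseteq> I"
    and H: "\<And>i. i \<in> I \<Longrightarrow> H i = sub {u \<in> U. blk u = i}"
  shows "generate A (\<Union>i\<in>I. H i) = sub U"
proof
  have "H i \<subseteq> sub U" if "i \<in> I" for i unfolding H[OF that] by (rule sub_mono) blast
  then show "generate A (\<Union>i\<in>I. H i) \<subseteq> sub U"
    by (intro generate_subgroup_incl[OF _ subgroup_sub[OF assms(1)]]) blast
  have "gen u \<in> H (blk u)" if "u \<in> U" for u
    using gen_sub[of u "{w \<in> U. blk w = blk u}"] that assms(2) H by auto
  then have "gen ` U \<subseteq> (\<Union>i\<in>I. H i)" using assms(2) by blast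
  then show "sub U \<subseteq> generate A (\<Union>i\<in>I. H i)"
    unfolding sub_def[of U] by (rule mono_generate)
qed

section \<open>Exponent sums and free subgroups\<close>

lemma expo_ex: "\<exists>h \<in> hom A integer_group. \<forall>v\<in>V. h (gen v) = (if v \<in> S then 1 else 0)"
  by (rule lift_ex) auto

definition expo :: "'v set \<Rightarrow> 'v elt \<Rightarrow> int" where
  "expo S = (SOME h. h \<in> hom A integer_group \<and> (\<forall>v\<in>V. h (gen v) = (if v \<in> S then 1 else 0)))"

lemma expo: "expo S \<in> hom A integer_group" "v \<in> V \<Longrightarrow> expo S (gen v) = (if v \<in> S then 1 else 0)"
proof -
  have "\<exists>h. h \<in> hom A integer_group \<and> (\<forall>v\<in>V. h (gen v) = (if v \<in> S then 1 else 0))"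
    using expo_ex by blast
  from someI_ex[OF this] show "expo S \<in> hom A integer_group"
    "v \<in> V \<Longrightarrow> expo S (gen v) = (if v \<in> S then 1 else 0)"
    unfolding expo_def by blast+
qed

lemma expo_hom: "group_hom A integer_group (expo S)"
  by (simp add: group_hom_def group_hom_axioms_def expo(1) group_A)

lemma expo_mult: "x \<in> carrier A \<Longrightarrow> y \<in> carrier A \<Longrightarrow> expo S (x \<cdot> y) = expo S x + expo S y"
  using hom_mult[OF expo(1)] by simp

lemma expo_one: "expo S \<epsilon> = 0"
  using group_hom.hom_one[OF expo_hom] by simp

lemma expo_inv: "x \<in> carrier A \<Longrightarrow> expo S (ginv x) = - expo S x"
  using group_hom.hom_inv[OF expo_hom] by simp

lemma expo_pow: "x \<in> carrier A \<Longrightarrow> expo S (x [^]\<^bsub>A\<^esub> (n::int)) = n * expo S x"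
  using group_hom.hom_int_pow[OF expo_hom, of x S n] by (simp add: mult.commute)

lemma expo_retr: "S \<subseteq> U \<Longrightarrow> x \<in> carrier A \<Longrightarrow> expo S (retr U x) = expo S x"
proof -
  assume S: "S \<subseteq> U" and x: "x \<in> carrier A"
  have "(expo S \<circ> retr U) x = expo S x"
    by (rule hom_eq_gens[OF group_integer_group Group.hom_compose[OF retr(1) expo(1)] expo(1) _ x])
       (use S in \<open>auto simp: retr(2) expo(2) expo_one\<close>)
  then show ?thesis by simp
qed

lemma gen_ne_one: "v \<in> V \<Longrightarrow> gen v \<noteq> \<epsilon>"
  using expo(2)[of v "{v}"] expo_one by auto

lemma free_sub:
  assumes "U \<subseteq> V" "\<And>u w. u \<in> U \<Longrightarrow> w \<in> U \<Longrightarrow> (u, w) \<notin> E"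
  shows "free_product A U (\<lambda>i. sub {i})"
    "generate A (\<Union>i\<in>U. sub {i}) = sub U"
proof -
  have "{u \<in> U. u = i} = {i}" if "i \<in> U" for i using that by blast
  then have H: "sub {i} = sub {u \<in> U. u = i}" if "i \<in> U" for i using that by simp
  show "free_product A U (\<lambda>i. sub {i})"
    by (rule free_product_blocks[OF assms(1) _ H]) (use assms(2) in blast)
  show "generate A (\<Union>i\<in>U. sub {i}) = sub U"
    by (rule generate_blocks[OF assms(1) _ H]) simp_all
qed

lemma free_sub_ct:
  assumes U: "U \<subseteq> V" "\<And>u w. u \<in> U \<Longrightarrow> w \<in> U \<Longrightarrow> (u, w) \<notin> E"
    and x: "x \<in> sub U" "x \<noteq> \<epsilon>" and y: "y \<in> sub U" "y \<cdot> x = x \<cdot> y"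
    and z: "z \<in> sub U" "z \<cdot> x = x \<cdot> z"
  shows "y \<cdot> z = z \<cdot> y"
proof -
  interpret F: free_product A U "\<lambda>i. sub {i}" by (rule free_sub[OF U])
  note P = free_sub(2)[OF U]
  show ?thesis
  proof (rule F.abelian_centralizers)
    show "x \<in> F.P" "y \<in> F.P" "z \<in> F.P" using P x y z by simp_all
    show "x \<noteq> \<epsilon>" "y \<cdot> x = x \<cdot> y" "z \<cdot> x = x \<cdot> z" by fact+
    fix i h k assume i: "i \<in> U" and hk: "h \<in> sub {i}" "k \<in> sub {i}"
    show "h \<cdot> k = k \<cdot> h"
      by (rule sub_comm[OF _ _ _ hk]) (use i U in auto)
  qed
qed

text \<open>The two products are distinct reduced words of length two.\<close>

lemma free_sub_noncomm:
  assumes U: "U \<subseteq> V" "\<And>u w. u \<in> U \<Longrightarrow> w \<in> U \<Longrightarrow> (u, w) \<notin> E" and vw: "v \<in> U" "w \<in> U" "v \<noteq> w"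
  shows "gen v \<cdot> gen w \<noteq> gen w \<cdot> gen v"
proof
  assume e: "gen v \<cdot> gen w = gen w \<cdot> gen v"
  interpret F: free_product A U "\<lambda>i. sub {i}" by (rule free_sub[OF U])
  have g: "gen v \<in> sub {v}" "gen w \<in> sub {w}"
    by (rule gen_sub, use vw in simp)+
  have n: "gen v \<noteq> \<epsilon>" "gen w \<noteq> \<epsilon>" "gen v \<in> carrier A" "gen w \<in> carrier A"
    using gen_ne_one gen_carrier vw U by auto
  have "[(v, gen v), (w, gen w)] = [(w, gen w), (v, gen v)]"
  proof (rule F.eval_unique)
    show "F.reduced [(v, gen v), (w, gen w)]" "F.reduced [(w, gen w), (v, gen v)]"
      using g n vw by (simp_all add: F.reduced_Cons)
  qed (use n e in simp)
  then show False using vw by simp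
qed

end

section \<open>Direct products of free groups\<close>

text \<open>Common ground of both constructions: \<open>C\<close> is empty for the group without
  centre, where \<open>Q\<close> is added outside \<open>W\<close>, and consists of the central
  generator for the other one. The blocks are ordered by strictly increasing rank.\<close>

locale raag_blocks = raag V E for V :: "'v set" and E +
  fixes k :: nat and B :: "nat \<Rightarrow> 'v set" and C :: "'v set"
  assumes B_sub: "i < k \<Longrightarrow> B i \<subseteq> V" and C_sub: "C \<subseteq> V"
    and B_disj: "i < k \<Longrightarrow> j < k \<Longrightarrow> i \<noteq> j \<Longrightarrow> B i \<inter> B j = {}"
    and B_C: "i < k \<Longrightarrow> B i \<inter> C = {}"
    and B_free: "i < k \<Longrightarrow> v \<in> B i \<Longrightarrow> w \<in> B i \<Longrightarrow> (v, w) \<notin> E"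
    and B_edge: "i < k \<Longrightarrow> j < k \<Longrightarrow> i \<noteq> j \<Longrightarrow> v \<in> B i \<Longrightarrow> w \<in> B j \<Longrightarrow> (v, w) \<in> E"
    and C_edge: "i < k \<Longrightarrow> v \<in> B i \<Longrightarrow> c \<in> C \<Longrightarrow> (v, c) \<in> E"
    and C_clique: "c \<in> C \<Longrightarrow> d \<in> C \<Longrightarrow> c \<noteq> d \<Longrightarrow> (c, d) \<in> E"
    and B_fin: "i < k \<Longrightarrow> finite (B i)"
    and B_card: "i < j \<Longrightarrow> j < k \<Longrightarrow> card (B i) < card (B j)"
    and B_two: "i < k \<Longrightarrow> 2 \<le> card (B i)"
begin

definition W :: "'v set" where "W = (\<Union>i<k. B i) \<union> C"

abbreviation D :: "'v elt set" where "D \<equiv> sub W"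

abbreviation p :: "nat \<Rightarrow> 'v elt \<Rightarrow> 'v elt" where
  "p i \<equiv> retr (B i)"

lemma W_sub: "W \<subseteq> V"
  using B_sub C_sub unfolding W_def by blast

lemma B_W: "i < k \<Longrightarrow> B i \<subseteq> W"
  by (auto simp: W_def)

lemma D_carrier: "x \<in> D \<Longrightarrow> x \<in> carrier A"
  by (rule sub_carrier[OF W_sub])

lemma p_D: "i < k \<Longrightarrow> x \<in> carrier A \<Longrightarrow> p i x \<in> D"
  by (rule subsetD[OF sub_mono[OF B_W] retr_sub[OF B_sub]])

lemma p_p: "i < k \<Longrightarrow> x \<in> carrier A \<Longrightarrow> p i (p i x) = p i x"
  by (simp add: retr_retr)

lemma p_p_ne: "i < k \<Longrightarrow> j < k \<Longrightarrow> i \<noteq> j \<Longrightarrow> x \<in> carrier A \<Longrightarrow> p i (p j x) = \<epsilon>"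
  using B_disj by (simp add: retr_retr retr_empty)

text \<open>The retractions onto the blocks and onto \<open>C\<close> multiply to the retraction
  onto \<open>W\<close>, which is built up one block at a time.\<close>

lemma D_eq_one:
  assumes x: "x \<in> D" "\<And>i. i < k \<Longrightarrow> p i x = \<epsilon>" "retr C x = \<epsilon>"
  shows "x = \<epsilon>"
proof -
  have xc: "x \<in> carrier A" using x D_carrier by blast
  have "n \<le> k \<Longrightarrow> retr ((\<Union>i<n. B i) \<union> C) x = \<epsilon>" for n
  proof (induction n)
    case 0 then show ?case using x by simp
  next
    case (Suc n)
    have BV: "B j \<subseteq> V" if "j \<le> n" for j using that Suc.prems B_sub by simp
    have eq: "(\<Union>i<Suc n. B i) \<union> C = B n \<union> ((\<Union>i<n. B i) \<union> C)" by (auto simp: less_Suc_eq)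
    have "retr (B n \<union> ((\<Union>i<n. B i) \<union> C)) x = p n x \<cdot> retr ((\<Union>i<n. B i) \<union> C) x"
    proof (rule retr_Un[OF _ _ _ xc])
      show "B n \<union> ((\<Union>i<n. B i) \<union> C) \<subseteq> V" using BV C_sub by (blast intro: less_imp_le)
      show "B n \<inter> ((\<Union>i<n. B i) \<union> C) = {}" 
      proof -
        have "B n \<inter> B j = {}" if "j < n" for j using B_disj[of n j] that Suc.prems by simp
        moreover have "B n \<inter> C = {}" using B_C[of n] Suc.prems by simp
        ultimately show ?thesis by blast
      qed
      show "(u, w) \<in> E" if "u \<in> B n" "w \<in> (\<Union>i<n. B i) \<union> C" for u w
        using that(2)
      proof
        assume "w \<in> (\<Union>i<n. B i)"
        then obtain j where "j < n" "w \<in> B j" by blast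
        then show ?thesis using B_edge[of n j u w] that(1) Suc.prems by simp
      qed (use C_edge[of n u w] that(1) Suc.prems in simp)
    qed
    then show ?case using Suc x by (simp add: eq)
  qed
  then have "retr W x = \<epsilon>" by (simp add: W_def)
  then show ?thesis using retr_id[OF order_refl W_sub x(1)] by simp
qed

lemma D_eqI:
  assumes x: "x \<in> D" "y \<in> D" "\<And>i. i < k \<Longrightarrow> p i x = p i y" "retr C x = retr C y"
  shows "x = y"
proof -
  have c: "x \<in> carrier A" "y \<in> carrier A" using x D_carrier by auto
  have "x \<cdot> ginv y = \<epsilon>"
  proof (rule D_eq_one)
    show "x \<cdot> ginv y \<in> D" using x sub_closed[OF W_sub] by blast
  qed (use c x in \<open>simp_all add: retr_mult retr_inv retr_carrier\<close>)
  then have "x \<cdot> ginv y \<cdot> y = \<epsilon> \<cdot> y" by simp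
  then show ?thesis using c by (simp add: m_assoc)
qed

text \<open>The \<open>C\<close>-coordinates commute by themselves, as \<open>C\<close> is a
  clique.\<close>

lemma D_comm:
  assumes x: "x \<in> D" "y \<in> D" "\<And>i. i < k \<Longrightarrow> p i x \<cdot> p i y = p i y \<cdot> p i x"
  shows "x \<cdot> y = y \<cdot> x"
proof (rule D_eqI)
  have c: "x \<in> carrier A" "y \<in> carrier A" using x D_carrier by auto
  show "x \<cdot> y \<in> D" "y \<cdot> x \<in> D" using x sub_closed[OF W_sub] by blast+
  show "p i (x \<cdot> y) = p i (y \<cdot> x)" if "i < k" for i using c x(3)[OF that] by (simp add: retr_mult)
  have "retr C x \<cdot> retr C y = retr C y \<cdot> retr C x"
    by (rule sub_comm[OF C_sub C_sub _ retr_sub[OF C_sub c(1)] retr_sub[OF C_sub c(2)]])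
       (use C_clique in blast)
  then show "retr C (x \<cdot> y) = retr C (y \<cdot> x)" using c by (simp add: retr_mult)
qed

lemma B_ct:
  assumes "i < k" "x \<in> sub (B i)" "x \<noteq> \<epsilon>" "y \<in> sub (B i)" "y \<cdot> x = x \<cdot> y" "z \<in> sub (B i)" "z \<cdot> x = x \<cdot> z"
  shows "y \<cdot> z = z \<cdot> y"
  by (rule free_sub_ct[OF B_sub[OF assms(1)] B_free[OF assms(1)] assms(2-7)])

lemma B_noncomm:
  assumes "i < k" obtains a b where "a \<in> sub (B i)" "b \<in> sub (B i)" "a \<cdot> b \<noteq> b \<cdot> a"
proof -
  obtain v w where "v \<in> B i" "w \<in> B i" "v \<noteq> w"
    using B_two[OF assms] card_le_Suc0_iff_eq[OF B_fin[OF assms]] by force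
  then show ?thesis
    using that[OF gen_sub gen_sub] free_sub_noncomm[OF B_sub[OF assms] B_free[OF assms]] by blast
qed

lemma comm_p_kill:
  assumes "i < k" "x \<in> carrier A" "y \<in> D" "p i y = \<epsilon>"
  shows "p i x \<cdot> y = y \<cdot> p i x"
proof (rule D_comm[OF p_D[OF assms(1,2)] assms(3)])
  fix j assume j: "j < k"
  have c: "y \<in> carrier A" "p i x \<in> carrier A" using assms D_carrier retr_carrier by auto
  show "p j (p i x) \<cdot> p j y = p j y \<cdot> p j (p i x)"
    using assms(1,2,4) j c by (cases "j = i") (simp_all add: p_p_ne retr_carrier)
qed

lemma p_split:
  assumes "i < k" "y \<in> D"
  obtains y' where "y' \<in> D" "p i y' = \<epsilon>" "y = p i y \<cdot> y'"
proof -
  have c: "y \<in> carrier A" "p i y \<in> carrier A" using assms D_carrier retr_carrier by auto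
  show ?thesis
  proof (rule that[of "ginv (p i y) \<cdot> y"])
    show "ginv (p i y) \<cdot> y \<in> D"
      using sub_closed[OF W_sub] p_D[OF assms(1) c(1)] assms(2) by blast
    show "p i (ginv (p i y) \<cdot> y) = \<epsilon>" using c assms(1) by (simp add: retr_mult retr_inv p_p)
    show "y = p i y \<cdot> (ginv (p i y) \<cdot> y)" using c by (simp add: mult_inv_cancel)
  qed
qed

text \<open>Parities of exponent sums are homomorphisms to Z/2, so agreement on the generators of
  the block propagates. They take the role of the abelianization when ranks are compared.\<close>

lemma expo_B_even:
  assumes \<alpha>: "\<And>x. x \<in> D \<Longrightarrow> \<alpha> x \<in> D" "\<And>x y. x \<in> D \<Longrightarrow> y \<in> D \<Longrightarrow> \<alpha> (x \<cdot> y) = \<alpha> x \<cdot> \<alpha> y"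
    and i: "i < k" and ev: "\<And>v. v \<in> B i \<Longrightarrow> even (expo S (\<alpha> (gen v)) - expo T (\<alpha> (gen v)))"
    and x: "x \<in> sub (B i)"
  shows "even (expo S (\<alpha> x) - expo T (\<alpha> x))"
proof -
  have BD: "sub (B i) \<subseteq> D" by (rule sub_mono[OF B_W[OF i]])
  have one: "\<alpha> \<epsilon> = \<epsilon>"
  proof -
    have "\<alpha> \<epsilon> \<in> carrier A" using \<alpha>(1)[OF sub_one] D_carrier by blast
    then show ?thesis using \<alpha>(2)[OF sub_one sub_one] by simp
  qed
  from x have "x \<in> generate A (gen ` B i)" by (simp add: sub_def)
  then have "x \<in> sub (B i) \<and> even (expo S (\<alpha> x) - expo T (\<alpha> x))"
  proof (induction x rule: generate.induct)
    case one show ?case by (simp add: \<open>\<alpha> \<epsilon> = \<epsilon>\<close> sub_one expo_one)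
  next
    case (incl h) then show ?case using ev gen_sub by blast
  next
    case (inv h)
    then obtain v where v: "v \<in> B i" "h = gen v" by blast
    have h: "h \<in> sub (B i)" "ginv h \<in> sub (B i)"
      using v gen_sub sub_closed(2)[OF B_sub[OF i]] by blast+
    then have hD: "h \<in> D" "ginv h \<in> D" using BD by auto
    have hc: "h \<in> carrier A" "\<alpha> h \<in> carrier A" "\<alpha> (ginv h) \<in> carrier A"
      using \<alpha>(1) hD D_carrier by auto
    have "\<alpha> (ginv h) \<cdot> \<alpha> h = \<epsilon>" using \<alpha>(2)[OF hD(2,1)] one hc by simp
    then have "\<alpha> (ginv h) = ginv (\<alpha> h)" using inv_equality[OF _ hc(2,3)] by simp
    then show ?case using h hc ev[OF v(1)] v(2) by (simp add: expo_inv)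
  next
    case (eng a b)
    then have ab: "a \<in> D" "b \<in> D" "a \<cdot> b \<in> sub (B i)"
      using BD sub_closed(1)[OF B_sub[OF i]] by blast+
    have "\<alpha> a \<in> carrier A" "\<alpha> b \<in> carrier A" using \<alpha>(1) ab D_carrier by auto
    then show ?case using eng ab \<alpha>(2)[OF ab(1,2)] by (simp add: expo_mult)
  qed
  then show ?thesis by blast
qed

text \<open>The composite \<open>p m \<circ> \<alpha>\<close> cannot be nontrivial both on the \<open>i\<close>-th factor and on an element that
  commutes with it: these images commute, and by commutative transitivity the \<open>m\<close>-th factor would
  be abelian.\<close>

theorem automorphism_preserves_blocks:
  assumes \<alpha>: "\<And>x. x \<in> D \<Longrightarrow> \<alpha> x \<in> D" "\<And>x y. x \<in> D \<Longrightarrow> y \<in> D \<Longrightarrow> \<alpha> (x \<cdot> y) = \<alpha> x \<cdot> \<alpha> y"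
    and inj: "inj_on \<alpha> D" and surj: "D \<subseteq> \<alpha> ` D"
    and m: "m < k" and y: "y \<in> D"
  shows "p m (\<alpha> y) = p m (\<alpha> (p m y))"
proof -
  let ?q = "\<lambda>m x. p m (\<alpha> x)"
  \<comment> \<open>\<open>M i m\<close> records that the i-th factor has nontrivial image in the
    m-th coordinate. The aim is to show that this forces m = i.\<close>
  define M where "M i m \<longleftrightarrow> (\<exists>x\<in>D. ?q m (p i x) \<noteq> \<epsilon>)" for i m
  have \<alpha>c: "\<alpha> x \<in> carrier A" if "x \<in> D" for x using \<alpha>(1) that D_carrier by blast
  have pD: "p i x \<in> D" if "i < k" "x \<in> D" for i x using p_D that D_carrier by blast
  have qs: "?q m x \<in> sub (B m)" if "m < k" "x \<in> D" for m x
    using retr_sub[OF B_sub[OF that(1)] \<alpha>c[OF that(2)]] .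
  have qc: "?q m x \<in> carrier A" if "x \<in> D" for m x
    using retr_carrier[OF \<alpha>c[OF that]] .
  have q_mult: "?q m (x \<cdot> y) = ?q m x \<cdot> ?q m y" if "x \<in> D" "y \<in> D" for m x y
    using \<alpha>(2)[OF that] \<alpha>c that by (simp add: retr_mult)
  have q_comm: "?q m x \<cdot> ?q m y = ?q m y \<cdot> ?q m x" if "x \<in> D" "y \<in> D" "x \<cdot> y = y \<cdot> x" for m x y
    using q_mult[OF that(1,2)] q_mult[OF that(2,1)] that(3) by metis
  have q_surj: "\<exists>x\<in>D. w = ?q m x" if "m < k" "w \<in> sub (B m)" for m w
  proof -
    have "w \<in> D" using that sub_mono[OF B_W] by blast
    then obtain x where "x \<in> D" "w = \<alpha> x" using surj by blast
    then show ?thesis using retr_id[OF order_refl B_sub[OF that(1)] that(2)] by metis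
  qed
  have key: "?q m y = \<epsilon>" if m: "m < k" and i: "i < k" and M: "M i m" and y: "y \<in> D" "p i y = \<epsilon>"
    for m i y
  proof (rule ccontr)
    assume v: "?q m y \<noteq> \<epsilon>"
    obtain x where x: "x \<in> D" "?q m (p i x) \<noteq> \<epsilon>" using M M_def by blast
    have q_kill: "?q m (p i z) \<cdot> ?q m z' = ?q m z' \<cdot> ?q m (p i z)"
      if "z \<in> D" "z' \<in> D" "p i z' = \<epsilon>" for z z'
      by (rule q_comm[OF pD[OF i that(1)] that(2) comm_p_kill[OF i D_carrier[OF that(1)] that(2,3)]])
    let ?u = "?q m (p i x)"
    have u: "?u \<in> sub (B m)" "?u \<in> carrier A"
      using qs[OF m pD[OF i x(1)]] qc[OF pD[OF i x(1)]] by blast+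
    \<comment> \<open>The i-th part of \<open>z\<close> commutes with \<open>?u\<close> by
      transitivity through \<open>?q m y\<close>, the complementary part because it already commutes
      with \<open>p i x\<close>. So \<open>?u\<close> would be central in the whole m-th
      factor.\<close>
    have all: "?q m z \<cdot> ?u = ?u \<cdot> ?q m z" if z: "z \<in> D" for z
    proof -
      obtain z' where z': "z' \<in> D" "p i z' = \<epsilon>" "z = p i z \<cdot> z'" using p_split[OF i z] by blast
      have piz: "p i z \<in> D" using pD[OF i z] .
      have 1: "?q m (p i z) \<cdot> ?u = ?u \<cdot> ?q m (p i z)"
        by (rule B_ct[OF m qs[OF m y(1)] v qs[OF m piz] q_kill[OF z y]
              u(1) q_kill[OF x(1) y]])
      have 2: "?q m z' \<cdot> ?u = ?u \<cdot> ?q m z'" using q_kill[OF x(1) z'(1,2)] by simp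
      have "?q m z = ?q m (p i z) \<cdot> ?q m z'" using q_mult[OF piz z'(1)] z'(3) by metis
      then show ?thesis using comm_mult[OF qc[OF piz] qc[OF z'(1)] u(2) 1 2] by metis
    qed
    obtain a b where ab: "a \<in> sub (B m)" "b \<in> sub (B m)" "a \<cdot> b \<noteq> b \<cdot> a"
      using B_noncomm[OF m] by blast
    obtain a' b' where ab': "a' \<in> D" "a = ?q m a'" "b' \<in> D" "b = ?q m b'"
      using q_surj[OF m ab(1)] q_surj[OF m ab(2)] by blast
    have "a \<cdot> ?u = ?u \<cdot> a" "b \<cdot> ?u = ?u \<cdot> b" using all ab' by simp_all
    then show False using B_ct[OF m u(1) x(2) ab(1) _ ab(2)] ab(3) by blast
  qed
  \<comment> \<open>Otherwise \<open>\<alpha>\<close> would embed the nonabelian i-th factor into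
    the abelian part \<open>C\<close>.\<close>
  have M_ex: "\<exists>m<k. M i m" if i: "i < k" for i
  proof (rule ccontr)
    assume no: "\<not> ?thesis"
    obtain a b where ab: "a \<in> sub (B i)" "b \<in> sub (B i)" "a \<cdot> b \<noteq> b \<cdot> a"
      using B_noncomm[OF i] by blast
    have abD: "a \<in> D" "b \<in> D" using ab sub_mono[OF B_W[OF i]] by auto
    have pa: "p i a = a" using retr_id[OF order_refl B_sub[OF i] ab(1)] .
    have "?q m a = \<epsilon>" if "m < k" for m using no that abD(1) pa unfolding M_def by metis
    then have "\<alpha> a \<cdot> \<alpha> b = \<alpha> b \<cdot> \<alpha> a"
      using D_comm[OF \<alpha>(1)[OF abD(1)] \<alpha>(1)[OF abD(2)]] qc[OF abD(2)] by simp
    then have "\<alpha> (a \<cdot> b) = \<alpha> (b \<cdot> a)" using \<alpha>(2) abD by simp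
    moreover have "a \<cdot> b \<in> D" "b \<cdot> a \<in> D" using sub_closed(1)[OF W_sub] abD by blast+
    ultimately show False using inj_onD[OF inj] ab(3) by blast
  qed
  have M_disj: False if h: "i < k" "j < k" "m < k" "i \<noteq> j" "M i m" "M j m" for i j m
  proof -
    obtain x where x: "x \<in> D" "?q m (p j x) \<noteq> \<epsilon>" using h(6) M_def by blast
    have "p i (p j x) = \<epsilon>" using p_p_ne h x D_carrier by simp
    then show False using key[OF h(3,1,5) pD[OF h(2) x(1)]] x(2) by blast
  qed
  \<comment> \<open>Subsets of \<open>B m\<close> are mod 2 characters of the m-th factor. The i-th
    factor surjects onto it, so restricting them to the generators of the i-th one is injective, and
    2^|B m| \<le> 2^|B i|.\<close>
  have rank: "m \<le> i" if i: "i < k" and m: "m < k" and M: "M i m" for i m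
  proof -
    define F where "F S = {v \<in> B i. odd (expo S (\<alpha> (gen v)))}" for S
    have sur: "\<exists>x\<in>sub (B i). x \<in> D \<and> w = ?q m x" if w: "w \<in> sub (B m)" for w
    proof -
      obtain x where x: "x \<in> D" "w = ?q m x" using q_surj[OF m w] by blast
      obtain x' where x': "x' \<in> D" "p i x' = \<epsilon>" "x = p i x \<cdot> x'" using p_split[OF i x(1)] by blast
      have "?q m x = ?q m (p i x) \<cdot> ?q m x'" using q_mult[OF pD[OF i x(1)] x'(1)] x'(3) by metis
      then have "w = ?q m (p i x)" using key[OF m i M x'(1,2)] x(2) qc[OF pD[OF i x(1)]] by simp
      then show ?thesis using pD[OF i x(1)] retr_sub[OF B_sub[OF i] D_carrier[OF x(1)]] by blast
    qed
    have "inj_on F (Pow (B m))"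
    proof (rule inj_onI)
      fix S T assume ST: "S \<in> Pow (B m)" "T \<in> Pow (B m)" "F S = F T"
      have ev: "even (expo S (\<alpha> (gen v)) - expo T (\<alpha> (gen v)))" if "v \<in> B i" for v
      proof -
        have "v \<in> F S \<longleftrightarrow> v \<in> F T" using ST(3) by simp
        then show ?thesis using that by (simp add: F_def)
      qed
      have "w \<in> S \<longleftrightarrow> w \<in> T" if w: "w \<in> B m" for w
      proof -
        obtain x where x: "x \<in> sub (B i)" "x \<in> D" "gen w = ?q m x" using sur[OF gen_sub[OF w]] by blast
        have "expo S (gen w) = expo S (\<alpha> x)" "expo T (gen w) = expo T (\<alpha> x)"
          using expo_retr[of S "B m", OF _ \<alpha>c[OF x(2)]] expo_retr[of T "B m", OF _ \<alpha>c[OF x(2)]] ST x(3)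
          by auto
        then have "even (expo S (gen w) - expo T (gen w))"
          using expo_B_even[of \<alpha>, OF \<alpha> i ev x(1)] by simp
        then show ?thesis using w B_sub[OF m] expo(2)[of w] by (auto split: if_splits)
      qed
      then show "S = T" using ST by blast
    qed
    moreover have "F ` Pow (B m) \<subseteq> Pow (B i)" by (auto simp: F_def)
    ultimately have "card (Pow (B m)) \<le> card (Pow (B i))"
      using card_inj_on_le B_fin[OF i] by blast
    then have "card (B m) \<le> card (B i)" using B_fin i m by (simp add: card_Pow)
    then show ?thesis using B_card[of i m] m by (cases "i < m") auto
  qed
  \<comment> \<open>If \<open>i\<close> reached some \<open>m < i\<close>, then by induction
    \<open>m\<close> reaches itself, and two different factors would have nontrivial image in the
    m-th one.\<close>
  have M_eq: "i < k \<Longrightarrow> m < k \<Longrightarrow> M i m \<Longrightarrow> m = i" for i m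
  proof (induction i arbitrary: m rule: less_induct)
    case (less i)
    show ?case
    proof (rule ccontr)
      assume "m \<noteq> i"
      then have "m < i" using rank[OF less.prems(1,2,3)] by simp
      obtain m' where "m' < k" "M m m'" using M_ex[OF less.prems(2)] by blast
      then have "M m m" using less.IH[OF \<open>m < i\<close> less.prems(2)] by blast
      then show False using M_disj[OF less.prems(1,2,2) _ less.prems(3)] \<open>m \<noteq> i\<close> by blast
    qed
  qed
  have "M m m" using M_ex[OF m] M_eq[OF m] by blast
  obtain y' where y': "y' \<in> D" "p m y' = \<epsilon>" "y = p m y \<cdot> y'" using p_split[OF m y] by blast
  have "?q m y = ?q m (p m y) \<cdot> ?q m y'" using q_mult[OF pD[OF m y] y'(1)] y'(3) by metis
  then show ?thesis using key[OF m m \<open>M m m\<close> y'(1,2)] qc[OF pD[OF m y]] by simp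
qed

end

section \<open>Automorphisms of the free product with a free abelian group\<close>

context free_product
begin

text \<open>After removing a left factor in \<open>H i\<close> and a right factor in \<open>H j\<close>, the normal form \<open>N\<close> of \<open>g\<close>
  starts in \<open>H j\<close> and ends in \<open>H i\<close>. Then replacing letters \<open>c\<close> in \<open>H j\<close> by \<open>N c N\<inverse>\<close> preserves
  reducedness, so that no single letter in \<open>H j\<close> arises unless \<open>N\<close> is empty.\<close>

lemma conj_generate:
  assumes I: "I = {i, j}" "i \<noteq> j" and c0: "c0 \<in> H j" "c0 \<noteq> \<one>" and g: "g \<in> P"
    and gen: "c0 \<in> generate G (H i \<union> (\<lambda>c. g \<otimes> c \<otimes> inv g) ` H j)"
  shows "\<exists>a\<in>H i. \<exists>c\<in>H j. g = a \<otimes> c"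
proof -
  have ij: "i \<in> I" "j \<in> I" using I by auto
  obtain Y where Y: "reduced Y" "eval Y = g" using P_eval g by blast
  have "\<exists>a Z. a \<in> H i \<and> reduced Z \<and> g = a \<otimes> eval Z \<and> (Z = [] \<or> fst (hd Z) = j)"
  proof (cases "Y = [] \<or> fst (hd Y) = j")
    case True
    then show ?thesis using Y H_one[OF ij(1)] P_carrier[OF g] by (metis l_one)
  next
    case False
    then obtain l Z where lZ: "Y = l # Z" by (cases Y) auto
    have l: "fst l \<in> I" "snd l \<in> H (fst l)" "reduced Z" "Z = [] \<or> fst l \<noteq> fst (hd Z)"
      using Y lZ by (auto simp: reduced_Cons)
    then have li: "fst l = i" using False lZ I by auto
    have "Z = [] \<or> fst (hd Z) \<in> I" using l(3) by (cases Z) (auto simp: reduced_Cons)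
    then have "Z = [] \<or> fst (hd Z) = j" using l(4) li I by auto
    then show ?thesis using l li Y lZ by auto
  qed
  then obtain a Z where a: "a \<in> H i" "reduced Z" "g = a \<otimes> eval Z" "Z = [] \<or> fst (hd Z) = j"
    by blast
  have "\<exists>c N. c \<in> H j \<and> reduced N \<and> eval Z = eval N \<otimes> c \<and> (N = [] \<or> fst (hd N) = j \<and> fst (last N) = i)"
  proof (cases "Z = [] \<or> fst (last Z) = i")
    case True
    then show ?thesis using a H_one[OF ij(2)] eval_closed[OF reduced_letters[OF a(2)]] by (metis r_one)
  next
    case False
    then obtain l N where lN: "Z = N @ [l]" by (metis rev_exhaust)
    have l: "fst l \<in> I" "snd l \<in> H (fst l)" "reduced N" "N = [] \<or> fst (last N) \<noteq> fst l"
      using a(2) lN by (auto simp: reduced_append reduced_Cons)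
    then have lj: "fst l = j" using False lN I by auto
    have "N = [] \<or> fst (last N) \<in> I"
      using l(3) by (cases N rule: rev_cases) (auto simp: reduced_append reduced_Cons)
    then have "N = [] \<or> fst (hd N) = j \<and> fst (last N) = i" using l(4) lj I a(4) lN by auto
    moreover have "eval Z = eval N \<otimes> snd l"
      using lN l reduced_letters H_carrier[OF l(1,2)] by (simp add: eval_append)
    ultimately show ?thesis using l lj by auto
  qed
  then obtain c N where c: "c \<in> H j" "reduced N" "eval Z = eval N \<otimes> c"
    "N = [] \<or> fst (hd N) = j \<and> fst (last N) = i" by blast
  let ?h = "eval N"
  have hc: "?h \<in> carrier G" "a \<in> carrier G" "c \<in> carrier G"
    using c a H_carrier ij by (auto intro: eval_closed reduced_letters)
  have ge: "g = a \<otimes> ?h \<otimes> c" using a(3) c(3) hc by (simp add: m_assoc)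
  show ?thesis
  proof (cases "N = []")
    case True
    then show ?thesis using ge a(1) c(1) hc by auto
  next
    case False
    then have hd: "fst (hd N) = j" "fst (last N) = i" using c by auto
    \<comment> \<open>With this, \<open>ev\<close> reads a word as an element of the subgroup
      generated by \<open>H i\<close> and the conjugate of \<open>H j\<close> by
      \<open>?h\<close>.\<close>
    define \<psi> where "\<psi> m x = (if m = i then x else ?h \<otimes> x \<otimes> inv ?h)" for m x
    have \<psi>c: "\<psi> m x \<in> carrier G" if "x \<in> carrier G" for m x using that hc by (simp add: \<psi>_def)
    have \<psi>m: "\<psi> m (x \<otimes> y) = \<psi> m x \<otimes> \<psi> m y" if "x \<in> carrier G" "y \<in> carrier G" for m x y
      using that hc by (simp add: \<psi>_def word_simps)
    have \<psi>1: "\<psi> m \<one> = \<one>" for m using hc by (simp add: \<psi>_def)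
    define ev where "ev L = foldr (\<lambda>l x. \<psi> (fst l) (snd l) \<otimes> x) L \<one>" for L
    have evc: "ev L \<in> carrier G" if "letters L" for L
      using that by (induction L) (auto simp: ev_def \<psi>c)
    have ev_lact: "ev (lact m x L) = \<psi> m x \<otimes> ev L" if m: "m \<in> I" "x \<in> H m" "reduced L" for m x L
    proof (cases L)
      case Nil
      then show ?thesis using H_carrier[OF m(1,2)] by (auto simp: lact_def ev_def \<psi>1 \<psi>c)
    next
      case (Cons l M)
      have cc: "snd l \<in> carrier G" "x \<in> carrier G" "ev M \<in> carrier G"
        using m Cons H_carrier reduced_letters evc by (auto simp: reduced_Cons)
      have evL: "ev L = \<psi> (fst l) (snd l) \<otimes> ev M" using Cons by (simp add: ev_def)
      have evC: "ev (l' # M') = \<psi> (fst l') (snd l') \<otimes> ev M'" for l' M' by (simp add: ev_def)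
      show ?thesis
      proof (cases "fst l = m")
        case True
        have "\<psi> m (x \<otimes> snd l) \<otimes> ev M = \<psi> m x \<otimes> ev L"
          using True cc evL \<psi>m \<psi>c by (simp add: m_assoc)
        then show ?thesis using True Cons cc \<psi>1[of m] evL \<psi>c
          by (auto simp: lact_def evC)
      next
        case False
        then show ?thesis using Cons cc \<psi>1 evL \<psi>c by (auto simp: lact_def evC)
      qed
    qed
    \<comment> \<open>\<open>T\<close> is stable under left multiplication by \<open>?S\<close> and
      contains the unit, hence contains all of \<open>generate G ?S\<close>. The passage from
      \<open>?h\<close> to \<open>g\<close> is harmless since \<open>a\<close> lies in
      \<open>H i\<close> and \<open>c\<close> in \<open>H j\<close>.\<close>
    define T where "T = ev ` {L. reduced L}"
    have T_left: "\<psi> m x \<otimes> t \<in> T" if m: "m \<in> I" "x \<in> H m" and t: "t \<in> T" for m x t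
    proof -
      from t obtain L where L: "reduced L" "t = ev L" by (auto simp: T_def)
      have "\<psi> m x \<otimes> t = ev (lact m x L)" using ev_lact[OF m L(1)] L(2) by simp
      then show ?thesis using lact_reduced[OF m L(1)] unfolding T_def by blast
    qed
    have Tc: "t \<in> carrier G" if "t \<in> T" for t
      using that evc reduced_letters by (auto simp: T_def)
    have T_i: "x \<otimes> t \<in> T" if "x \<in> H i" "t \<in> T" for x t
      using T_left[OF ij(1) that] by (simp add: \<psi>_def)
    have T_j: "?h \<otimes> x \<otimes> inv ?h \<otimes> t \<in> T" if "x \<in> H j" "t \<in> T" for x t
      using T_left[OF ij(2) that] I(2) by (simp add: \<psi>_def)
    have T_g: "g \<otimes> x \<otimes> inv g \<otimes> t \<in> T" if x: "x \<in> H j" and t: "t \<in> T" for x t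
    proof -
      let ?x = "c \<otimes> x \<otimes> inv c"
      have "?x \<in> H j" using c(1) x H_mult[OF ij(2)] H_inv[OF ij(2)] by blast
      then have "a \<otimes> (?h \<otimes> ?x \<otimes> inv ?h \<otimes> (inv a \<otimes> t)) \<in> T"
        using T_i T_j a(1) H_inv[OF ij(1)] t by blast
      moreover have "a \<otimes> (?h \<otimes> ?x \<otimes> inv ?h \<otimes> (inv a \<otimes> t)) = g \<otimes> x \<otimes> inv g \<otimes> t"
        using hc H_carrier[OF ij(2) x] Tc[OF t] unfolding ge by (simp add: word_simps)
      ultimately show ?thesis by simp
    qed
    let ?S = "H i \<union> (\<lambda>c. g \<otimes> c \<otimes> inv g) ` H j"
    have Sc: "?S \<subseteq> carrier G"
      using H_carrier[OF ij(1)] H_carrier[OF ij(2)] P_carrier[OF g] by auto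
    have S_left: "s \<otimes> t \<in> T" if "s \<in> ?S" "t \<in> T" for s t
      using that T_i T_g by blast
    have S_inv: "inv s \<in> ?S" if "s \<in> ?S" for s
      using that
    proof
      assume "s \<in> (\<lambda>c. g \<otimes> c \<otimes> inv g) ` H j"
      then obtain x where x: "x \<in> H j" "s = g \<otimes> x \<otimes> inv g" by blast
      then have "inv s = g \<otimes> inv x \<otimes> inv g"
        using H_carrier[OF ij(2) x(1)] P_carrier[OF g] by (simp add: word_simps)
      then show ?thesis using H_inv[OF ij(2) x(1)] by blast
    qed (use H_inv[OF ij(1)] in blast)
    have "\<forall>t\<in>T. x \<otimes> t \<in> T" if "x \<in> generate G ?S" for x using that
    proof (induction x rule: generate.induct)
      case one then show ?case using Tc by auto
    next
      case (incl s) then show ?case using S_left by blast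
    next
      case (inv s) then show ?case using S_left S_inv by blast
    next
      case (eng x y)
      have "x \<in> carrier G" "y \<in> carrier G" using eng generate_in_carrier[OF Sc] by auto
      then show ?case using eng Tc by (simp add: m_assoc)
    qed
    moreover have "\<one> \<in> T" unfolding T_def by (rule image_eqI[of _ _ "[]"]) (simp_all add: ev_def)
    moreover have c0c: "c0 \<in> carrier G" using H_carrier[OF ij(2) c0(1)] .
    ultimately have "c0 \<in> T" using gen by force
    then obtain L where L: "reduced L" "c0 = ev L" by (auto simp: T_def)
    \<comment> \<open>The substitution turns a reduced \<open>L\<close> into the normal form of
      \<open>ev L\<close>. Every letter from \<open>H j\<close> becomes a stretch of length at least
      three, since \<open>N\<close> is not empty.\<close>
    define sb where "sb l = (if fst l = i then [l] else N @ [l] @ invl N)" for l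
    have sb_red: "reduced (sb l) \<and> fst (hd (sb l)) = fst l \<and> fst (last (sb l)) = fst l
        \<and> sb l \<noteq> [] \<and> eval (sb l) = \<psi> (fst l) (snd l)"
      if l: "fst l \<in> I" "snd l \<in> H (fst l)" "snd l \<noteq> \<one>" for l
    proof (cases "fst l = i")
      case True
      then show ?thesis using l H_carrier[OF l(1,2)] by (simp add: sb_def reduced_Cons \<psi>_def)
    next
      case False
      then have lj: "fst l = j" using l I by auto
      have "reduced (N @ [l] @ invl N)"
        using c(2) False hd l lj I(2) by (auto simp: reduced_append reduced_Cons invl_reduced hd_invl)
      moreover have "eval (N @ [l] @ invl N) = ?h \<otimes> snd l \<otimes> inv ?h"
        using reduced_letters[OF c(2)] H_carrier[OF l(1,2)]
        by (simp add: eval_append letters_invl eval_invl eval_closed m_assoc)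
      ultimately show ?thesis using False hd lj \<open>N \<noteq> []\<close> by (simp add: sb_def \<psi>_def last_invl)
    qed
    have sub_red: "reduced (concat (map sb M)) \<and> eval (concat (map sb M)) = ev M
        \<and> (M \<noteq> [] \<longrightarrow> concat (map sb M) \<noteq> [] \<and> fst (hd (concat (map sb M))) = fst (hd M))"
      if "reduced M" for M using that
    proof (induction M)
      case Nil then show ?case by (simp add: ev_def)
    next
      case (Cons l M)
      have l: "fst l \<in> I" "snd l \<in> H (fst l)" "snd l \<noteq> \<one>" "reduced M" "M = [] \<or> fst l \<noteq> fst (hd M)"
        using Cons.prems by (auto simp: reduced_Cons)
      note s = sb_red[OF l(1-3)]
      have M: "reduced (concat (map sb M))" "eval (concat (map sb M)) = ev M"
        "M \<noteq> [] \<Longrightarrow> fst (hd (concat (map sb M))) = fst (hd M)"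
        using Cons.IH[OF l(4)] by auto
      have "reduced (sb l @ concat (map sb M))"
        unfolding reduced_append using s M l(5) by (cases "M = []") auto
      moreover have "eval (sb l @ concat (map sb M)) = ev (l # M)"
        using s M by (simp add: eval_append reduced_letters ev_def)
      ultimately show ?case using s by simp
    qed
    let ?M = "concat (map sb L)"
    have "?M = [(j, c0)]"
      using eval_eq_letter[of ?M c0 j] sub_red[OF L(1)] L(2) ij(2) c0 by simp
    moreover have "L \<noteq> []" using L(2) c0(2) by (auto simp: ev_def)
    then obtain l M where lM: "L = l # M" by (cases L) auto
    ultimately have "fst l = j" using sub_red[OF L(1)] by simp
    then have "length (sb l) \<ge> 3" using False I(2) by (cases N) (auto simp: sb_def)
    then have "length ?M \<ge> 3" using lM by simp
    then show ?thesis using \<open>?M = [(j, c0)]\<close> by simp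
  qed
qed

end

section \<open>The group D * Q and the images of its two factors\<close>

locale raag_free_square = raag_blocks V E k B "{}" for V :: "'v set" and E k B +
  fixes c1 c2 :: 'v
  assumes V_eq: "V = W \<union> {c1, c2}" and c_notin: "c1 \<notin> W" "c2 \<notin> W" "c1 \<noteq> c2"
    and c_edge: "(c1, c2) \<in> E" "(c2, c1) \<in> E"
    and no_edge: "w \<in> W \<Longrightarrow> c \<in> {c1, c2} \<Longrightarrow> (w, c) \<notin> E \<and> (c, w) \<notin> E"
    and k2: "2 \<le> k"
begin

abbreviation Q :: "'v elt set" where "Q \<equiv> sub {c1, c2}"

definition H :: "bool \<Rightarrow> 'v elt set" where "H b = (if b then D else Q)"

lemma c_V: "{c1, c2} \<subseteq> V" "c1 \<in> V" "c2 \<in> V"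
  using V_eq by auto

lemma Q_carrier: "x \<in> Q \<Longrightarrow> x \<in> carrier A"
  by (rule sub_carrier[OF c_V(1)])

lemma Q_comm: "x \<in> Q \<Longrightarrow> y \<in> Q \<Longrightarrow> x \<cdot> y = y \<cdot> x"
  by (rule sub_comm[OF c_V(1) c_V(1)]) (use c_edge in auto)

lemma H_blocks: "H b = sub {u \<in> V. (u \<in> W) = b}"
proof -
  have "{u \<in> V. u \<in> W} = W" "{u \<in> V. u \<notin> W} = {c1, c2}" using V_eq c_notin by auto
  then show ?thesis by (cases b) (simp_all add: H_def)
qed

sublocale fp: free_product A UNIV H
proof (rule free_product_blocks[OF order_refl _ H_blocks])
  fix u w assume "u \<in> V" "w \<in> V" "(u, w) \<in> E"
  then show "(u \<in> W) = (w \<in> W)" using no_edge V_eq by blast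
qed

lemma fp_P: "fp.P = carrier A"
  using generate_blocks[OF order_refl _ H_blocks, of UNIV] by (simp add: sub_V)

lemma D_subset_carrier: "D \<subseteq> carrier A" and Q_subset_carrier: "Q \<subseteq> carrier A"
  using D_carrier Q_carrier by auto

lemma eq_on_factors:
  assumes "group K" "f \<in> hom A K" "h \<in> hom A K" "\<And>x. x \<in> D \<Longrightarrow> f x = h x"
    "\<And>x. x \<in> Q \<Longrightarrow> f x = h x" "x \<in> carrier A"
  shows "f x = h x"
proof (rule hom_eq_gens[OF assms(1-3) _ assms(6)])
  fix v assume "v \<in> V"
  then have "gen v \<in> D \<or> gen v \<in> Q" using V_eq gen_sub by blast
  then show "f (gen v) = h (gen v)" using assms(4,5) by blast
qed

lemma conj_hom:
  assumes "f \<in> hom A A" "g \<in> carrier A" shows "(\<lambda>x. ginv g \<cdot> f x \<cdot> g) \<in> hom A A"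
  using assms by (intro homI) (simp_all add: hom_in_carrier hom_mult word_simps)

text \<open>An endomorphism preserving both factors commutes with the retractions onto them, so a
  preimage of an element of a factor can be retracted into that factor.\<close>

lemma factor_surj:
  assumes f: "f \<in> hom A A" "carrier A \<subseteq> f ` carrier A" "f ` D \<subseteq> D" "f ` Q \<subseteq> Q"
  shows "D \<subseteq> f ` D" "Q \<subseteq> f ` Q"
proof -
  have key: "sub U \<subseteq> f ` sub U" if U: "U \<subseteq> V" and
    e: "\<And>x. x \<in> D \<Longrightarrow> retr U (f x) = f (retr U x)" "\<And>x. x \<in> Q \<Longrightarrow> retr U (f x) = f (retr U x)" for U
  proof
    fix y assume y: "y \<in> sub U"
    then obtain x where x: "x \<in> carrier A" "y = f x" using f(2) sub_carrier[OF U] by blast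
    have "(retr U \<circ> f) x = (f \<circ> retr U) x"
      by (rule eq_on_factors[OF group_A Group.hom_compose[OF f(1) retr(1)]
          Group.hom_compose[OF retr(1) f(1)] _ _ x(1)]) (simp_all add: e)
    then have "y = f (retr U x)" using retr_id[OF order_refl U y] x by simp
    then show "y \<in> f ` sub U" using retr_sub[OF U x(1)] by blast
  qed
  have f1: "f \<epsilon> = \<epsilon>" using hom_one[OF f(1) group_A group_A] .
  have dis: "W \<inter> {c1, c2} = {}" "{c1, c2} \<inter> W = {}" using c_notin by auto
  show "D \<subseteq> f ` D"
  proof (rule key[OF W_sub])
    fix x assume "x \<in> D"
    then show "retr W (f x) = f (retr W x)"
      using f(3) retr_id[OF order_refl W_sub] by (simp add: image_subset_iff)
  next
    fix x assume "x \<in> Q"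
    then show "retr W (f x) = f (retr W x)"
      using f(4) retr_kill[OF c_V(1) dis(2)] f1 by (simp add: image_subset_iff)
  qed
  show "Q \<subseteq> f ` Q"
  proof (rule key[OF c_V(1)])
    fix x assume "x \<in> Q"
    then show "retr {c1, c2} (f x) = f (retr {c1, c2} x)"
      using f(4) retr_id[OF order_refl c_V(1)] by (simp add: image_subset_iff)
  next
    fix x assume "x \<in> D"
    then show "retr {c1, c2} (f x) = f (retr {c1, c2} x)"
      using f(3) retr_kill[OF W_sub dis(1)] f1 by (simp add: image_subset_iff)
  qed
qed

context
  fixes f assumes f: "f \<in> hom A A" "inj_on f (carrier A)" "carrier A \<subseteq> f ` carrier A"
begin

lemma f_carrier: "x \<in> carrier A \<Longrightarrow> f x \<in> carrier A"
  by (rule hom_in_carrier[OF f(1)])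

lemma f_mult: "x \<in> carrier A \<Longrightarrow> y \<in> carrier A \<Longrightarrow> f (x \<cdot> y) = f x \<cdot> f y"
  by (rule hom_mult[OF f(1)])

lemma f_one: "f \<epsilon> = \<epsilon>"
  using hom_one[OF f(1) group_A group_A] .

lemma f_comm_iff:
  assumes "x \<in> carrier A" "y \<in> carrier A" "g \<in> carrier A"
  shows "(ginv g \<cdot> f x \<cdot> g) \<cdot> (ginv g \<cdot> f y \<cdot> g) = (ginv g \<cdot> f y \<cdot> g) \<cdot> (ginv g \<cdot> f x \<cdot> g)
    \<longleftrightarrow> x \<cdot> y = y \<cdot> x"
proof -
  have "f x \<cdot> f y = f y \<cdot> f x \<longleftrightarrow> x \<cdot> y = y \<cdot> x"
    using f_mult[OF assms(1,2)] f_mult[OF assms(2,1)] inj_onD[OF f(2), of "x \<cdot> y" "y \<cdot> x"] assms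
    by fastforce
  then show ?thesis
    using comm_conj_iff[OF f_carrier[OF assms(1)] f_carrier[OF assms(2)] inv_closed[OF assms(3)]] assms(3)
    by simp
qed

lemma f_conj_ne_one:
  assumes "x \<in> carrier A" "x \<noteq> \<epsilon>" "g \<in> carrier A"
  shows "ginv g \<cdot> f x \<cdot> g \<noteq> \<epsilon>"
proof
  assume "ginv g \<cdot> f x \<cdot> g = \<epsilon>"
  then have "g \<cdot> (ginv g \<cdot> f x \<cdot> g) \<cdot> ginv g = \<epsilon>" using assms by simp
  then have "f x = f \<epsilon>" using assms f_carrier f_one by (simp add: word_simps)
  then show False using inj_onD[OF f(2)] assms by blast
qed

text \<open>The generator \<open>?x\<close> of block 0 commutes with a nonabelian group, so
  \<open>f ?x\<close> is neither hyperbolic nor conjugate into \<open>Q\<close>. Hence the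
  centralizer of \<open>?x\<close> goes into one conjugate of \<open>D\<close>. Since
  \<open>?y\<close> lies in it, the centralizer of \<open>?y\<close> goes into the same conjugate,
  and the two centralizers contain all blocks between them.\<close>

lemma image_D_conj: "\<exists>g\<in>carrier A. \<forall>x\<in>D. ginv g \<cdot> f x \<cdot> g \<in> D"
proof -
  have k: "0 < k" "1 < k" using k2 by auto
  obtain v where v: "v \<in> B 0" using B_two[OF k(1)] by (metis card.empty ex_in_conv not_numeral_le_zero)
  obtain w where w: "w \<in> B 1" using B_two[OF k(2)] by (metis card.empty ex_in_conv not_numeral_le_zero)
  let ?x = "gen v" and ?y = "gen w"
  have vw: "v \<in> V" "w \<in> V" using v w B_sub k by blast+
  have xy: "?x \<in> carrier A" "?y \<in> carrier A" "?x \<noteq> \<epsilon>" "?y \<noteq> \<epsilon>"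
    using gen_carrier gen_ne_one vw by blast+
  have xy_comm: "?y \<cdot> ?x = ?x \<cdot> ?y"
    using gen_comm[OF B_edge[OF k(1,2) _ v w]] by simp
  obtain a b where ab: "a \<in> sub (B 1)" "b \<in> sub (B 1)" "a \<cdot> b \<noteq> b \<cdot> a"
    using B_noncomm[OF k(2)] by blast
  have abc: "a \<in> carrier A" "b \<in> carrier A" using ab sub_carrier[OF B_sub[OF k(2)]] by blast+
  have ab_comm: "z \<cdot> ?x = ?x \<cdot> z" if "z \<in> sub (B 1)" for z
    by (rule sub_comm[OF B_sub[OF k(2)] B_sub[OF k(1)] _ that gen_sub[OF v]])
       (use B_edge[OF k(2,1)] in auto)
  have "f ?x \<in> fp.P" using fp_P f_carrier xy by blast
  then show ?thesis
  proof (cases rule: fp.conj_cyclic)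
    case (1 g)
    then show ?thesis using f_conj_ne_one[OF xy(1,3)] fp_P by blast
  next
    case (3 g T)
    have g: "g \<in> carrier A" using 3 fp_P by blast
    have "(ginv g \<cdot> f a \<cdot> g) \<cdot> (ginv g \<cdot> f b \<cdot> g) = (ginv g \<cdot> f b \<cdot> g) \<cdot> (ginv g \<cdot> f a \<cdot> g)"
    proof (rule fp.hyperbolic_centralizer_comm[OF 3(2)], unfold fp_P 3(3)[symmetric])
      show "ginv g \<cdot> f a \<cdot> g \<in> carrier A" "ginv g \<cdot> f b \<cdot> g \<in> carrier A"
        using g f_carrier abc by blast+
    qed (simp_all only: f_comm_iff[OF abc(1) xy(1) g] f_comm_iff[OF abc(2) xy(1) g] ab_comm[OF ab(1)]
        ab_comm[OF ab(2)])
    then show ?thesis using f_comm_iff[OF abc g] ab(3) by blast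
  next
    case (2 g j h)
    have g: "g \<in> carrier A" using 2 fp_P by blast
    have cent: "ginv g \<cdot> f z \<cdot> g \<in> H j" if z: "z \<in> carrier A" "z \<cdot> ?x = ?x \<cdot> z" for z
    proof (rule fp.elliptic_centralizer[OF 2(2-4)], unfold fp_P 2(5)[symmetric])
      show "ginv g \<cdot> f z \<cdot> g \<in> carrier A" using g f_carrier z by blast
    qed (simp only: f_comm_iff[OF z(1) xy(1) g] z(2))
    have j: "j = True"
    proof (rule ccontr)
      assume "j \<noteq> True"
      then have "ginv g \<cdot> f a \<cdot> g \<in> Q" "ginv g \<cdot> f b \<cdot> g \<in> Q"
        using cent[OF abc(1) ab_comm[OF ab(1)]] cent[OF abc(2) ab_comm[OF ab(2)]] by (simp_all add: H_def)
      then show False using Q_comm f_comm_iff[OF abc g] ab(3) by blast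
    qed
    have y: "ginv g \<cdot> f ?y \<cdot> g \<in> H True" "ginv g \<cdot> f ?y \<cdot> g \<noteq> \<epsilon>"
      using cent[OF xy(2) xy_comm] j f_conj_ne_one[OF xy(2,4) g] by simp_all
    have cent': "ginv g \<cdot> f z \<cdot> g \<in> H True" if z: "z \<in> carrier A" "z \<cdot> ?y = ?y \<cdot> z" for z
    proof (rule fp.elliptic_centralizer[OF _ y], unfold fp_P)
      show "ginv g \<cdot> f z \<cdot> g \<in> carrier A" using g f_carrier z by blast
    qed (simp_all only: f_comm_iff[OF z(1) xy(2) g] z(2) UNIV_I)
    have gens: "ginv g \<cdot> f (gen u) \<cdot> g \<in> D" if u: "u \<in> W" for u
    proof -
      obtain i where i: "i < k" "u \<in> B i" using u by (auto simp: W_def)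
      have uc: "gen u \<in> carrier A" using u W_sub gen_carrier by blast
      show ?thesis
      proof (cases "i = 0")
        case True
        then have "gen u \<cdot> ?y = ?y \<cdot> gen u" using gen_comm[OF B_edge[OF i(1) k(2) _ i(2) w]] by simp
        then show ?thesis using cent'[OF uc] by (simp add: H_def)
      next
        case False
        then have "gen u \<cdot> ?x = ?x \<cdot> gen u" using gen_comm[OF B_edge[OF i(1) k(1) _ i(2) v]] by simp
        then show ?thesis using cent[OF uc] j by (simp add: H_def)
      qed
    qed
    have "(\<lambda>x. ginv g \<cdot> f x \<cdot> g) ` generate A (gen ` W) \<subseteq> D"
      by (rule hom_generate_subset[OF group_A conj_hom[OF f(1) g] gens_carrier[OF W_sub] subgroup_sub[OF W_sub]])
         (use gens in blast)
    then show ?thesis using g unfolding sub_def by blast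
  qed
qed

text \<open>In the hyperbolic case a positive power of \<open>gen c2\<close> would be a power of
  \<open>gen c1\<close>, which exponent sums exclude. If the image were conjugate into
  \<open>D\<close>, the retraction onto \<open>Q\<close> would kill the images of both factors,
  against surjectivity.\<close>

lemma image_Q_conj:
  "\<exists>g\<in>carrier A. \<forall>x\<in>Q. ginv g \<cdot> f x \<cdot> g \<in> Q"
proof -
  let ?x = "gen c1" and ?y = "gen c2"
  have xy: "?x \<in> carrier A" "?y \<in> carrier A" "?x \<noteq> \<epsilon>"
    using gen_carrier gen_ne_one c_V by blast+
  have yx: "?y \<cdot> ?x = ?x \<cdot> ?y" using gen_comm c_edge by blast
  have "f ?x \<in> fp.P" using fp_P f_carrier xy by blast
  then show ?thesis
  proof (cases rule: fp.conj_cyclic)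
    case (1 g)
    then show ?thesis using f_conj_ne_one[OF xy(1,3)] fp_P by blast
  next
    case (3 g T)
    have g: "g \<in> carrier A" using 3 fp_P by blast
    let ?c = "\<lambda>x. ginv g \<cdot> f x \<cdot> g"
    interpret c: group_hom A A ?c
      using conj_hom[OF f(1) g] by (simp add: group_hom_def group_hom_axioms_def group_A)
    have "?c ?y \<in> fp.P" using fp_P c.hom_closed xy by blast
    moreover have "?c ?y \<cdot> fp.eval T = fp.eval T \<cdot> ?c ?y"
      unfolding 3(3)[symmetric] by (simp only: f_comm_iff[OF xy(2,1) g] yx)
    ultimately obtain m n :: int where mn: "m > 0" "?c ?y [^]\<^bsub>A\<^esub> m = fp.eval T [^]\<^bsub>A\<^esub> n"
      by (rule fp.hyperbolic_centralizer_root[OF 3(2)])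
    then have "?c (?y [^]\<^bsub>A\<^esub> m) = ?c (?x [^]\<^bsub>A\<^esub> n)"
      using 3(3) c.hom_int_pow xy by metis
    then have "?c (?y [^]\<^bsub>A\<^esub> m \<cdot> ginv (?x [^]\<^bsub>A\<^esub> n)) = \<epsilon>"
      using xy c.hom_mult[of "?y [^]\<^bsub>A\<^esub> m" "ginv (?x [^]\<^bsub>A\<^esub> n)"] c.hom_inv[of "?x [^]\<^bsub>A\<^esub> n"]
        c.hom_closed[of "?x [^]\<^bsub>A\<^esub> n"] by simp
    then have "?y [^]\<^bsub>A\<^esub> m \<cdot> ginv (?x [^]\<^bsub>A\<^esub> n) = \<epsilon>"
      using f_conj_ne_one[of "?y [^]\<^bsub>A\<^esub> m \<cdot> ginv (?x [^]\<^bsub>A\<^esub> n)" g] g xy by blast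
    then have "expo {c2} (?y [^]\<^bsub>A\<^esub> m \<cdot> ginv (?x [^]\<^bsub>A\<^esub> n)) = 0" by (simp add: expo_one)
    then have "m = 0" using xy c_V c_notin(3) by (simp add: expo_mult expo_inv expo_pow expo(2))
    then show ?thesis using mn by simp
  next
    case (2 g j h)
    have g: "g \<in> carrier A" using 2 fp_P by blast
    let ?c = "\<lambda>x. ginv g \<cdot> f x \<cdot> g"
    have c: "?c \<in> hom A A" by (rule conj_hom[OF f(1) g])
    have x: "?c ?x \<in> H j" using 2 by simp
    have y: "?c ?y \<in> H j"
    proof (rule fp.elliptic_centralizer[OF 2(2-4)], unfold fp_P 2(5)[symmetric])
      show "?c ?y \<in> carrier A" using g f_carrier xy by blast
    qed (simp only: f_comm_iff[OF xy(2,1) g] yx)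
    have Hj: "subgroup (H j) A" using fp.subgroup_H by blast
    have "?c ` generate A (gen ` {c1, c2}) \<subseteq> H j"
      by (rule hom_generate_subset[OF group_A c gens_carrier[OF c_V(1)] Hj]) (use x y in blast)
    then have all: "?c z \<in> H j" if "z \<in> Q" for z using that unfolding sub_def by blast
    have "j = False"
    proof (rule ccontr)
      assume "j \<noteq> False"
      then have inD: "?c z \<in> D" if "z \<in> Q" for z using all[OF that] by (simp add: H_def)
      obtain a where a: "a \<in> carrier A" "\<And>z. z \<in> D \<Longrightarrow> ginv a \<cdot> f z \<cdot> a \<in> D"
        using image_D_conj by blast
      have dis: "W \<inter> {c1, c2} = {}" using c_notin by auto
      let ?r = "retr {c1, c2}"
      have kill: "?r (f z) = \<epsilon>" if u: "u \<in> carrier A" "z \<in> carrier A" "ginv u \<cdot> f z \<cdot> u \<in> D" for u z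
      proof -
        have fz: "f z \<in> carrier A" using f_carrier u by blast
        have "f z = u \<cdot> (ginv u \<cdot> f z \<cdot> u) \<cdot> ginv u" using u fz by (simp add: word_simps)
        also have "?r \<dots> = ?r u \<cdot> ?r (ginv u \<cdot> f z \<cdot> u) \<cdot> ginv (?r u)"
          using u fz by (simp only: retr_mult retr_inv m_closed inv_closed)
        also have "\<dots> = \<epsilon>" using retr_kill[OF W_sub dis u(3)] retr_carrier[OF u(1)] by simp
        finally show ?thesis .
      qed
      have triv: "(?r \<circ> f) z = (\<lambda>_. \<epsilon>) z" if "z \<in> carrier A" for z
      proof (rule eq_on_factors[OF group_A Group.hom_compose[OF f(1) retr(1)] _ _ _ that])
        show "(\<lambda>_. \<epsilon>) \<in> hom A A" by (simp add: hom_def)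
        show "(?r \<circ> f) z = \<epsilon>" if "z \<in> D" for z using kill[OF a(1) D_carrier[OF that] a(2)[OF that]] by simp
        show "(?r \<circ> f) z = \<epsilon>" if "z \<in> Q" for z using kill[OF g Q_carrier[OF that] inD[OF that]] by simp
      qed
      obtain z where "z \<in> carrier A" "?x = f z" using f(3) xy by blast
      then have "?r ?x = \<epsilon>" using triv by simp
      then show False using retr(2)[OF c_V(2)] xy by simp
    qed
    then show ?thesis using all g by (auto simp: H_def)
  qed
qed

text \<open>Conjugation by \<open>a\<close> corrects \<open>f\<close> on \<open>D\<close>,
  conjugation by \<open>b\<close> on \<open>Q\<close>. By surjectivity, \<open>D\<close> and the
  conjugate of \<open>Q\<close> by \<open>?g = ginv a \<cdot> b\<close> generate \<open>A\<close>,
  so \<open>conj_generate\<close> gives \<open>?g = d \<cdot> c\<close>. Then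
  \<open>a \<cdot> d\<close> serves both factors, since \<open>d\<close> normalizes \<open>D\<close>
  and \<open>c\<close> normalizes \<open>Q\<close>.\<close>

theorem automorphism_decomposition:
  "\<exists>x\<in>carrier A. (\<lambda>y. ginv x \<cdot> f y \<cdot> x) ` D = D \<and> (\<lambda>y. ginv x \<cdot> f y \<cdot> x) ` Q = Q"
proof -
  obtain a where a: "a \<in> carrier A" "\<And>z. z \<in> D \<Longrightarrow> ginv a \<cdot> f z \<cdot> a \<in> D"
    using image_D_conj by blast
  obtain b where b: "b \<in> carrier A" "\<And>z. z \<in> Q \<Longrightarrow> ginv b \<cdot> f z \<cdot> b \<in> Q"
    using image_Q_conj by blast
  have conj_surj: "carrier A \<subseteq> (\<lambda>y. ginv x \<cdot> f y \<cdot> x) ` carrier A" if x: "x \<in> carrier A" for x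
  proof
    fix z assume z: "z \<in> carrier A"
    have "x \<cdot> z \<cdot> ginv x \<in> carrier A" using x z by simp
    then obtain y where y: "y \<in> carrier A" "x \<cdot> z \<cdot> ginv x = f y" using f(3) by blast
    have "z = ginv x \<cdot> f y \<cdot> x" unfolding y(2)[symmetric] using x z by (simp add: word_simps)
    then show "z \<in> (\<lambda>y. ginv x \<cdot> f y \<cdot> x) ` carrier A" using y by blast
  qed
  let ?g = "ginv a \<cdot> b" and ?f = "\<lambda>y. ginv a \<cdot> f y \<cdot> a"
  have gc: "?g \<in> carrier A" using a b by simp
  let ?S = "D \<union> (\<lambda>c. ?g \<cdot> c \<cdot> ginv ?g) ` Q"
  have Sc: "?S \<subseteq> carrier A" using D_carrier Q_carrier gc by auto
  have "?f ` generate A (gen ` V) \<subseteq> generate A ?S"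
  proof (rule hom_generate_subset[OF group_A conj_hom[OF f(1) a(1)] gens_carrier[OF order_refl]
        generate_is_subgroup[OF Sc]])
    have "?f (gen v) \<in> ?S" if "v \<in> V" for v
    proof (cases "v \<in> W")
      case True
      then show ?thesis using a(2)[OF gen_sub] by blast
    next
      case False
      then have q: "gen v \<in> Q" using that V_eq gen_sub by blast
      have "?f (gen v) = ?g \<cdot> (ginv b \<cdot> f (gen v) \<cdot> b) \<cdot> ginv ?g"
        using a(1) b(1) f_carrier[OF Q_carrier[OF q]] by (simp add: word_simps)
      then show ?thesis using b(2)[OF q] by blast
    qed
    then show "?f ` gen ` V \<subseteq> generate A ?S" using generate.incl[of _ ?S A] by blast
  qed
  then have "gen c1 \<in> generate A ?S"
    using conj_surj[OF a(1)] gen_carrier[OF c_V(2)] unfolding carrier_generate[symmetric] by blast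
  moreover have "gen c1 \<in> Q" by (rule gen_sub) simp
  ultimately have "\<exists>d\<in>H True. \<exists>c\<in>H False. ?g = d \<cdot> c"
  proof (intro fp.conj_generate[of True False "gen c1"])
    show "?g \<in> fp.P" unfolding fp_P by (rule gc)
    show "gen c1 \<noteq> \<epsilon>" by (rule gen_ne_one[OF c_V(2)])
  qed (auto simp: H_def)
  then obtain d c where dc: "d \<in> D" "c \<in> Q" "?g = d \<cdot> c" by (auto simp: H_def)
  have dcc: "d \<in> carrier A" "c \<in> carrier A" using dc D_carrier Q_carrier by auto
  let ?x = "a \<cdot> d" and ?f' = "\<lambda>y. ginv (a \<cdot> d) \<cdot> f y \<cdot> (a \<cdot> d)"
  have x: "?x \<in> carrier A" using a dcc by simp
  have D': "?f' ` D \<subseteq> D"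
  proof (rule image_subsetI)
    fix z assume z: "z \<in> D"
    have "ginv d \<cdot> ?f z \<cdot> d \<in> D" using sub_closed[OF W_sub] a(2)[OF z] dc(1) by blast
    moreover have "ginv d \<cdot> ?f z \<cdot> d = ?f' z"
      using a(1) dcc f_carrier[OF D_carrier[OF z]] by (simp add: word_simps)
    ultimately show "?f' z \<in> D" by simp
  qed
  have "b = a \<cdot> ?g" using a b by (simp add: mult_inv_cancel)
  then have be: "b = a \<cdot> d \<cdot> c" using dc(3) a dcc by (simp add: m_assoc)
  have Q': "?f' ` Q \<subseteq> Q"
  proof (rule image_subsetI)
    fix z assume z: "z \<in> Q"
    have "c \<cdot> (ginv b \<cdot> f z \<cdot> b) \<cdot> ginv c \<in> Q"
      using sub_closed[OF c_V(1)] b(2)[OF z] dc(2) by blast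
    moreover have "c \<cdot> (ginv b \<cdot> f z \<cdot> b) \<cdot> ginv c = ?f' z"
      unfolding be using a(1) dcc f_carrier[OF Q_carrier[OF z]] by (simp add: word_simps)
    ultimately show "?f' z \<in> Q" by simp
  qed
  show ?thesis using factor_surj[OF conj_hom[OF f(1) x] conj_surj[OF x] D' Q'] D' Q' x by blast
qed

end

end

section \<open>Outer automorphisms of automorphism groups\<close>

context group
begin

definition cj :: "'a \<Rightarrow> 'a \<Rightarrow> 'a" where
  "cj g = (\<lambda>x\<in>carrier G. g \<otimes> x \<otimes> inv g)"

lemma inn_eq: "inn G = cj ` carrier G"
  unfolding inn_def cj_def by blast

lemma carrier_AutoGroup: "carrier (AutoGroup G) = auto G"
  by (simp add: AutoGroup_def)

lemma auto_closed: "g \<in> auto G \<Longrightarrow> x \<in> carrier G \<Longrightarrow> g x \<in> carrier G"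
  by (auto simp: auto_def hom_def)

lemma auto_mult: "g \<in> auto G \<Longrightarrow> x \<in> carrier G \<Longrightarrow> y \<in> carrier G \<Longrightarrow> g (x \<otimes> y) = g x \<otimes> g y"
  by (auto simp: auto_def hom_def)

lemma auto_inv: "g \<in> auto G \<Longrightarrow> x \<in> carrier G \<Longrightarrow> g (inv x) = inv (g x)"
  using group_hom.hom_inv[of G G g x] is_group by (simp add: auto_def group_hom_def group_hom_axioms_def)

lemma auto_bij: "g \<in> auto G \<Longrightarrow> bij_betw g (carrier G) (carrier G)"
  by (auto simp: auto_def Bij_def)

lemma auto_m_closed: "g \<in> auto G \<Longrightarrow> h \<in> auto G \<Longrightarrow> g \<otimes>\<^bsub>AutoGroup G\<^esub> h \<in> auto G"
  using monoid.m_closed[OF group.is_monoid[OF AutoGroup], of g h] by (simp add: carrier_AutoGroup)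

lemma auto_apply:
  "g \<in> auto G \<Longrightarrow> h \<in> auto G \<Longrightarrow> x \<in> carrier G \<Longrightarrow> (g \<otimes>\<^bsub>AutoGroup G\<^esub> h) x = g (h x)"
  by (simp add: AutoGroup_def BijGroup_def auto_def compose_def)

lemma auto_one_apply: "x \<in> carrier G \<Longrightarrow> \<one>\<^bsub>AutoGroup G\<^esub> x = x"
  by (simp add: AutoGroup_def BijGroup_def)

lemma auto_eqI:
  assumes "g \<in> auto G" "h \<in> auto G" "\<And>x. x \<in> carrier G \<Longrightarrow> g x = h x"
  shows "g = h"
  by (rule extensionalityI[of _ "carrier G"]) (use assms in \<open>auto simp: auto_def Bij_def\<close>)

lemma restrict_auto:
  assumes "f \<in> hom G G" "\<And>x. x \<in> carrier G \<Longrightarrow> f' x \<in> carrier G"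
    "\<And>x. x \<in> carrier G \<Longrightarrow> f' (f x) = x" "\<And>x. x \<in> carrier G \<Longrightarrow> f (f' x) = x"
  shows "restrict f (carrier G) \<in> auto G"
proof -
  have "bij_betw (restrict f (carrier G)) (carrier G) (carrier G)"
    by (rule bij_betw_byWitness[where f' = f']) (use assms hom_in_carrier[OF assms(1)] in auto)
  moreover have "restrict f (carrier G) \<in> hom G G" using assms(1) by (auto simp: hom_def)
  ultimately show ?thesis by (simp add: auto_def Bij_def)
qed

lemma cj_apply: "x \<in> carrier G \<Longrightarrow> cj g x = g \<otimes> x \<otimes> inv g"
  by (simp add: cj_def)

lemma cj_auto: "g \<in> carrier G \<Longrightarrow> cj g \<in> auto G"
  unfolding cj_def
  by (rule restrict_auto[where f' = "\<lambda>x. inv g \<otimes> x \<otimes> g"])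
     (auto simp: word_simps intro!: homI)

lemma cj_mult:
  assumes "g \<in> carrier G" "h \<in> carrier G"
  shows "cj (g \<otimes> h) = cj g \<otimes>\<^bsub>AutoGroup G\<^esub> cj h"
proof (rule auto_eqI)
  show "cj g \<otimes>\<^bsub>AutoGroup G\<^esub> cj h \<in> auto G"
    using assms by (simp add: auto_m_closed cj_auto)
qed (use assms cj_auto in \<open>simp_all add: auto_apply cj_apply word_simps\<close>)

lemma cj_hom: "cj \<in> hom G (AutoGroup G)"
  by (rule homI) (simp_all add: carrier_AutoGroup cj_auto cj_mult)

lemma auto_cj: "g \<in> auto G \<Longrightarrow> x \<in> carrier G \<Longrightarrow> g \<otimes>\<^bsub>AutoGroup G\<^esub> cj x = cj (g x) \<otimes>\<^bsub>AutoGroup G\<^esub> g"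
  by (rule auto_eqI)
     (simp_all add: auto_m_closed cj_auto auto_closed auto_apply cj_apply auto_mult auto_inv)

text \<open>The hypothesis \<open>dist\<close> asks for one inequality only: passing to
  \<open>inv h\<close> exchanges \<open>s\<close> and \<open>t\<close>, and antisymmetry separates
  the classes.\<close>

lemma Out_exceeds:
  fixes F :: "'i::order set"
  assumes F: "finite F" "N < card F" "\<And>s. s \<in> F \<Longrightarrow> \<Theta> s \<in> auto G"
    and dist: "\<And>s t h. s \<in> F \<Longrightarrow> t \<in> F \<Longrightarrow> h \<in> carrier G \<Longrightarrow>
      (\<And>g. g \<in> carrier G \<Longrightarrow> \<Theta> s g = h \<otimes> \<Theta> t g \<otimes> inv h) \<Longrightarrow> s \<le> t"
  shows "order_exceeds (Out G) N"
proof -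
  let ?c = "\<lambda>x. inn G #>\<^bsub>AutoGroup G\<^esub> x"
  have carr: "carrier (Out G) = ?c ` auto G"
    by (simp add: Out_def carrier_FactGroup carrier_AutoGroup)
  have "inj_on (\<lambda>s. ?c (\<Theta> s)) F"
  proof (rule inj_onI)
    fix s t assume st: "s \<in> F" "t \<in> F" "?c (\<Theta> s) = ?c (\<Theta> t)"
    have "cj \<one> \<otimes>\<^bsub>AutoGroup G\<^esub> \<Theta> s = \<Theta> s"
      using F(3)[OF st(1)] auto_m_closed cj_auto
      by (intro auto_eqI) (simp_all add: auto_apply cj_apply auto_closed)
    moreover have "cj \<one> \<in> inn G" unfolding inn_eq by (rule imageI) simp
    ultimately have "\<Theta> s \<in> ?c (\<Theta> s)"
      unfolding r_coset_def by (intro UN_I[of "cj \<one>"]) simp_all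
    then have "\<Theta> s \<in> ?c (\<Theta> t)" by (simp only: st(3))
    then obtain h where h: "h \<in> carrier G" "\<Theta> s = cj h \<otimes>\<^bsub>AutoGroup G\<^esub> \<Theta> t"
      unfolding r_coset_def inn_eq by blast
    have e: "\<Theta> s g = h \<otimes> \<Theta> t g \<otimes> inv h" if g: "g \<in> carrier G" for g
      unfolding h(2) using F(3)[OF st(2)] g h(1) by (simp add: auto_apply cj_auto cj_apply auto_closed)
    have e': "\<Theta> t g = inv h \<otimes> \<Theta> s g \<otimes> inv (inv h)" if g: "g \<in> carrier G" for g
      unfolding e[OF g] using auto_closed[OF F(3)[OF st(2)] g] h(1) by (simp add: word_simps)
    show "s = t"
      by (rule order_antisym[OF dist[OF st(1,2) h(1) e] dist[OF st(2,1) inv_closed[OF h(1)] e']])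
  qed
  then have "card ((\<lambda>s. ?c (\<Theta> s)) ` F) = card F" by (rule card_image)
  moreover have "(\<lambda>s. ?c (\<Theta> s)) ` F \<subseteq> carrier (Out G)" using F(3) carr by blast
  ultimately show ?thesis
    unfolding order_exceeds_def using F(2) card_mono[of "carrier (Out G)" "(\<lambda>s. ?c (\<Theta> s)) ` F"]
    by linarith
qed

end

section \<open>Exchanging the normal factor of a semidirect product\<close>

text \<open>The assumption \<open>swap\<close> makes \<open>\<Theta>\<close> an involution: it says that \<open>\<Theta>\<close> maps \<open>\<tau> x\<close> back to
  \<open>\<iota> x\<close>.\<close>

locale semidirect_swap = A: group A + G: group G
  for A :: "('a, 'c) monoid_scheme" (structure) and G :: "('b, 'd) monoid_scheme" (structure) +
  fixes \<iota> \<tau> :: "'a \<Rightarrow> 'b" and S :: "'b set" and X0 :: "'a set"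
  assumes hom_iota: "\<iota> \<in> hom A G" and hom_tau: "\<tau> \<in> hom A G" and subgroup_S: "subgroup S G"
    and act: "q \<in> S \<Longrightarrow> x \<in> carrier A \<Longrightarrow>
      \<exists>y\<in>carrier A. q \<otimes>\<^bsub>G\<^esub> \<iota> x = \<iota> y \<otimes>\<^bsub>G\<^esub> q \<and> q \<otimes>\<^bsub>G\<^esub> \<tau> x = \<tau> y \<otimes>\<^bsub>G\<^esub> q"
    and span: "g \<in> carrier G \<Longrightarrow> \<exists>x\<in>carrier A. \<exists>q\<in>S. g = \<iota> x \<otimes>\<^bsub>G\<^esub> q"
    and indep: "x \<in> carrier A \<Longrightarrow> \<iota> x \<in> S \<Longrightarrow> x = \<one>\<^bsub>A\<^esub>"
    and X0: "X0 \<subseteq> carrier A" "carrier A = generate A X0"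
    and swap: "x \<in> X0 \<Longrightarrow>
      \<exists>y\<in>carrier A. \<exists>q\<in>S. \<tau> x = \<iota> y \<otimes>\<^bsub>G\<^esub> q \<and> \<tau> y \<otimes>\<^bsub>G\<^esub> q = \<iota> x"
begin

abbreviation gm :: "'b \<Rightarrow> 'b \<Rightarrow> 'b" (infixl "\<bullet>" 70) where "g \<bullet> h \<equiv> g \<otimes>\<^bsub>G\<^esub> h"

sublocale i: group_hom A G \<iota>
  by (simp add: group_hom_def group_hom_axioms_def hom_iota A.is_group G.is_group)

sublocale t: group_hom A G \<tau>
  by (simp add: group_hom_def group_hom_axioms_def hom_tau A.is_group G.is_group)

lemma S_carrier: "q \<in> S \<Longrightarrow> q \<in> carrier G"
  by (rule subgroup.mem_carrier[OF subgroup_S])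

text \<open>\<open>G\<close> is the semidirect product of the image of \<open>\<iota>\<close> with
  \<open>S\<close>. The map fixes \<open>S\<close> and replaces \<open>\<iota>\<close> by
  \<open>\<tau>\<close>; by \<open>unique\<close> the choice is determined.\<close>

definition \<Theta> :: "'b \<Rightarrow> 'b" where
  "\<Theta> g = (SOME h. \<exists>x\<in>carrier A. \<exists>q\<in>S. g = \<iota> x \<bullet> q \<and> h = \<tau> x \<bullet> q)"

lemma unique:
  assumes "x \<in> carrier A" "x' \<in> carrier A" "q \<in> S" "q' \<in> S" "\<iota> x \<bullet> q = \<iota> x' \<bullet> q'"
  shows "x = x' \<and> q = q'"
proof -
  have c: "q \<in> carrier G" "q' \<in> carrier G" "\<iota> x \<in> carrier G" "\<iota> x' \<in> carrier G"
    using assms S_carrier by simp_all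
  have "\<iota> (inv\<^bsub>A\<^esub> x' \<otimes>\<^bsub>A\<^esub> x) = inv\<^bsub>G\<^esub> (\<iota> x') \<bullet> (\<iota> x \<bullet> q) \<bullet> inv\<^bsub>G\<^esub> q"
    using assms(1,2) c by (simp add: G.word_simps)
  also have "\<dots> = q' \<bullet> inv\<^bsub>G\<^esub> q" unfolding assms(5) using c by (simp add: G.word_simps)
  also have "\<dots> \<in> S" using assms subgroup_S by (simp add: subgroup.m_closed subgroup.m_inv_closed)
  finally have "inv\<^bsub>A\<^esub> x' \<otimes>\<^bsub>A\<^esub> x = \<one>\<^bsub>A\<^esub>" using indep assms by simp
  then have "x' \<otimes>\<^bsub>A\<^esub> (inv\<^bsub>A\<^esub> x' \<otimes>\<^bsub>A\<^esub> x) = x'" using assms by simp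
  then have "x = x'" using assms by (simp add: A.word_simps)
  then show ?thesis using assms(5) c by simp
qed

lemma Theta: "x \<in> carrier A \<Longrightarrow> q \<in> S \<Longrightarrow> \<Theta> (\<iota> x \<bullet> q) = \<tau> x \<bullet> q"
  unfolding \<Theta>_def by (rule some_equality) (use unique in blast)+

lemma Theta_iota: "x \<in> carrier A \<Longrightarrow> \<Theta> (\<iota> x) = \<tau> x"
  using Theta[OF _ subgroup.one_closed[OF subgroup_S], of x] by simp

lemma Theta_closed: "g \<in> carrier G \<Longrightarrow> \<Theta> g \<in> carrier G"
  using span[of g] Theta S_carrier by auto

text \<open>The same \<open>y\<close> serves to move \<open>q\<close> past \<open>\<iota> x'\<close>
  and past \<open>\<tau> x'\<close>, which is the point of \<open>act\<close>.\<close>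

lemma Theta_mult:
  assumes "g \<in> carrier G" "h \<in> carrier G" shows "\<Theta> (g \<bullet> h) = \<Theta> g \<bullet> \<Theta> h"
proof -
  obtain x q where x: "x \<in> carrier A" "q \<in> S" "g = \<iota> x \<bullet> q" using span assms(1) by blast
  obtain x' q' where x': "x' \<in> carrier A" "q' \<in> S" "h = \<iota> x' \<bullet> q'" using span assms(2) by blast
  obtain y where y: "y \<in> carrier A" "q \<bullet> \<iota> x' = \<iota> y \<bullet> q" "q \<bullet> \<tau> x' = \<tau> y \<bullet> q"
    using act[OF x(2) x'(1)] by blast
  have c: "q \<in> carrier G" "q' \<in> carrier G" using x x' S_carrier by auto
  have qq: "q \<bullet> q' \<in> S" using x x' subgroup_S by (simp add: subgroup.m_closed)
  have "g \<bullet> h = \<iota> x \<bullet> (q \<bullet> \<iota> x') \<bullet> q'" using x x' c by (simp add: G.m_assoc)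
  also have "\<dots> = \<iota> (x \<otimes>\<^bsub>A\<^esub> y) \<bullet> (q \<bullet> q')" unfolding y(2) using x y c by (simp add: G.m_assoc)
  finally have "\<Theta> (g \<bullet> h) = \<tau> (x \<otimes>\<^bsub>A\<^esub> y) \<bullet> (q \<bullet> q')" 
    by (simp only: Theta[OF A.m_closed[OF x(1) y(1)] qq])
  also have "\<dots> = \<tau> x \<bullet> (q \<bullet> \<tau> x') \<bullet> q'" unfolding y(3) using x y c by (simp add: G.m_assoc)
  also have "\<dots> = \<Theta> g \<bullet> \<Theta> h" using x x' c Theta by (simp add: G.m_assoc)
  finally show ?thesis .
qed

lemma Theta_hom: "\<Theta> \<in> hom G G"
  by (rule homI) (simp_all add: Theta_closed Theta_mult)

text \<open>Both sides are homomorphisms in \<open>x\<close>, so the exchange has to be verified on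
  the generating set \<open>X0\<close> only.\<close>

lemma Theta_tau: "x \<in> carrier A \<Longrightarrow> \<Theta> (\<tau> x) = \<iota> x"
proof -
  assume x: "x \<in> carrier A"
  have "(\<Theta> \<circ> \<tau>) x = \<iota> x"
  proof (rule A.hom_eq_on_generate[OF G.is_group Group.hom_compose[OF hom_tau Theta_hom] hom_iota X0(1)])
    show "x \<in> generate A X0" using x X0(2) by simp
    fix s assume "s \<in> X0"
    then obtain y q where y: "y \<in> carrier A" "q \<in> S" "\<tau> s = \<iota> y \<bullet> q" "\<tau> y \<bullet> q = \<iota> s"
      using swap by blast
    then show "(\<Theta> \<circ> \<tau>) s = \<iota> s" using Theta by simp
  qed
  then show ?thesis by simp
qed

lemma Theta_Theta:
  assumes "g \<in> carrier G" shows "\<Theta> (\<Theta> g) = g"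
proof -
  obtain x q where x: "x \<in> carrier A" "q \<in> S" "g = \<iota> x \<bullet> q" using span assms by blast
  have q: "\<Theta> q = q" using Theta[OF A.one_closed x(2)] S_carrier[OF x(2)] by simp
  have "\<Theta> (\<Theta> g) = \<Theta> (\<tau> x) \<bullet> \<Theta> q" using x Theta Theta_mult S_carrier by simp
  then show ?thesis using Theta_tau x q by simp
qed

lemma Theta_auto: "restrict \<Theta> (carrier G) \<in> auto G"
  by (rule G.restrict_auto[OF Theta_hom Theta_closed Theta_Theta Theta_Theta])

end

section \<open>Projections to sets of coordinates\<close>

context raag_blocks
begin

text \<open>Indices from \<open>k\<close> on are dropped, so that \<open>- S\<close> can denote the
  complementary coordinates.\<close>

definition blocks :: "nat set \<Rightarrow> 'v set" where "blocks S = (\<Union>i\<in>S \<inter> {..<k}. B i)"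

abbreviation pr :: "nat set \<Rightarrow> 'v elt \<Rightarrow> 'v elt" where
  "pr S \<equiv> retr (blocks S)"

lemma blocks_sub: "blocks S \<subseteq> V" and blocks_W: "blocks S \<subseteq> W"
  using B_sub by (auto simp: blocks_def W_def)

lemma blocks_Un: "blocks (S \<union> T) = blocks S \<union> blocks T"
  by (auto simp: blocks_def)

lemma blocks_Int: "blocks S \<inter> blocks T = blocks (S \<inter> T)"
proof
  show "blocks S \<inter> blocks T \<subseteq> blocks (S \<inter> T)"
  proof
    fix v assume "v \<in> blocks S \<inter> blocks T"
    then obtain i j where ij: "i \<in> S" "i < k" "v \<in> B i" "j \<in> T" "j < k" "v \<in> B j"
      by (auto simp: blocks_def)
    then have "i = j" using B_disj[of i j] by blast
    then show "v \<in> blocks (S \<inter> T)" using ij by (auto simp: blocks_def)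
  qed
qed (auto simp: blocks_def)

lemma blocks_empty: "blocks {} = {}"
  by (simp add: blocks_def)

lemma blocks_edge:
  assumes "S \<inter> T = {}" "u \<in> blocks S" "w \<in> blocks T" shows "(u, w) \<in> E"
proof -
  obtain i j where "i \<in> S" "i < k" "u \<in> B i" "j \<in> T" "j < k" "w \<in> B j"
    using assms(2,3) by (auto simp: blocks_def)
  moreover from this have "i \<noteq> j" using assms(1) by blast
  ultimately show ?thesis using B_edge by blast
qed

lemma pr_pr: "x \<in> carrier A \<Longrightarrow> pr S (pr T x) = pr (S \<inter> T) x"
  by (simp add: retr_retr blocks_Int)

lemma pr_Un: "S \<inter> T = {} \<Longrightarrow> x \<in> carrier A \<Longrightarrow> pr (S \<union> T) x = pr S x \<cdot> pr T x"
  unfolding blocks_Un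
  by (rule retr_Un) (use blocks_sub blocks_Int blocks_empty blocks_edge in auto)

lemma pr_empty: "x \<in> carrier A \<Longrightarrow> pr {} x = \<epsilon>"
  by (simp add: blocks_empty retr_empty)

lemma pr_comm:
  assumes "S \<inter> T = {}" "x \<in> carrier A" "y \<in> carrier A" shows "pr S x \<cdot> pr T y = pr T y \<cdot> pr S x"
  by (rule sub_comm[OF blocks_sub blocks_sub _ retr_sub[OF blocks_sub assms(2)] retr_sub[OF blocks_sub assms(3)]])
     (use blocks_edge[OF assms(1)] in blast)

lemma pr_D: "x \<in> carrier A \<Longrightarrow> pr S x \<in> D"
  by (rule subsetD[OF sub_mono[OF blocks_W] retr_sub[OF blocks_sub]])

lemma p_pr: "i < k \<Longrightarrow> x \<in> carrier A \<Longrightarrow> p i (pr S x) = (if i \<in> S then p i x else \<epsilon>)"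
proof -
  assume i: "i < k" "x \<in> carrier A"
  then have "B i = blocks {i}" by (auto simp: blocks_def)
  then have "p i (pr S x) = pr ({i} \<inter> S) x" using pr_pr[OF i(2), of "{i}" S] by simp
  then show ?thesis using i \<open>B i = blocks {i}\<close> pr_empty by auto
qed

text \<open>Only block coordinates are compared: in the presence of \<open>C\<close> the two
  elements may differ by a factor in \<open>sub C\<close>.\<close>

lemma pr_automorphism:
  assumes \<alpha>: "\<And>x. x \<in> D \<Longrightarrow> \<alpha> x \<in> D" "\<And>x y. x \<in> D \<Longrightarrow> y \<in> D \<Longrightarrow> \<alpha> (x \<cdot> y) = \<alpha> x \<cdot> \<alpha> y"
    and inj: "inj_on \<alpha> D" and surj: "D \<subseteq> \<alpha> ` D" and y: "y \<in> D" and i: "i < k"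
  shows "p i (\<alpha> (pr S y)) = p i (pr S (\<alpha> y))"
proof -
  have blk: "p i (\<alpha> z) = p i (\<alpha> (p i z))" if "z \<in> D" for z
    by (rule automorphism_preserves_blocks) (fact \<alpha> inj surj i that)+
  have c: "y \<in> carrier A" "\<alpha> y \<in> carrier A" "pr S y \<in> D" using y \<alpha>(1) D_carrier pr_D by auto
  have one: "\<alpha> \<epsilon> = \<epsilon>"
  proof -
    have "\<alpha> \<epsilon> \<in> carrier A" using \<alpha>(1)[OF sub_one] D_carrier by blast
    then show ?thesis using \<alpha>(2)[OF sub_one sub_one] by simp
  qed
  have "p i (\<alpha> (pr S y)) = p i (\<alpha> (p i (pr S y)))" by (rule blk[OF c(3)])
  also have "\<dots> = p i (pr S (\<alpha> y))"
    using p_pr[OF i c(1)] p_pr[OF i c(2)] blk[OF y] one retr_one by auto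
  finally show ?thesis .
qed

end

section \<open>Partial conjugations and the stabilizer of both factors\<close>

context raag_free_square
begin

text \<open>For \<open>u\<close> and \<open>w\<close> in \<open>D\<close> it carries the conjugate
  of \<open>Q\<close> by \<open>a\<close> to the one by
  \<open>u \<cdot> a \<cdot> ginv u \<cdot> w\<close>, an element of the holomorph acting on the
  index \<open>a\<close>. The restriction makes the function extensional, as \<open>auto\<close>
  demands.\<close>

definition pc where
  "pc u w = restrict (SOME h. h \<in> hom A A \<and> (\<forall>x\<in>D. h x = u \<cdot> x \<cdot> ginv u) \<and> (\<forall>x\<in>Q. h x = w \<cdot> x \<cdot> ginv w))
     (carrier A)"

lemma conj_left_hom: "g \<in> carrier A \<Longrightarrow> (\<lambda>x. g \<cdot> x \<cdot> ginv g) \<in> hom A A"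
  by (rule homI) (simp_all add: word_simps)

lemma pc_ex:
  assumes u: "u \<in> carrier A" and w: "w \<in> carrier A"
  shows "\<exists>h. h \<in> hom A A \<and> (\<forall>x\<in>D. h x = u \<cdot> x \<cdot> ginv u) \<and> (\<forall>x\<in>Q. h x = w \<cdot> x \<cdot> ginv w)"
proof -
  define f where "f v = (if v \<in> W then u \<cdot> gen v \<cdot> ginv u else w \<cdot> gen v \<cdot> ginv w)" for v
  have "\<exists>h\<in>hom A A. \<forall>v\<in>V. h (gen v) = f v"
  proof (rule lift_ex[OF group_A])
    fix a b assume e: "(a, b) \<in> E"
    then have ab: "a \<in> V" "b \<in> V" using E_sub by auto
    then have "a \<in> W \<longleftrightarrow> b \<in> W" using no_edge e V_eq by blast
    moreover note gen_comm[OF e]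
    ultimately show "f a \<cdot> f b = f b \<cdot> f a"
      using comm_conj_iff[OF gen_carrier[OF ab(1)] gen_carrier[OF ab(2)] u]
        comm_conj_iff[OF gen_carrier[OF ab(1)] gen_carrier[OF ab(2)] w]
      unfolding f_def by (cases "a \<in> W") simp_all
  qed (simp add: f_def u w gen_carrier)
  then obtain h where h: "h \<in> hom A A" "\<And>v. v \<in> V \<Longrightarrow> h (gen v) = f v" by blast
  have "h x = u \<cdot> x \<cdot> ginv u" if "x \<in> D" for x
    by (rule hom_eq_on_generate[OF group_A h(1) conj_left_hom[OF u] gens_carrier[OF W_sub] _
          that[unfolded sub_def]]) (use h(2) W_sub in \<open>auto simp: f_def subset_iff\<close>)
  moreover have "h x = w \<cdot> x \<cdot> ginv w" if "x \<in> Q" for x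
    by (rule hom_eq_on_generate[OF group_A h(1) conj_left_hom[OF w] gens_carrier[OF c_V(1)] _
          that[unfolded sub_def]]) (use h(2) c_V c_notin in \<open>auto simp: f_def\<close>)
  ultimately show ?thesis using h(1) by blast
qed

lemma pc:
  assumes "u \<in> carrier A" "w \<in> carrier A"
  shows "pc u w \<in> hom A A" "x \<in> D \<Longrightarrow> pc u w x = u \<cdot> x \<cdot> ginv u" "x \<in> Q \<Longrightarrow> pc u w x = w \<cdot> x \<cdot> ginv w"
proof -
  obtain h where h: "pc u w = restrict h (carrier A)" "h \<in> hom A A"
    "\<And>x. x \<in> D \<Longrightarrow> h x = u \<cdot> x \<cdot> ginv u" "\<And>x. x \<in> Q \<Longrightarrow> h x = w \<cdot> x \<cdot> ginv w"
    using someI_ex[OF pc_ex[OF assms]] unfolding pc_def by blast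
  show "pc u w \<in> hom A A"
    unfolding h(1) by (intro homI) (simp_all add: hom_in_carrier[OF h(2)] hom_mult[OF h(2)])
  show "x \<in> D \<Longrightarrow> pc u w x = u \<cdot> x \<cdot> ginv u" using h(3) D_carrier by (simp add: h(1))
  show "x \<in> Q \<Longrightarrow> pc u w x = w \<cdot> x \<cdot> ginv w" using h(4) Q_carrier by (simp add: h(1))
qed

lemma D_closed: "x \<in> D \<Longrightarrow> y \<in> D \<Longrightarrow> x \<cdot> y \<in> D" "x \<in> D \<Longrightarrow> ginv x \<in> D"
  by (rule sub_closed(1)[OF W_sub], assumption+) (rule sub_closed(2)[OF W_sub], assumption+)

lemma id_hom: "(\<lambda>x. x) \<in> hom A A"
  by (simp add: hom_def)

text \<open>On \<open>Q\<close> the conjugator \<open>w'\<close> of the inner map lies in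
  \<open>D\<close> and is therefore itself conjugated by \<open>u\<close>.\<close>

lemma pc_pc:
  assumes u: "u \<in> D" "w \<in> D" "u' \<in> D" "w' \<in> D"
  shows "x \<in> D \<Longrightarrow> pc u w (pc u' w' x) = (u \<cdot> u') \<cdot> x \<cdot> ginv (u \<cdot> u')"
    "x \<in> Q \<Longrightarrow> pc u w (pc u' w' x)
      = (u \<cdot> w' \<cdot> ginv u \<cdot> w) \<cdot> x \<cdot> ginv (u \<cdot> w' \<cdot> ginv u \<cdot> w)"
proof -
  have c: "u \<in> carrier A" "w \<in> carrier A" "u' \<in> carrier A" "w' \<in> carrier A"
    using u D_carrier by auto
  show "pc u w (pc u' w' x) = (u \<cdot> u') \<cdot> x \<cdot> ginv (u \<cdot> u')" if x: "x \<in> D"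
  proof -
    have "u' \<cdot> x \<cdot> ginv u' \<in> D" by (intro D_closed u x)
    then show ?thesis using c D_carrier[OF x] unfolding pc(2)[OF c(3,4) x]
      by (subst pc(2)[OF c(1,2)]) (simp_all add: word_simps)
  qed
  show "pc u w (pc u' w' x) = (u \<cdot> w' \<cdot> ginv u \<cdot> w) \<cdot> x \<cdot> ginv (u \<cdot> w' \<cdot> ginv u \<cdot> w)" if x: "x \<in> Q"
  proof -
    note xc = Q_carrier[OF x]
    have "pc u w (w' \<cdot> x \<cdot> ginv w') = pc u w w' \<cdot> pc u w x \<cdot> pc u w (ginv w')"
      by (simp only: hom_mult[OF pc(1)[OF c(1,2)]] c xc m_closed inv_closed)
    also have "\<dots> = (u \<cdot> w' \<cdot> ginv u) \<cdot> (w \<cdot> x \<cdot> ginv w) \<cdot> (u \<cdot> ginv w' \<cdot> ginv u)"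
      by (simp only: pc(2)[OF c(1,2) u(4)] pc(2)[OF c(1,2) D_closed(2)[OF u(4)]] pc(3)[OF c(1,2) x])
    finally show ?thesis unfolding pc(3)[OF c(3,4) x] using c xc by (simp add: word_simps)
  qed
qed

lemma pc_inverse:
  assumes u: "u \<in> D" "w \<in> D" and x: "x \<in> carrier A"
  defines "u' \<equiv> ginv u" and "w' \<equiv> ginv u \<cdot> ginv w \<cdot> u"
  shows "pc u' w' (pc u w x) = x" "pc u w (pc u' w' x) = x"
proof -
  have c: "u \<in> carrier A" "w \<in> carrier A" "u' \<in> carrier A" "w' \<in> carrier A" "u' \<in> D" "w' \<in> D"
    unfolding u'_def w'_def by (intro D_carrier D_closed u)+
  have "(pc u' w' \<circ> pc u w) x = (\<lambda>x. x) x"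
  proof (rule eq_on_factors[OF group_A Group.hom_compose[OF pc(1)[OF c(1,2)] pc(1)[OF c(3,4)]] id_hom _ _ x])
    show "(pc u' w' \<circ> pc u w) y = y" if "y \<in> D" for y
      using pc_pc(1)[OF c(5,6) u that] c(1,2) D_carrier[OF that] by (simp add: u'_def)
    show "(pc u' w' \<circ> pc u w) y = y" if "y \<in> Q" for y
      using pc_pc(2)[OF c(5,6) u that] c(1,2) Q_carrier[OF that] by (simp add: u'_def w'_def word_simps)
  qed
  then show "pc u' w' (pc u w x) = x" by simp
  have "(pc u w \<circ> pc u' w') x = (\<lambda>x. x) x"
  proof (rule eq_on_factors[OF group_A Group.hom_compose[OF pc(1)[OF c(3,4)] pc(1)[OF c(1,2)]] id_hom _ _ x])
    show "(pc u w \<circ> pc u' w') y = y" if "y \<in> D" for y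
      using pc_pc(1)[OF u c(5,6) that] c(1,2) D_carrier[OF that] by (simp add: u'_def)
    show "(pc u w \<circ> pc u' w') y = y" if "y \<in> Q" for y
      using pc_pc(2)[OF u c(5,6) that] c(1,2) Q_carrier[OF that] by (simp add: u'_def w'_def word_simps)
  qed
  then show "pc u w (pc u' w' x) = x" by simp
qed

lemma pc_auto:
  assumes u: "u \<in> D" "w \<in> D" shows "pc u w \<in> auto A"
proof -
  have c: "u \<in> carrier A" "w \<in> carrier A" using u D_carrier by auto
  let ?i = "pc (ginv u) (ginv u \<cdot> ginv w \<cdot> u)"
  have i: "?i \<in> hom A A" using pc(1) c by simp
  have "restrict (pc u w) (carrier A) \<in> auto A"
    by (rule restrict_auto[OF pc(1)[OF c] hom_in_carrier[OF i] pc_inverse[OF u]])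
  then show ?thesis by (simp add: pc_def)
qed

lemma auto_eq_factors:
  assumes "g \<in> auto A" "h \<in> auto A" "\<And>x. x \<in> D \<Longrightarrow> g x = h x" "\<And>x. x \<in> Q \<Longrightarrow> g x = h x"
  shows "g = h"
proof (rule auto_eqI[OF assms(1,2)])
  have gh: "g \<in> hom A A" "h \<in> hom A A" using assms(1,2) by (auto simp: auto_def)
  show "g x = h x" if "x \<in> carrier A" for x
    by (rule eq_on_factors[of A g h, OF group_A gh assms(3,4) that])
qed

lemma pc_mult:
  assumes u: "u \<in> D" "w \<in> D" "u' \<in> D" "w' \<in> D"
  shows "pc u w \<star> pc u' w' = pc (u \<cdot> u') (u \<cdot> w' \<cdot> ginv u \<cdot> w)"
proof -
  have d: "u \<cdot> u' \<in> D" "u \<cdot> w' \<cdot> ginv u \<cdot> w \<in> D" by (intro D_closed u)+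
  note c = d[THEN D_carrier]
  show ?thesis
  proof (rule auto_eq_factors)
    show "pc u w \<star> pc u' w' \<in> auto A" by (intro auto_m_closed pc_auto u)
    show "pc (u \<cdot> u') (u \<cdot> w' \<cdot> ginv u \<cdot> w) \<in> auto A" by (intro pc_auto d)
    note app = auto_apply[OF pc_auto[OF u(1,2)] pc_auto[OF u(3,4)]]
    show "(pc u w \<star> pc u' w') x = pc (u \<cdot> u') (u \<cdot> w' \<cdot> ginv u \<cdot> w) x" if x: "x \<in> D" for x
      unfolding app[OF D_carrier[OF x]] pc_pc(1)[OF u x] pc(2)[OF c x] ..
    show "(pc u w \<star> pc u' w') x = pc (u \<cdot> u') (u \<cdot> w' \<cdot> ginv u \<cdot> w) x" if x: "x \<in> Q" for x
      unfolding app[OF Q_carrier[OF x]] pc_pc(2)[OF u x] pc(3)[OF c x] ..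
  qed
qed

lemma cj_pc: "b \<in> D \<Longrightarrow> cj b = pc b b"
proof -
  assume b: "b \<in> D"
  note c = D_carrier[OF b]
  show ?thesis
  proof (rule auto_eq_factors[OF cj_auto[OF c] pc_auto[OF b b]])
    show "cj b x = pc b b x" if "x \<in> D" for x
      unfolding pc(2)[OF c c that] by (rule cj_apply[OF D_carrier[OF that]])
    show "cj b x = pc b b x" if "x \<in> Q" for x
      unfolding pc(3)[OF c c that] by (rule cj_apply[OF Q_carrier[OF that]])
  qed
qed

text \<open>A complement of the inner automorphisms in Aut A; it takes the place of \<open>S\<close>
  in \<open>semidirect_swap\<close>.\<close>

definition Stab where "Stab = {\<alpha> \<in> auto A. \<alpha> ` D = D \<and> \<alpha> ` Q = Q}"

lemma Stab_subgroup: "subgroup Stab G"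
proof (rule group.subgroupI[OF group_G])
  have fix_img: "f ` Z = Z" if "\<And>x. x \<in> Z \<Longrightarrow> f x = x" for f :: "'v elt \<Rightarrow> 'v elt" and Z
    using image_cong[OF refl that, of Z] by simp
  show "Stab \<subseteq> carrier G" by (auto simp: Stab_def carrier_AutoGroup)
  have one: "\<one>\<^bsub>G\<^esub> \<in> auto A"
    using monoid.one_closed[OF group.is_monoid[OF group_G]] by (simp add: carrier_AutoGroup)
  have "\<one>\<^bsub>G\<^esub> ` D = D" "\<one>\<^bsub>G\<^esub> ` Q = Q" 
    by (rule fix_img, rule auto_one_apply, erule D_carrier)
       (rule fix_img, rule auto_one_apply, erule Q_carrier)
  then show "Stab \<noteq> {}" using one by (auto simp: Stab_def)
  fix a assume a: "a \<in> Stab"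
  then have aa: "a \<in> auto A" by (simp add: Stab_def)
  have ia: "inv\<^bsub>G\<^esub> a \<in> auto A"
    using group.inv_closed[OF group_G] aa by (simp add: carrier_AutoGroup)
  have "inv\<^bsub>G\<^esub> a \<star> a = \<one>\<^bsub>G\<^esub>" using group.l_inv[OF group_G] aa by (simp add: carrier_AutoGroup)
  then have i: "(inv\<^bsub>G\<^esub> a) (a x) = x" if "x \<in> carrier A" for x
    using auto_apply[OF ia aa that] auto_one_apply[OF that] by simp
  have inv_img: "(inv\<^bsub>G\<^esub> a) ` Z = Z" if "a ` Z = Z" "Z \<subseteq> carrier A" for Z
  proof -
    have "(inv\<^bsub>G\<^esub> a) ` a ` Z = Z" 
      unfolding image_image by (rule fix_img, rule i) (use that(2) in blast)
    then show ?thesis using that(1) by simp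
  qed
  show "inv\<^bsub>G\<^esub> a \<in> Stab"
    using a ia inv_img D_subset_carrier Q_subset_carrier by (simp add: Stab_def)
  fix b assume b: "b \<in> Stab"
  then have bb: "b \<in> auto A" by (simp add: Stab_def)
  have m_img: "(a \<star> b) ` Z = Z" if "a ` Z = Z" "b ` Z = Z" "Z \<subseteq> carrier A" for Z
  proof -
    have "(a \<star> b) ` Z = a ` b ` Z" unfolding image_image
      by (rule image_cong) (use auto_apply[OF aa bb] that(3) in auto)
    then show ?thesis using that by simp
  qed
  show "a \<star> b \<in> Stab"
    using a b auto_m_closed[OF aa bb] m_img D_subset_carrier Q_subset_carrier by (simp add: Stab_def)
qed

lemma Stab_mem: "\<alpha> \<in> Stab \<Longrightarrow> \<alpha> \<in> auto A" "\<alpha> \<in> Stab \<Longrightarrow> x \<in> D \<Longrightarrow> \<alpha> x \<in> D"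
  "\<alpha> \<in> Stab \<Longrightarrow> x \<in> Q \<Longrightarrow> \<alpha> x \<in> Q"
  by (auto simp: Stab_def)

lemma Stab_pc:
  assumes \<alpha>: "\<alpha> \<in> Stab" and u: "u \<in> D" "w \<in> D"
  shows "\<alpha> \<star> pc u w = pc (\<alpha> u) (\<alpha> w) \<star> \<alpha>"
proof -
  note a = Stab_mem[OF \<alpha>]
  have c: "u \<in> carrier A" "w \<in> carrier A" "\<alpha> u \<in> carrier A" "\<alpha> w \<in> carrier A"
    using u a(2) D_carrier by auto
  have p: "pc u w \<in> auto A" "pc (\<alpha> u) (\<alpha> w) \<in> auto A" by (intro pc_auto u a(2))+
  show ?thesis
  proof (rule auto_eq_factors)
    show "\<alpha> \<star> pc u w \<in> auto A" "pc (\<alpha> u) (\<alpha> w) \<star> \<alpha> \<in> auto A" by (intro auto_m_closed a p)+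
    show "(\<alpha> \<star> pc u w) x = (pc (\<alpha> u) (\<alpha> w) \<star> \<alpha>) x" if x: "x \<in> D" for x
      using auto_apply[OF a(1) p(1) D_carrier[OF x]] auto_apply[OF p(2) a(1) D_carrier[OF x]]
        pc(2)[OF c(1,2) x] pc(2)[OF c(3,4) a(2)[OF x]] c D_carrier[OF x]
      by (simp add: auto_mult[OF a(1)] auto_inv[OF a(1)])
    show "(\<alpha> \<star> pc u w) x = (pc (\<alpha> u) (\<alpha> w) \<star> \<alpha>) x" if x: "x \<in> Q" for x
      using auto_apply[OF a(1) p(1) Q_carrier[OF x]] auto_apply[OF p(2) a(1) Q_carrier[OF x]]
        pc(3)[OF c(1,2) x] pc(3)[OF c(3,4) a(3)[OF x]] c Q_carrier[OF x]
      by (simp add: auto_mult[OF a(1)] auto_inv[OF a(1)])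
  qed
qed

text \<open>Here the distinct ranks enter the construction: elements of \<open>Stab\<close> respect
  the coordinates of \<open>D\<close>, and so they are compatible with inverting some of
  them.\<close>

lemma Stab_pr:
  assumes \<alpha>: "\<alpha> \<in> Stab" and y: "y \<in> D" shows "\<alpha> (pr S y) = pr S (\<alpha> y)"
proof (rule D_eqI)
  note a = Stab_mem[OF \<alpha>]
  have c: "y \<in> carrier A" "\<alpha> y \<in> carrier A" using y a(2) D_carrier by auto
  show "\<alpha> (pr S y) \<in> D" using a(2) pr_D c by blast
  show "pr S (\<alpha> y) \<in> D" using pr_D c by blast
  show "retr {} (\<alpha> (pr S y)) = retr {} (pr S (\<alpha> y))"
    using c a pr_D by (simp add: retr_empty auto_closed retr_carrier)
  fix i assume i: "i < k"
  show "p i (\<alpha> (pr S y)) = p i (pr S (\<alpha> y))"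
  proof (rule pr_automorphism[OF a(2) _ _ _ y i])
    show "\<alpha> (x \<cdot> z) = \<alpha> x \<cdot> \<alpha> z" if "x \<in> D" "z \<in> D" for x z
      using auto_mult[OF a(1)] that D_carrier by simp
    show "inj_on \<alpha> D"
      using bij_betw_imp_inj_on[OF auto_bij[OF a(1)]] inj_on_subset D_subset_carrier by blast
    show "D \<subseteq> \<alpha> ` D" using \<alpha> by (simp add: Stab_def)
  qed
qed

lemma auto_span:
  assumes g: "g \<in> auto A"
  shows "\<exists>x\<in>carrier A. \<exists>q\<in>Stab. g = cj x \<star> q"
proof -
  have gh: "g \<in> hom A A" using g by (simp add: auto_def)
  have gi: "inj_on g (carrier A)" "carrier A \<subseteq> g ` carrier A"
    using auto_bij[OF g] unfolding bij_betw_def by blast+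
  obtain x where x: "x \<in> carrier A" "(\<lambda>y. ginv x \<cdot> g y \<cdot> x) ` D = D" "(\<lambda>y. ginv x \<cdot> g y \<cdot> x) ` Q = Q"
    using automorphism_decomposition[OF gh gi] by (elim bexE conjE)
  let ?q = "cj (ginv x) \<star> g"
  have q: "?q \<in> auto A" by (intro auto_m_closed cj_auto g inv_closed x)
  have qa: "?q y = ginv x \<cdot> g y \<cdot> x" if "y \<in> carrier A" for y
    using x(1) auto_apply[OF cj_auto[OF inv_closed[OF x(1)]] g that] cj_apply[OF auto_closed[OF g that]]
    by simp
  have "?q ` D = (\<lambda>y. ginv x \<cdot> g y \<cdot> x) ` D" by (rule image_cong[OF refl qa[OF D_carrier]])
  moreover have "?q ` Q = (\<lambda>y. ginv x \<cdot> g y \<cdot> x) ` Q" by (rule image_cong[OF refl qa[OF Q_carrier]])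
  ultimately have "?q \<in> Stab" using q x(2,3) unfolding Stab_def by simp
  moreover have "g = cj x \<star> ?q"
  proof (rule auto_eqI[OF g])
    show "cj x \<star> ?q \<in> auto A" by (intro auto_m_closed cj_auto x q)
    fix y assume y: "y \<in> carrier A"
    have "(cj x \<star> ?q) y = x \<cdot> (ginv x \<cdot> g y \<cdot> x) \<cdot> ginv x"
      unfolding auto_apply[OF cj_auto[OF x(1)] q y] qa[OF y]
      by (rule cj_apply) (use x(1) auto_closed[OF g y] in simp)
    also have "\<dots> = g y" using x(1) auto_closed[OF g y] by (simp add: word_simps)
    finally show "g y = (cj x \<star> ?q) y" ..
  qed
  ultimately show ?thesis using x(1) by (intro bexI[of _ x] bexI[of _ ?q])
qed

lemma D_Int_Q: "x \<in> D \<Longrightarrow> x \<in> Q \<Longrightarrow> x = \<epsilon>"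
  using fp.H_Int[of True False x] by (auto simp: H_def)

lemma conj_D:
  assumes "x \<in> carrier A" "d \<in> D" "d \<noteq> \<epsilon>" "x \<cdot> d \<cdot> ginv x \<in> D" shows "x \<in> D"
  using fp.elliptic_conj[of True d x True] assms fp_P by (simp add: H_def)

lemma conj_Q:
  assumes "x \<in> carrier A" "d \<in> Q" "d \<noteq> \<epsilon>" "x \<cdot> d \<cdot> ginv x \<in> Q" shows "x \<in> Q"
  using fp.elliptic_conj[of False d x False] assms fp_P by (simp add: H_def)

lemma W_elem: obtains v where "v \<in> W" "gen v \<in> D" "gen v \<noteq> \<epsilon>"
proof -
  have k: "0 < k" using k2 by simp
  obtain v where v: "v \<in> B 0" using B_two[OF k] by (metis card.empty ex_in_conv not_numeral_le_zero)
  then show ?thesis using that B_W[OF k] gen_sub gen_ne_one W_sub by blast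
qed

lemma c1_elem: "gen c1 \<in> Q" "gen c1 \<noteq> \<epsilon>"
  using gen_sub gen_ne_one c_V by auto

text \<open>Conjugation can keep a nontrivial element of a factor in that factor only if the
  conjugator lies there, and \<open>D\<close> and \<open>Q\<close> meet trivially.\<close>

lemma cj_Stab: "x \<in> carrier A \<Longrightarrow> cj x \<in> Stab \<Longrightarrow> x = \<epsilon>"
proof -
  assume x: "x \<in> carrier A" "cj x \<in> Stab"
  obtain v where v: "gen v \<in> D" "gen v \<noteq> \<epsilon>" using W_elem by blast
  have "x \<in> D" by (rule conj_D[OF x(1) v]) (use Stab_mem(2)[OF x(2) v(1)] D_carrier v in \<open>simp add: cj_apply\<close>)
  moreover have "x \<in> Q"
    by (rule conj_Q[OF x(1) c1_elem])
       (use Stab_mem(3)[OF x(2) c1_elem(1)] Q_carrier c1_elem in \<open>simp add: cj_apply\<close>)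
  ultimately show ?thesis using D_Int_Q by blast
qed

lemma trivial_center: "center A = {\<epsilon>}"
proof -
  have "z = \<epsilon>" if z: "z \<in> carrier A" "\<And>x. x \<in> carrier A \<Longrightarrow> x \<cdot> z = z \<cdot> x" for z
  proof -
    have conj: "z \<cdot> x \<cdot> ginv z = x" if "x \<in> carrier A" for x
      using z(2)[OF that, symmetric] that z(1) by (simp add: word_simps)
    obtain v where v: "gen v \<in> D" "gen v \<noteq> \<epsilon>" using W_elem by blast
    have "z \<in> D" by (rule conj_D[OF z(1) v]) (use conj v D_carrier in simp)
    moreover have "z \<in> Q" by (rule conj_Q[OF z(1) c1_elem]) (use conj c1_elem Q_carrier in simp)
    ultimately show ?thesis using D_Int_Q by blast
  qed
  then show ?thesis unfolding center_def by auto
qed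

end

section \<open>Sign changes for the group without centre\<close>

context raag_free_square
begin

text \<open>Multiplicative in the coordinates outside \<open>S\<close>, but order reversing in those
  of \<open>S\<close>.\<close>

definition flip :: "nat set \<Rightarrow> 'v elt \<Rightarrow> 'v elt" where
  "flip S b = pr (- S) b \<cdot> ginv (pr S b)"

lemma flip_D: "b \<in> D \<Longrightarrow> flip S b \<in> D"
  unfolding flip_def by (intro D_closed pr_D D_carrier)

lemma D_split: "b \<in> D \<Longrightarrow> b = pr (- S) b \<cdot> pr S b"
proof -
  assume b: "b \<in> D"
  have "b = pr UNIV b"
    using retr_id[OF _ blocks_sub b, of UNIV] by (simp add: W_def blocks_def)
  also have "\<dots> = pr (- S \<union> S) b" by (simp add: Compl_partition2)
  also have "\<dots> = pr (- S) b \<cdot> pr S b" by (rule pr_Un) (use b D_carrier in auto)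
  finally show ?thesis .
qed

text \<open>The image of the inner automorphism of \<open>b\<close>: it sends \<open>a Q a\<inverse>\<close> to the conjugate of \<open>Q\<close> by
  \<open>flip S (b \<cdot> flip S a)\<close>.\<close>

definition tau_D where "tau_D S b = pc (pr (- S) b) (flip S b)"

lemma tau_D_auto: "b \<in> D \<Longrightarrow> tau_D S b \<in> auto A"
  unfolding tau_D_def by (intro pc_auto pr_D flip_D D_carrier)

text \<open>On the indices, \<open>b\<close> acts by left translation in the coordinates outside
  \<open>S\<close> and by right translation with the inverse in those of \<open>S\<close>. Both are
  left actions.\<close>

lemma tau_D_mult:
  assumes b: "b \<in> D" "d \<in> D" shows "tau_D S b \<star> tau_D S d = tau_D S (b \<cdot> d)"
proof -
  have c: "b \<in> carrier A" "d \<in> carrier A" using b D_carrier by auto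
  have r: "pr T b \<in> carrier A" "pr T d \<in> carrier A" for T using retr_carrier c by auto
  have "pr (- S) b \<cdot> flip S d \<cdot> ginv (pr (- S) b) \<cdot> flip S b = flip S (b \<cdot> d)"
    using c r by (simp add: flip_def retr_mult word_simps)
  moreover have "pr (- S) b \<cdot> pr (- S) d = pr (- S) (b \<cdot> d)" using c by (simp add: retr_mult)
  ultimately show ?thesis unfolding tau_D_def
    by (subst pc_mult) (use b c pr_D flip_D in simp_all)
qed

text \<open>No edge joins \<open>W\<close> to \<open>c1\<close> or \<open>c2\<close>, so the
  relations can be checked on each factor separately.\<close>

lemma tau_ex: "\<exists>h. h \<in> hom A G \<and> (\<forall>v\<in>V. h (gen v) = (if v \<in> W then tau_D S (gen v) else cj (gen v)))"
proof -
  have "\<exists>h\<in>hom A G. \<forall>v\<in>V. h (gen v) = (if v \<in> W then tau_D S (gen v) else cj (gen v))"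
  proof (rule lift_ex[OF group_G])
    show "(if v \<in> W then tau_D S (gen v) else cj (gen v)) \<in> carrier G" if "v \<in> V" for v
      using that tau_D_auto gen_sub cj_auto gen_carrier by (simp add: carrier_AutoGroup)
    fix v w assume e: "(v, w) \<in> E"
    then have vw: "v \<in> V" "w \<in> V" using E_sub by auto
    show "(if v \<in> W then tau_D S (gen v) else cj (gen v)) \<star> (if w \<in> W then tau_D S (gen w) else cj (gen w))
      = (if w \<in> W then tau_D S (gen w) else cj (gen w)) \<star> (if v \<in> W then tau_D S (gen v) else cj (gen v))"
    proof (cases "v \<in> W")
      case True
      then have w: "w \<in> W" using no_edge e vw V_eq by blast
      have "tau_D S (gen v) \<star> tau_D S (gen w) = tau_D S (gen w) \<star> tau_D S (gen v)"
        using tau_D_mult[OF gen_sub[OF True] gen_sub[OF w], of S]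
          tau_D_mult[OF gen_sub[OF w] gen_sub[OF True], of S] gen_comm[OF e] by metis
      then show ?thesis using True w by simp
    next
      case False
      then have w: "w \<notin> W" using no_edge e vw V_eq by blast
      have "cj (gen v) \<star> cj (gen w) = cj (gen w) \<star> cj (gen v)"
        using cj_mult[OF gen_carrier gen_carrier, OF vw] cj_mult[OF gen_carrier gen_carrier, OF vw(2,1)]
          gen_comm[OF e] by metis
      then show ?thesis using False w by simp
    qed
  qed
  then show ?thesis by blast
qed

definition tau where
  "tau S = (SOME h. h \<in> hom A G \<and> (\<forall>v\<in>V. h (gen v) = (if v \<in> W then tau_D S (gen v) else cj (gen v))))"

lemma tau_hom: "tau S \<in> hom A G"
  using someI_ex[OF tau_ex[of S]] by (simp add: tau_def)

lemma tau_gen: "v \<in> V \<Longrightarrow> tau S (gen v) = (if v \<in> W then tau_D S (gen v) else cj (gen v))"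
  using someI_ex[OF tau_ex[of S]] by (simp add: tau_def)

lemma tau_on_D: "x \<in> D \<Longrightarrow> tau S x = tau_D S x"
proof -
  assume x: "x \<in> D"
  have h: "(\<lambda>x. tau_D S (retr W x)) \<in> hom A G"
  proof (rule homI)
    fix x y assume xy: "x \<in> carrier A" "y \<in> carrier A"
    show "tau_D S (retr W x) \<in> carrier G"
      unfolding carrier_AutoGroup by (intro tau_D_auto retr_sub[OF W_sub] xy)
    show "tau_D S (retr W (x \<cdot> y)) = tau_D S (retr W x) \<star> tau_D S (retr W y)"
      using tau_D_mult[OF retr_sub[OF W_sub xy(1)] retr_sub[OF W_sub xy(2)]] xy
      by (simp add: retr_mult)
  qed
  have "tau S x = tau_D S (retr W x)"
  proof (rule hom_eq_on_generate[OF group_G tau_hom h gens_carrier[OF W_sub] _ x[unfolded sub_def]])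
    fix s assume "s \<in> gen ` W"
    then obtain v where v: "v \<in> W" "s = gen v" by blast
    then show "tau S s = tau_D S (retr W s)" using W_sub by (simp add: tau_gen retr(2) subset_iff)
  qed
  then show ?thesis using retr_id[OF order_refl W_sub x] by simp
qed

lemma tau_on_Q: "x \<in> Q \<Longrightarrow> tau S x = cj x"
  by (rule hom_eq_on_generate[OF group_G tau_hom cj_hom gens_carrier[OF c_V(1)]])
     (use c_V c_notin in \<open>auto simp: tau_gen sub_def\<close>)

lemma generate_D_Q: "carrier A = generate A (D \<union> Q)"
proof
  show "generate A (D \<union> Q) \<subseteq> carrier A"
    by (rule generate_incl) (use D_subset_carrier Q_subset_carrier in blast)
  have "gen v \<in> D \<union> Q" if "v \<in> V" for v using that V_eq gen_sub by blast
  then have "gen ` V \<subseteq> D \<union> Q" by blast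
  then show "carrier A \<subseteq> generate A (D \<union> Q)" unfolding carrier_generate by (rule mono_generate)
qed

lemma pc_Stab:
  assumes u: "u \<in> D" shows "pc u \<epsilon> \<in> Stab"
proof -
  have uc: "u \<in> carrier A" using u D_carrier by blast
  have a: "pc u \<epsilon> \<in> auto A" by (rule pc_auto[OF u sub_one])
  have "pc u \<epsilon> ` D = D"
  proof
    show "pc u \<epsilon> ` D \<subseteq> D" using pc(2)[OF uc one_closed] u D_closed by auto
    show "D \<subseteq> pc u \<epsilon> ` D"
    proof
      fix x assume x: "x \<in> D"
      have y: "ginv u \<cdot> x \<cdot> u \<in> D" using u x D_closed by blast
      have "pc u \<epsilon> (ginv u \<cdot> x \<cdot> u) = x"
        using pc(2)[OF uc one_closed y] uc D_carrier[OF x] by (simp add: word_simps)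
      then show "x \<in> pc u \<epsilon> ` D" using y by force
    qed
  qed
  moreover have "pc u \<epsilon> ` Q = Q"
    using pc(3)[OF uc one_closed] Q_carrier by force
  ultimately show ?thesis using a by (simp add: Stab_def)
qed

text \<open>Both sides, multiplied by the inverse of \<open>\<alpha>\<close>, are homomorphisms in
  \<open>x\<close> and can be compared on the factors. On \<open>D\<close> the claim rests on
  \<open>Stab_pr\<close>, on \<open>Q\<close> it is the rule for inner automorphisms.\<close>

lemma Stab_tau:
  assumes \<alpha>: "\<alpha> \<in> Stab" and x: "x \<in> carrier A" shows "\<alpha> \<star> tau S x = tau S (\<alpha> x) \<star> \<alpha>"
proof -
  interpret G: group G by (rule group_G)
  note a = Stab_mem[OF \<alpha>]
  have aG: "\<alpha> \<in> carrier G" using a by (simp add: carrier_AutoGroup)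
  have ah: "\<alpha> \<in> hom A A" using a(1) by (simp add: auto_def)
  have tc: "tau S y \<in> carrier G" if "y \<in> carrier A" for y using hom_in_carrier[OF tau_hom that] .
  have h1: "(\<lambda>x. \<alpha> \<star> tau S x \<star> inv\<^bsub>G\<^esub> \<alpha>) \<in> hom A G"
    by (rule homI) (use aG tc in \<open>simp_all add: hom_mult[OF tau_hom] G.word_simps\<close>)
  have key: "\<alpha> \<star> tau S x \<star> inv\<^bsub>G\<^esub> \<alpha> = tau S (\<alpha> x)" if "\<alpha> \<star> tau S x = tau S (\<alpha> x) \<star> \<alpha>" "x \<in> carrier A" for x
    unfolding that(1) using aG tc[OF auto_closed[OF a(1) that(2)]] by (simp add: G.word_simps)
  have "\<alpha> \<star> tau S x \<star> inv\<^bsub>G\<^esub> \<alpha> = (tau S \<circ> \<alpha>) x"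
  proof (rule eq_on_factors[OF group_G h1 Group.hom_compose[OF ah tau_hom] _ _ x])
    fix b assume b: "b \<in> D"
    have bc: "b \<in> carrier A" "\<alpha> b \<in> carrier A" using b a(2) D_carrier by auto
    have "\<alpha> \<star> tau_D S b = tau_D S (\<alpha> b) \<star> \<alpha>"
      unfolding tau_D_def
      using Stab_pc[OF \<alpha> pr_D[OF bc(1)] flip_D[OF b]] Stab_pr[OF \<alpha> b] auto_mult[OF a(1)]
        auto_inv[OF a(1)] retr_carrier bc by (simp add: flip_def)
    then show "\<alpha> \<star> tau S b \<star> inv\<^bsub>G\<^esub> \<alpha> = (tau S \<circ> \<alpha>) b"
      using key[OF _ bc(1)] tau_on_D[OF b] tau_on_D[OF a(2)[OF b]] by simp
  next
    fix b assume b: "b \<in> Q"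
    have "\<alpha> \<star> cj b = cj (\<alpha> b) \<star> \<alpha>" by (rule auto_cj[OF a(1) Q_carrier[OF b]])
    then show "\<alpha> \<star> tau S b \<star> inv\<^bsub>G\<^esub> \<alpha> = (tau S \<circ> \<alpha>) b"
      using key[OF _ Q_carrier[OF b]] tau_on_Q[OF b] tau_on_Q[OF a(3)[OF b]] by simp
  qed
  then have "\<alpha> \<star> tau S x \<star> inv\<^bsub>G\<^esub> \<alpha> \<star> \<alpha> = tau S (\<alpha> x) \<star> \<alpha>" by simp
  then show ?thesis using aG tc[OF x] by (simp add: G.m_assoc)
qed

lemma pr_flip: "b \<in> D \<Longrightarrow> pr (- S) (flip S b) = pr (- S) b" "b \<in> D \<Longrightarrow> pr S (flip S b) = ginv (pr S b)"
  using D_carrier[of b] by (simp_all add: flip_def retr_mult retr_inv retr_carrier pr_pr pr_empty)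

text \<open>The factor in \<open>Stab\<close> is conjugation of \<open>D\<close> by the
  \<open>S\<close>-coordinates of \<open>b\<close>, since
  \<open>ginv (flip S b) \<cdot> pr (- S) b\<close> equals \<open>pr S b\<close>. It accounts for
  the difference between left and right translation.\<close>

lemma swap_D:
  assumes b: "b \<in> D"
  shows "tau S b = cj (flip S b) \<star> pc (ginv (flip S b) \<cdot> pr (- S) b) \<epsilon>"
    "tau S (flip S b) \<star> pc (ginv (flip S b) \<cdot> pr (- S) b) \<epsilon> = cj b"
proof -
  let ?s = "flip S b" and ?q = "pr (- S) b"
  let ?u = "ginv ?s \<cdot> ?q"
  have d: "?s \<in> D" "?q \<in> D" "?u \<in> D" using flip_D b pr_D D_carrier D_closed by blast+
  have c: "?s \<in> carrier A" "?q \<in> carrier A" "pr S b \<in> carrier A" "b \<in> carrier A"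
    using d D_carrier retr_carrier b by auto
  have comm: "?q \<cdot> pr S b = pr S b \<cdot> ?q" by (rule pr_comm) (use c in auto)
  have "cj ?s \<star> pc ?u \<epsilon> = pc (?s \<cdot> ?u) (?s \<cdot> \<epsilon> \<cdot> ginv ?s \<cdot> ?s)"
    unfolding cj_pc[OF d(1)] by (rule pc_mult[OF d(1,1,3) sub_one])
  also have "\<dots> = tau_D S b" unfolding tau_D_def using c by (simp add: word_simps)
  finally show "tau S b = cj ?s \<star> pc ?u \<epsilon>" using tau_on_D[OF b] by simp
  have ss: "flip S ?s = ?q \<cdot> pr S b" unfolding flip_def[of S ?s] pr_flip[OF b] using c by simp
  have "tau S ?s \<star> pc ?u \<epsilon> = pc ?q (flip S ?s) \<star> pc ?u \<epsilon>"
    unfolding tau_on_D[OF d(1)] tau_D_def pr_flip(1)[OF b] ..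
  also have "\<dots> = pc (?q \<cdot> ?u) (?q \<cdot> \<epsilon> \<cdot> ginv ?q \<cdot> flip S ?s)"
    by (rule pc_mult[OF d(2) flip_D[OF d(1)] d(3) sub_one])
  also have "?q \<cdot> \<epsilon> \<cdot> ginv ?q \<cdot> flip S ?s = b" unfolding ss using c D_split[OF b, of S] by simp
  also have "?q \<cdot> ?u = b"
  proof -
    have "?q \<cdot> ?u = ?q \<cdot> pr S b" unfolding flip_def using c by (simp add: word_simps)
    then show ?thesis using D_split[OF b, of S] by simp
  qed
  finally show "tau S ?s \<star> pc ?u \<epsilon> = cj b" using cj_pc[OF b] by simp
qed

lemma semidirect: "semidirect_swap A G cj (tau S) Stab (D \<union> Q)"
proof (intro semidirect_swap.intro semidirect_swap_axioms.intro)
  show "group A" "group G" by (rule group_A group_G)+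
  show "cj \<in> hom A G" "tau S \<in> hom A G" "subgroup Stab G" by (rule cj_hom tau_hom Stab_subgroup)+
  show "D \<union> Q \<subseteq> carrier A" using D_subset_carrier Q_subset_carrier by blast
  show "carrier A = generate A (D \<union> Q)" by (rule generate_D_Q)
  show "\<exists>y\<in>carrier A. q \<star> cj x = cj y \<star> q \<and> q \<star> tau S x = tau S y \<star> q"
    if "q \<in> Stab" "x \<in> carrier A" for q x
    using Stab_tau[OF that] auto_cj[OF Stab_mem(1)[OF that(1)] that(2)]
      auto_closed[OF Stab_mem(1)[OF that(1)] that(2)] by blast
  show "\<exists>x\<in>carrier A. \<exists>q\<in>Stab. g = cj x \<star> q" if "g \<in> carrier G" for g
    using auto_span that by (simp add: carrier_AutoGroup)
  show "x = \<epsilon>" if "x \<in> carrier A" "cj x \<in> Stab" for x using cj_Stab that .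
  fix x assume "x \<in> D \<union> Q"
  then show "\<exists>y\<in>carrier A. \<exists>q\<in>Stab. tau S x = cj y \<star> q \<and> tau S y \<star> q = cj x"
  proof
    assume x: "x \<in> D"
    have "ginv (flip S x) \<cdot> pr (- S) x \<in> D" using flip_D[OF x] x pr_D D_carrier D_closed by blast
    then show ?thesis using swap_D[OF x] pc_Stab flip_D[OF x] D_carrier by blast
  next
    assume x: "x \<in> Q"
    interpret G: group G by (rule group_G)
    have "cj x \<star> \<one>\<^bsub>G\<^esub> = cj x"
      using cj_auto[OF Q_carrier[OF x]] by (simp add: carrier_AutoGroup[symmetric])
    then show ?thesis using subgroup.one_closed[OF Stab_subgroup] tau_on_Q[OF x] Q_carrier[OF x] by metis
  qed
qed

definition twist where
  "twist S = restrict (semidirect_swap.\<Theta> A G cj (tau S) Stab) (carrier G)"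

lemma twist_auto: "twist S \<in> auto G"
  unfolding twist_def by (rule semidirect_swap.Theta_auto[OF semidirect])

lemma twist_cj: "x \<in> carrier A \<Longrightarrow> twist S (cj x) = tau S x"
  unfolding twist_def using semidirect_swap.Theta_iota[OF semidirect] cj_auto
  by (simp add: carrier_AutoGroup)

text \<open>For \<open>i\<close> in \<open>S\<close> but not in \<open>T\<close> and a generator
  \<open>?b\<close> of block \<open>i\<close>, \<open>twist T\<close> fixes \<open>cj ?b\<close>,
  while \<open>twist S\<close> makes it trivial on \<open>D\<close> and conjugation by
  \<open>ginv ?b\<close> on \<open>Q\<close>. If this were conjugation by some \<open>?y\<close>,
  then \<open>?y\<close> would centralize \<open>D\<close>, hence lie in \<open>D\<close>, and
  \<open>?b \<cdot> ?y\<close> would centralize \<open>gen c1\<close>, so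
  \<open>?y = ginv ?b\<close>. But \<open>?b\<close> is not central in \<open>D\<close>.\<close>

lemma twist_conj_subset:
  assumes S: "S \<subseteq> {..<k}" and h: "h \<in> carrier G"
    and eq: "\<And>g. g \<in> carrier G \<Longrightarrow> twist S g = h \<star> twist T g \<star> inv\<^bsub>G\<^esub> h"
  shows "S \<subseteq> T"
proof
  interpret G: group G by (rule group_G)
  fix i assume iS: "i \<in> S"
  then have i: "i < k" using S by blast
  have ha: "h \<in> auto A" using h by (simp add: carrier_AutoGroup)
  show "i \<in> T"
  proof (rule ccontr)
    assume iT: "i \<notin> T"
    obtain v w where vw: "v \<in> B i" "w \<in> B i" "v \<noteq> w"
      using B_two[OF i] card_le_Suc0_iff_eq[OF B_fin[OF i]] by force
    let ?b = "gen v"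
    have b: "?b \<in> sub (B i)" "?b \<in> D" "?b \<in> carrier A"
      using gen_sub[OF vw(1)] sub_mono[OF B_W[OF i]] D_carrier by blast+
    have V: "v \<in> V" using vw B_sub[OF i] by blast
    have prb: "pr U ?b = (if i \<in> U then ?b else \<epsilon>)" for U
    proof -
      have "v \<in> blocks U \<longleftrightarrow> i \<in> U"
        using vw(1) i B_disj[of i] unfolding blocks_def by blast
      then show ?thesis by (simp add: retr(2)[OF V])
    qed
    have T: "tau T ?b = cj ?b"
      using iT b tau_on_D[OF b(2)] cj_pc[OF b(2)] by (simp add: tau_D_def flip_def prb)
    have S': "tau S ?b = pc \<epsilon> (ginv ?b)"
      using iS b tau_on_D[OF b(2)] by (simp add: tau_D_def flip_def prb)
    let ?y = "h ?b"
    have yc: "?y \<in> carrier A" using auto_closed[OF ha b(3)] .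
    have "tau S ?b = h \<star> cj ?b \<star> inv\<^bsub>G\<^esub> h"
      using eq[of "cj ?b"] cj_auto[OF b(3)] twist_cj[OF b(3)] T by (simp add: carrier_AutoGroup)
    also have "\<dots> = cj ?y \<star> h \<star> inv\<^bsub>G\<^esub> h" by (simp only: auto_cj[OF ha b(3)])
    also have "\<dots> = cj ?y" using h cj_auto[OF yc] by (simp add: G.word_simps flip: carrier_AutoGroup)
    finally have e: "pc \<epsilon> (ginv ?b) = cj ?y" using S' by simp
    have bi: "ginv ?b \<in> carrier A" using b by simp
    have yD: "?y \<cdot> d \<cdot> ginv ?y = d" if d: "d \<in> D" for d
      using fun_cong[OF e, of d] pc(2)[OF one_closed bi d] D_carrier[OF d] by (simp add: cj_apply)
    have "?y \<in> D" by (rule conj_D[OF yc b(2) gen_ne_one[OF V]]) (use yD b in simp)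
    have q: "gen c1 \<in> carrier A" using c1_elem Q_carrier by blast
    have yq: "?y \<cdot> gen c1 \<cdot> ginv ?y = ginv ?b \<cdot> gen c1 \<cdot> ?b"
      using fun_cong[OF e, of "gen c1"] pc(3)[OF one_closed bi c1_elem(1)] q b by (simp add: cj_apply)
    have "(?b \<cdot> ?y) \<cdot> gen c1 \<cdot> ginv (?b \<cdot> ?y) = ?b \<cdot> (?y \<cdot> gen c1 \<cdot> ginv ?y) \<cdot> ginv ?b"
      using b yc q by (simp add: word_simps)
    also have "\<dots> = gen c1" unfolding yq using b q by (simp add: word_simps)
    finally have "?b \<cdot> ?y \<in> Q"
      using conj_Q[OF _ c1_elem, of "?b \<cdot> ?y"] b yc c1_elem by simp
    then have "?b \<cdot> ?y = \<epsilon>" using D_Int_Q D_closed(1)[OF b(2) \<open>?y \<in> D\<close>] by blast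
    then have yi: "?y = ginv ?b" using b yc by (metis inv_equality inv_inv)
    have w: "gen w \<in> D" "gen w \<in> carrier A"
      using gen_sub[OF vw(2)] sub_mono[OF B_W[OF i]] D_carrier by blast+
    have "?b \<cdot> (ginv ?b \<cdot> gen w \<cdot> ?b) = ?b \<cdot> gen w" using yD[OF w(1)] yi b by simp
    then have "?b \<cdot> gen w = gen w \<cdot> ?b" using b w by (simp add: word_simps)
    then show False using free_sub_noncomm[OF B_sub[OF i] B_free[OF i] vw] by blast
  qed
qed

lemma Out_exceeds_power: "N < 2 ^ k \<Longrightarrow> order_exceeds (Out G) N"
  by (rule group.Out_exceeds[OF group_G, of "Pow {..<k}" N twist])
     (simp_all add: card_Pow twist_auto twist_conj_subset)

end

section \<open>Sign changes for the group with centre\<close>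

text \<open>With \<open>C = {z}\<close> and \<open>V = W\<close>, the abbreviation \<open>D\<close>
  now denotes the whole group, centre included, and not the product of the free factors.\<close>

locale raag_center = raag_blocks V E k B "{z}" for V :: "'v set" and E k B and z +
  assumes V_W: "V = W"
begin

abbreviation Z :: "'v elt set" where "Z \<equiv> sub {z}"

abbreviation ze :: "'v elt \<Rightarrow> 'v elt" where "ze \<equiv> retr {z}"

lemma z_V: "z \<in> V" "{z} \<subseteq> V"
  using C_sub by auto

lemma D_carrier_eq: "D = carrier A"
  using sub_V V_W by simp

lemma Z_carrier: "x \<in> Z \<Longrightarrow> x \<in> carrier A"
  by (rule sub_carrier[OF z_V(2)])

lemma Z_comm: "x \<in> carrier A \<Longrightarrow> y \<in> Z \<Longrightarrow> x \<cdot> y = y \<cdot> x"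
proof (rule sub_comm[of V "{z}"])
  show "u = w \<or> (u, w) \<in> E" if "u \<in> V" "w \<in> {z}" for u w
    using that V_W C_edge by (auto simp: W_def)
qed (use z_V sub_V in auto)

lemma Z_closed: "x \<in> Z \<Longrightarrow> y \<in> Z \<Longrightarrow> x \<cdot> y \<in> Z" "x \<in> Z \<Longrightarrow> ginv x \<in> Z"
  by (rule sub_closed(1)[OF z_V(2)], assumption+) (rule sub_closed(2)[OF z_V(2)], assumption+)

lemma ze_Z: "x \<in> carrier A \<Longrightarrow> ze x \<in> Z"
  by (rule retr_sub[OF z_V(2)])

lemma ze_id: "x \<in> Z \<Longrightarrow> ze x = x"
  by (rule retr_id[OF order_refl z_V(2)])

lemma z_block: "z \<notin> blocks S"
  using B_C by (auto simp: blocks_def)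

lemma ze_pr: "x \<in> carrier A \<Longrightarrow> ze (pr S x) = \<epsilon>"
  using z_block by (simp add: retr_retr retr_empty)

lemma pr_Z: "x \<in> Z \<Longrightarrow> pr S x = \<epsilon>"
  by (rule retr_kill[OF z_V(2)]) (use z_block in auto)

lemma p_Z: "i < k \<Longrightarrow> x \<in> Z \<Longrightarrow> p i x = \<epsilon>"
  by (rule retr_kill[OF z_V(2)]) (use B_C in auto)

lemma auto_blocks:
  assumes g: "g \<in> auto A" and x: "x \<in> carrier A" and i: "i < k"
  shows "p i (g x) = p i (g (p i x))" "p i (g (pr S x)) = p i (pr S (g x))"
proof -
  have b: "inj_on g D" "D \<subseteq> g ` D"
    using auto_bij[OF g] unfolding D_carrier_eq bij_betw_def by blast+
  have 1: "g y \<in> D" if "y \<in> D" for y using auto_closed[OF g] that unfolding D_carrier_eq .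
  have 2: "g (y \<cdot> w) = g y \<cdot> g w" if "y \<in> D" "w \<in> D" for y w
    using auto_mult[OF g] that unfolding D_carrier_eq .
  have xD: "x \<in> D" using x unfolding D_carrier_eq .
  show "p i (g x) = p i (g (p i x))"
    by (rule automorphism_preserves_blocks) (fact 1 2 b i xD)+
  show "p i (g (pr S x)) = p i (pr S (g x))"
    by (rule pr_automorphism) (fact 1 2 b i xD)+
qed

lemma auto_one: "g \<in> auto A \<Longrightarrow> g \<epsilon> = \<epsilon>"
  using hom_one[of g A A] group_A by (simp add: auto_def)

text \<open>\<open>Z\<close> consists of the elements whose block coordinates all vanish, and
  automorphisms preserve this because they respect the blocks.\<close>

lemma auto_Z:
  assumes g: "g \<in> auto A" and x: "x \<in> Z" shows "g x \<in> Z"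
proof -
  have c: "x \<in> carrier A" "g x \<in> carrier A" using Z_carrier[OF x] auto_closed[OF g] by auto
  have "g x = ze (g x)"
  proof (rule D_eqI)
    show "g x \<in> D" "ze (g x) \<in> D" using c retr_carrier unfolding D_carrier_eq by auto
    show "p i (g x) = p i (ze (g x))" if "i < k" for i
      using auto_blocks(1)[OF g c(1) that] p_Z[OF that x] auto_one[OF g] retr_one
        p_Z[OF that ze_Z[OF c(2)]] by simp
    show "ze (g x) = ze (ze (g x))" using ze_id[OF ze_Z[OF c(2)]] by simp
  qed
  then show ?thesis using ze_Z[OF c(2)] by simp
qed

text \<open>The counterpart of \<open>Stab_pr\<close>: coordinates are respected up to a factor in
  \<open>Z\<close>, and this factor is what the sign change acts on.\<close>

lemma auto_pr:
  assumes h: "h \<in> auto A" and x: "x \<in> carrier A"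
  shows "h (pr S x) = pr S (h x) \<cdot> ze (h (pr S x))"
proof (rule D_eqI)
  have c: "h x \<in> carrier A" "pr S x \<in> carrier A" "h (pr S x) \<in> carrier A" "pr S (h x) \<in> carrier A"
    using auto_closed[OF h] x retr_carrier by auto
  note zz = ze_Z[OF c(3)]
  show "h (pr S x) \<in> D" "pr S (h x) \<cdot> ze (h (pr S x)) \<in> D"
    using c retr_carrier unfolding D_carrier_eq by auto
  show "p i (h (pr S x)) = p i (pr S (h x) \<cdot> ze (h (pr S x)))" if i: "i < k" for i
    using auto_blocks(2)[OF h x i] p_Z[OF i zz] c Z_carrier[OF zz] by (simp add: retr_mult retr_carrier)
  show "ze (h (pr S x)) = ze (pr S (h x) \<cdot> ze (h (pr S x)))"
    using c Z_carrier[OF zz] ze_id[OF zz] ze_pr[OF c(1)] by (simp add: retr_mult)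
qed

text \<open>If \<open>g\<close> maps \<open>x\<close> to \<open>q x\<close> times \<open>f x\<close> in \<open>Z\<close>, then \<open>tw S g\<close> changes the sign of \<open>f\<close> on the blocks in
  \<open>S\<close>.\<close>

definition tw :: "nat set \<Rightarrow> ('v elt \<Rightarrow> 'v elt) \<Rightarrow> 'v elt \<Rightarrow> 'v elt" where
  "tw S g x = g x \<cdot> (ginv (ze (g (pr S x))) \<cdot> ginv (ze (g (pr S x))))"

lemma Z_inv_mult:
  assumes a: "a \<in> Z" "b \<in> Z"
  shows "ginv (a \<cdot> b) \<cdot> ginv (a \<cdot> b) = (ginv b \<cdot> ginv b) \<cdot> (ginv a \<cdot> ginv a)"
proof -
  have c: "a \<in> carrier A" "b \<in> carrier A" using a Z_carrier by auto
  have e: "ginv a \<cdot> ginv b = ginv b \<cdot> ginv a"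
    by (rule Z_comm) (use c a Z_closed in auto)
  have "ginv (a \<cdot> b) \<cdot> ginv (a \<cdot> b) = ginv b \<cdot> (ginv a \<cdot> ginv b) \<cdot> ginv a"
    using c by (simp add: inv_mult_group m_assoc)
  then show ?thesis unfolding e using c by (simp add: m_assoc)
qed

lemma nZ:
  assumes "g \<in> auto A" "x \<in> carrier A"
  shows "ze (g (pr S x)) \<in> Z" "ze (g (pr S x)) \<in> carrier A"
    "ginv (ze (g (pr S x))) \<cdot> ginv (ze (g (pr S x))) \<in> Z"
proof -
  show a: "ze (g (pr S x)) \<in> Z" by (rule ze_Z[OF auto_closed[OF assms(1) retr_carrier[OF assms(2)]]])
  show "ze (g (pr S x)) \<in> carrier A" by (rule Z_carrier[OF a])
  show "ginv (ze (g (pr S x))) \<cdot> ginv (ze (g (pr S x))) \<in> Z" by (intro Z_closed a)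
qed

lemma tw_closed: "g \<in> auto A \<Longrightarrow> x \<in> carrier A \<Longrightarrow> tw S g x \<in> carrier A"
  unfolding tw_def by (rule m_closed[OF auto_closed Z_carrier[OF nZ(3)]])

lemma tw_hom:
  assumes g: "g \<in> auto A" shows "tw S g \<in> hom A A"
proof (rule homI)
  fix x y assume xy: "x \<in> carrier A" "y \<in> carrier A"
  let ?a = "ze (g (pr S x))" and ?b = "ze (g (pr S y))"
  let ?i = "\<lambda>a. ginv a \<cdot> ginv a"
  note a = nZ[OF g xy(1), of S] and b = nZ[OF g xy(2), of S]
  have gc: "g x \<in> carrier A" "g y \<in> carrier A" using auto_closed[OF g] xy by auto
  have prc: "pr S x \<in> carrier A" "pr S y \<in> carrier A" using retr_carrier xy by auto
  have n: "ze (g (pr S (x \<cdot> y))) = ?a \<cdot> ?b"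
    unfolding retr_mult[OF xy] auto_mult[OF g prc]
    by (rule retr_mult[OF auto_closed[OF g prc(1)] auto_closed[OF g prc(2)]])
  have "tw S g (x \<cdot> y) = g x \<cdot> g y \<cdot> (?i ?b \<cdot> ?i ?a)"
    unfolding tw_def n Z_inv_mult[OF a(1) b(1)] auto_mult[OF g xy] ..
  also have "\<dots> = g x \<cdot> g y \<cdot> (?i ?a \<cdot> ?i ?b)"
    unfolding Z_comm[OF Z_carrier[OF b(3)] a(3)] ..
  also have "\<dots> = g x \<cdot> (g y \<cdot> ?i ?a) \<cdot> ?i ?b"
    using gc Z_carrier[OF a(3)] Z_carrier[OF b(3)] by (simp only: m_assoc m_closed)
  also have "\<dots> = g x \<cdot> (?i ?a \<cdot> g y) \<cdot> ?i ?b"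
    unfolding Z_comm[OF gc(2) a(3)] ..
  also have "\<dots> = tw S g x \<cdot> tw S g y"
    unfolding tw_def using gc Z_carrier[OF a(3)] Z_carrier[OF b(3)] by (simp only: m_assoc m_closed)
  finally show "tw S g (x \<cdot> y) = tw S g x \<cdot> tw S g y" .
qed (rule tw_closed[OF g])

text \<open>A product rule: the \<open>Z\<close>-part of \<open>g \<star> h\<close> on the
  \<open>S\<close>-coordinates of \<open>x\<close> is that of \<open>g\<close> at \<open>h x\<close>
  times \<open>g\<close> applied to that of \<open>h\<close>. Inverting both parts inverts the
  product, as \<open>Z\<close> is abelian.\<close>

lemma tw_tw:
  assumes g: "g \<in> auto A" and h: "h \<in> auto A" and x: "x \<in> carrier A"
  shows "tw S g (tw S h x) = tw S (g \<star> h) x"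
proof -
  let ?i = "\<lambda>a. ginv a \<cdot> ginv a"
  let ?n = "ze (h (pr S x))" and ?u = "ze (g (pr S (h x)))"
  note n = nZ[OF h x, of S]
  have hx: "h x \<in> carrier A" using auto_closed[OF h x] .
  note u = nZ[OF g hx, of S]
  have gn: "g ?n \<in> Z" using auto_Z[OF g n(1)] .
  have prx: "pr S x \<in> carrier A" "pr S (h x) \<in> carrier A" using retr_carrier x hx by auto
  have gc: "g (h x) \<in> carrier A" "g (pr S (h x)) \<in> carrier A" "g ?n \<in> carrier A"
    using auto_closed[OF g] hx prx n(2) by auto
  have "pr S (tw S h x) = pr S (h x)"
    unfolding tw_def retr_mult[OF hx Z_carrier[OF n(3)]] pr_Z[OF n(3)] using prx by simp
  then have 1: "tw S g (tw S h x) = g (tw S h x) \<cdot> ?i ?u" unfolding tw_def[of S g] by simp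
  have 2: "g (tw S h x) = g (h x) \<cdot> ?i (g ?n)"
    unfolding tw_def using hx n(2) by (simp add: auto_mult[OF g] auto_inv[OF g])
  have 1: "tw S g (tw S h x) = g (h x) \<cdot> (?i (g ?n) \<cdot> ?i ?u)"
    unfolding 1 2 using gc(1,3) u(2) by (simp add: m_assoc)
  have "ze (g (h (pr S x))) = ze (g (pr S (h x) \<cdot> ?n))" using auto_pr[OF h x, of S] by simp
  also have "\<dots> = ?u \<cdot> g ?n"
    using auto_mult[OF g prx(2) n(2)] gc ze_id[OF gn] by (simp add: retr_mult)
  finally have "tw S (g \<star> h) x = g (h x) \<cdot> ?i (?u \<cdot> g ?n)"
    unfolding tw_def auto_apply[OF g h x] auto_apply[OF g h prx(1)] by simp
  then show ?thesis unfolding 1 Z_inv_mult[OF u(1) gn] ..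
qed

lemma tw_one: "x \<in> carrier A \<Longrightarrow> tw S \<one>\<^bsub>G\<^esub> x = x"
  by (simp add: tw_def auto_one_apply retr_carrier ze_pr)

lemma tw_auto:
  assumes g: "g \<in> auto A" shows "restrict (tw S g) (carrier A) \<in> auto A"
proof -
  interpret G: group G by (rule group_G)
  have gG: "g \<in> carrier G" using g by (simp add: carrier_AutoGroup)
  have i: "inv\<^bsub>G\<^esub> g \<in> auto A" using G.inv_closed[OF gG] by (simp add: carrier_AutoGroup)
  show ?thesis
  proof (rule restrict_auto[OF tw_hom[OF g] tw_closed[OF i]])
    fix x assume x: "x \<in> carrier A"
    show "tw S (inv\<^bsub>G\<^esub> g) (tw S g x) = x" "tw S g (tw S (inv\<^bsub>G\<^esub> g) x) = x"
      unfolding tw_tw[OF i g x] tw_tw[OF g i x] using tw_one[OF x] gG by simp_all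
  qed
qed

definition twist where "twist S = (\<lambda>g\<in>carrier G. restrict (tw S g) (carrier A))"

lemma twist_apply: "g \<in> auto A \<Longrightarrow> x \<in> carrier A \<Longrightarrow> twist S g x = tw S g x"
  by (simp add: twist_def carrier_AutoGroup)

lemma twist_mem: "g \<in> auto A \<Longrightarrow> twist S g \<in> auto A"
  using tw_auto by (simp add: twist_def carrier_AutoGroup)

lemma twist_twist:
  assumes g: "g \<in> auto A" shows "twist S (twist S g) = g"
proof (rule auto_eqI[OF twist_mem[OF twist_mem[OF g]] g])
  fix x assume x: "x \<in> carrier A"
  have px: "pr S x \<in> carrier A" using retr_carrier[OF x] .
  let ?n = "ze (g (pr S x))"
  note n = nZ[OF g x, of S]
  have gc: "g x \<in> carrier A" "g (pr S x) \<in> carrier A" using auto_closed[OF g] x px by auto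
  have "pr S (pr S x) = pr S x" using pr_pr[OF x, of S S] by simp
  then have "twist S g (pr S x) = g (pr S x) \<cdot> (ginv ?n \<cdot> ginv ?n)"
    unfolding twist_apply[OF g px] tw_def by simp
  then have "ze (twist S g (pr S x)) = ?n \<cdot> (ginv ?n \<cdot> ginv ?n)"
    by (simp only: retr_mult[OF gc(2) Z_carrier[OF n(3)]] ze_id[OF n(3)])
  also have "\<dots> = ginv ?n" using n(2) by (simp add: word_simps)
  finally have m: "ze (twist S g (pr S x)) = ginv ?n" .
  have "twist S (twist S g) x = twist S g x \<cdot> (ginv (ginv ?n) \<cdot> ginv (ginv ?n))"
    unfolding twist_apply[OF twist_mem[OF g] x] tw_def[of S "twist S g"] m ..
  also have "\<dots> = g x \<cdot> (ginv ?n \<cdot> ginv ?n) \<cdot> (?n \<cdot> ?n)"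
    unfolding twist_apply[OF g x] tw_def inv_inv[OF n(2)] ..
  also have "\<dots> = g x" using gc(1) n(2) by (simp add: word_simps)
  finally show "twist S (twist S g) x = g x" .
qed

lemma twist_auto: "twist S \<in> auto G"
proof -
  interpret G: group G by (rule group_G)
  have "restrict (twist S) (carrier G) \<in> auto G"
  proof (rule G.restrict_auto[where f' = "twist S"])
    show "twist S \<in> hom G G"
    proof (rule homI)
      show "twist S g \<in> carrier G" if "g \<in> carrier G" for g
        using twist_mem that by (simp add: carrier_AutoGroup)
      fix g h assume "g \<in> carrier G" "h \<in> carrier G"
      then have gh: "g \<in> auto A" "h \<in> auto A" "g \<star> h \<in> auto A"
        using auto_m_closed by (simp_all add: carrier_AutoGroup)
      note t = twist_mem[OF gh(1), of S] twist_mem[OF gh(2), of S]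
      show "twist S (g \<star> h) = twist S g \<star> twist S h"
      proof (rule auto_eqI[OF twist_mem[OF gh(3)] auto_m_closed[OF t]])
        fix x assume x: "x \<in> carrier A"
        show "twist S (g \<star> h) x = (twist S g \<star> twist S h) x"
          unfolding auto_apply[OF t x] twist_apply[OF gh(3) x] twist_apply[OF gh(2) x]
            twist_apply[OF gh(1) tw_closed[OF gh(2) x]] tw_tw[OF gh(1,2) x] ..
      qed
    qed
  qed (simp_all add: carrier_AutoGroup twist_mem twist_twist)
  then show ?thesis by (simp add: twist_def)
qed

section \<open>Transvections, and how they tell the sign changes apart\<close>

definition trans :: "'v \<Rightarrow> int \<Rightarrow> 'v elt \<Rightarrow> 'v elt" where
  "trans v e = (\<lambda>x\<in>carrier A. x \<cdot> gen z [^]\<^bsub>A\<^esub> (e * expo {v} x))"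

lemma gz: "gen z \<in> carrier A" "gen z \<in> Z" "gen z [^]\<^bsub>A\<^esub> (e::int) \<in> carrier A" "gen z [^]\<^bsub>A\<^esub> (e::int) \<in> Z"
  using gen_carrier[OF z_V(1)] gen_sub[of z "{z}"] subgroup_int_pow_closed[OF subgroup_sub[OF z_V(2)]]
  by auto

lemma trans_auto:
  assumes v: "v \<in> V" "v \<noteq> z" shows "trans v e \<in> auto A"
proof -
  have ez: "expo {v} (gen z) = 0" using expo(2)[OF z_V(1)] v by simp
  have inv: "(x \<cdot> gen z [^]\<^bsub>A\<^esub> (d * expo {v} x)) \<cdot>
      gen z [^]\<^bsub>A\<^esub> (- d * expo {v} (x \<cdot> gen z [^]\<^bsub>A\<^esub> (d * expo {v} x))) = x"
    if "x \<in> carrier A" for x and d :: int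
    using that gz(1,3) ez by (simp add: expo_mult expo_pow m_assoc int_pow_neg)
  show ?thesis unfolding trans_def
  proof (rule restrict_auto[where f' = "\<lambda>x. x \<cdot> gen z [^]\<^bsub>A\<^esub> (- e * expo {v} x)"])
    show "(\<lambda>x. x \<cdot> gen z [^]\<^bsub>A\<^esub> (e * expo {v} x)) \<in> hom A A"
    proof (rule homI)
      fix x y assume xy: "x \<in> carrier A" "y \<in> carrier A"
      let ?z = "\<lambda>x. gen z [^]\<^bsub>A\<^esub> (e * expo {v} x)"
      have "?z (x \<cdot> y) = ?z x \<cdot> ?z y"
        using xy gz by (simp add: expo_mult distrib_left int_pow_mult)
      then have "x \<cdot> y \<cdot> ?z (x \<cdot> y) = x \<cdot> (y \<cdot> ?z x) \<cdot> ?z y" using xy gz by (simp add: m_assoc)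
      also have "y \<cdot> ?z x = ?z x \<cdot> y" by (rule Z_comm[OF xy(2) gz(4)])
      finally show "x \<cdot> y \<cdot> ?z (x \<cdot> y) = (x \<cdot> ?z x) \<cdot> (y \<cdot> ?z y)" using xy gz by (simp add: m_assoc)
    qed (simp add: gz)
    show "(x \<cdot> gen z [^]\<^bsub>A\<^esub> (- e * expo {v} x)) \<cdot>
        gen z [^]\<^bsub>A\<^esub> (e * expo {v} (x \<cdot> gen z [^]\<^bsub>A\<^esub> (- e * expo {v} x))) = x"
      if "x \<in> carrier A" for x using inv[OF that, of "- e"] by simp
    show "(x \<cdot> gen z [^]\<^bsub>A\<^esub> (e * expo {v} x)) \<cdot>
        gen z [^]\<^bsub>A\<^esub> (- e * expo {v} (x \<cdot> gen z [^]\<^bsub>A\<^esub> (e * expo {v} x))) = x"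
      if "x \<in> carrier A" for x using inv[OF that, of e] .
  qed (simp add: gz)
qed

lemma trans_apply: "x \<in> carrier A \<Longrightarrow> trans v e x = x \<cdot> gen z [^]\<^bsub>A\<^esub> (e * expo {v} x)"
  by (simp add: trans_def)

lemma expo_disjoint: "v \<notin> U \<Longrightarrow> x \<in> carrier A \<Longrightarrow> expo {v} (retr U x) = 0"
proof -
  assume v: "v \<notin> U" and x: "x \<in> carrier A"
  have "(expo {v} \<circ> retr U) x = (\<lambda>_. 0) x"
    by (rule hom_eq_gens[OF group_integer_group Group.hom_compose[OF retr(1) expo(1)] _ _ x])
       (use v in \<open>auto simp: retr(2) expo(2) expo_one hom_def\<close>)
  then show ?thesis by simp
qed

text \<open>The retraction to the blocks in \<open>S\<close> sees the generator \<open>v\<close>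
  exactly when \<open>i\<close> is in \<open>S\<close>. Then two copies of the added power of
  \<open>gen z\<close> are removed, which changes its sign.\<close>

lemma twist_trans:
  assumes v: "v \<in> B i" "i < k"
  shows "twist S (trans v 1) = trans v (if i \<in> S then - 1 else 1)"
proof -
  have vV: "v \<in> V" "v \<noteq> z" using v B_sub[OF v(2)] B_C[OF v(2)] by auto
  note t = trans_auto[OF vV]
  have vS: "v \<in> blocks S \<longleftrightarrow> i \<in> S" using v B_disj[OF v(2)] unfolding blocks_def by blast
  show ?thesis
  proof (rule auto_eqI[OF twist_mem[OF t] t])
    fix x assume x: "x \<in> carrier A"
    have px: "pr S x \<in> carrier A" using retr_carrier[OF x] .
    have e: "expo {v} (pr S x) = (if i \<in> S then expo {v} x else 0)"
      using expo_retr[of "{v}" "blocks S" x] expo_disjoint[of v "blocks S" x] vS x by simp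
    have "ze (trans v 1 (pr S x)) = gen z [^]\<^bsub>A\<^esub> expo {v} (pr S x)"
      using px gz ze_id[OF gz(4)] ze_pr[OF x] by (simp add: trans_apply retr_mult)
    then have "tw S (trans v 1) x = x \<cdot> gen z [^]\<^bsub>A\<^esub> expo {v} x \<cdot>
        (ginv (gen z [^]\<^bsub>A\<^esub> expo {v} (pr S x)) \<cdot> ginv (gen z [^]\<^bsub>A\<^esub> expo {v} (pr S x)))"
      using x by (simp add: tw_def trans_apply)
    also have "\<dots> = x \<cdot> (gen z [^]\<^bsub>A\<^esub> expo {v} x \<cdot>
        (gen z [^]\<^bsub>A\<^esub> (- expo {v} (pr S x)) \<cdot> gen z [^]\<^bsub>A\<^esub> (- expo {v} (pr S x))))"
      using x gz(1,3) by (simp add: m_assoc int_pow_neg)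
    also have "\<dots> = x \<cdot> gen z [^]\<^bsub>A\<^esub> (expo {v} x + (- expo {v} (pr S x) + - expo {v} (pr S x)))"
      unfolding int_pow_mult[OF gz(1)] ..
    also have "\<dots> = trans v (if i \<in> S then - 1 else 1) x" using e x by (simp add: trans_apply)
    finally show "twist S (trans v 1) x = trans v (if i \<in> S then - 1 else 1) x"
      using twist_apply[OF t x] by simp
  qed
qed

text \<open>An inner automorphism has no \<open>Z\<close>-part on the blocks, so there is no sign to
  change. In \<open>twist_conj_subset\<close> this forces the conjugating automorphism to be trivial
  modulo the centre.\<close>

lemma twist_cj:
  assumes g: "g \<in> carrier A" shows "twist S (cj g) = cj g"
proof (rule auto_eqI[OF twist_mem[OF cj_auto[OF g]] cj_auto[OF g]])
  fix x assume x: "x \<in> carrier A"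
  have px: "pr S x \<in> carrier A" using retr_carrier[OF x] .
  have "ze (cj g (pr S x)) = \<epsilon>"
    using g px ze_pr[OF x] retr_carrier[OF g] by (simp add: cj_apply retr_mult retr_inv)
  then show "twist S (cj g) x = cj g x"
    using twist_apply[OF cj_auto[OF g] x] x g by (simp add: tw_def cj_apply)
qed

text \<open>\<open>ginv x \<cdot> y\<close> is central, whereas a free block of rank at least two
  has trivial centre.\<close>

lemma cj_eq_p:
  assumes x: "x \<in> carrier A" "y \<in> carrier A" "cj x = cj y" and i: "i < k"
  shows "p i x = p i y"
proof (rule ccontr)
  assume ne: "p i x \<noteq> p i y"
  let ?c = "ginv x \<cdot> y"
  have c: "?c \<in> carrier A" using x by simp
  have com: "a \<cdot> ?c = ?c \<cdot> a" if a: "a \<in> carrier A" for a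
  proof -
    have e: "x \<cdot> a \<cdot> ginv x = y \<cdot> a \<cdot> ginv y" using fun_cong[OF x(3), of a] a by (simp add: cj_apply)
    have "a \<cdot> ?c = ginv x \<cdot> (x \<cdot> a \<cdot> ginv x) \<cdot> y" using x a by (simp add: word_simps)
    also have "\<dots> = ?c \<cdot> a" unfolding e using x a by (simp add: word_simps)
    finally show ?thesis .
  qed
  have pc: "p i ?c \<in> sub (B i)" by (rule retr_sub[OF B_sub[OF i] c])
  have "p i ?c \<noteq> \<epsilon>"
  proof
    assume "p i ?c = \<epsilon>"
    then have "p i x \<cdot> (ginv (p i x) \<cdot> p i y) = p i x \<cdot> \<epsilon>" using x by (simp add: retr_mult retr_inv)
    then show False using ne x retr_carrier by (simp add: mult_inv_cancel)
  qed
  obtain a b where ab: "a \<in> sub (B i)" "b \<in> sub (B i)" "a \<cdot> b \<noteq> b \<cdot> a" using B_noncomm[OF i] by blast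
  have pcom: "a \<cdot> p i ?c = p i ?c \<cdot> a" if a: "a \<in> sub (B i)" for a
  proof -
    have ac: "a \<in> carrier A" by (rule sub_carrier[OF B_sub[OF i] a])
    have "p i (a \<cdot> ?c) = p i (?c \<cdot> a)" using com[OF ac] by simp
    then show ?thesis unfolding retr_mult[OF ac c] retr_mult[OF c ac] retr_id[OF order_refl B_sub[OF i] a] .
  qed
  show False using B_ct[OF i pc \<open>p i ?c \<noteq> \<epsilon>\<close> ab(1) pcom[OF ab(1)] ab(2) pcom[OF ab(2)]] ab(3) by blast
qed

text \<open>Block \<open>k - 1\<close> has sign + on both sides, and a transvection there shows that
  \<open>h\<close> fixes \<open>gen z\<close>. Transvections on the other blocks then have to carry
  the same sign for \<open>S\<close> and \<open>T\<close>. Without such a reference block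
  \<open>h\<close> could invert \<open>gen z\<close>, which would identify a set of blocks with its
  complement.\<close>

lemma twist_conj_subset:
  assumes S: "S \<subseteq> {..<k - 1}" and T: "T \<subseteq> {..<k - 1}" and h: "h \<in> carrier G"
    and eq: "\<And>g. g \<in> carrier G \<Longrightarrow> twist S g = h \<star> twist T g \<star> inv\<^bsub>G\<^esub> h"
  shows "S \<subseteq> T"
proof
  interpret G: group G by (rule group_G)
  fix i assume iS: "i \<in> S"
  then have i: "i < k" "k - 1 < k" "k - 1 \<notin> S" "k - 1 \<notin> T" using S T by auto
  have ha: "h \<in> auto A" using h by (simp add: carrier_AutoGroup)
  have rel: "twist S g \<star> h = h \<star> twist T g" if g: "g \<in> auto A" for g
  proof -
    have gG: "g \<in> carrier G" "twist T g \<in> carrier G" using g twist_mem by (simp_all add: carrier_AutoGroup)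
    show ?thesis unfolding eq[OF gG(1)] using gG h by (simp add: G.m_assoc)
  qed
  \<comment> \<open>Both twists fix inner automorphisms, so \<open>h\<close> commutes with them and
    moves each element by a central factor only.\<close>
  have ph: "p j (h x) = p j x" if x: "x \<in> carrier A" and j: "j < k" for x j
  proof -
    have hx: "h x \<in> carrier A" using auto_closed[OF ha x] .
    have "cj x \<star> h = cj (h x) \<star> h"
      using rel[OF cj_auto[OF x]] unfolding twist_cj[OF x] auto_cj[OF ha x] .
    then have "cj x = cj (h x)" using h cj_auto[OF x] cj_auto[OF hx] by (simp flip: carrier_AutoGroup)
    then show ?thesis using cj_eq_p[OF x hx _ j] by simp
  qed
  have h_trans: "h (gen v) \<cdot> gen z [^]\<^bsub>A\<^esub> (if j \<in> S then - 1 else 1 :: int)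
      = h (gen v) \<cdot> h (gen z) [^]\<^bsub>A\<^esub> (if j \<in> T then - 1 else 1 :: int)"
    if j: "j < k" and v: "v \<in> B j" for j v
  proof -
    have vV: "v \<in> V" "v \<noteq> z" using v B_sub[OF j] B_C[OF j] by auto
    have gv: "gen v \<in> carrier A" "h (gen v) \<in> carrier A"
      using gen_carrier[OF vV(1)] auto_closed[OF ha] by auto
    have ev: "expo {v} (gen v) = 1" using expo(2)[OF vV(1)] by simp
    have "expo {v} (h (gen v)) = expo {v} (p j (h (gen v)))"
      using expo_retr[of "{v}" "B j" "h (gen v)"] v gv by simp
    then have ehv: "expo {v} (h (gen v)) = 1"
      using ph[OF gv(1) j] expo_retr[of "{v}" "B j" "gen v"] v gv ev by simp
    note t = trans_auto[OF vV]
    have "(trans v (if j \<in> S then - 1 else 1) \<star> h) (gen v) = (h \<star> trans v (if j \<in> T then - 1 else 1)) (gen v)"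
      using rel[OF t, of 1] unfolding twist_trans[OF v j] by simp
    then have "trans v (if j \<in> S then - 1 else 1) (h (gen v)) = h (trans v (if j \<in> T then - 1 else 1) (gen v))"
      unfolding auto_apply[OF t ha gv(1)] auto_apply[OF ha t gv(1)] .
    then have "h (gen v) \<cdot> gen z [^]\<^bsub>A\<^esub> (if j \<in> S then - 1 else 1 :: int)
       = h (gen v \<cdot> gen z [^]\<^bsub>A\<^esub> (if j \<in> T then - 1 else 1 :: int))"
      unfolding trans_apply[OF gv(1)] trans_apply[OF gv(2)] ev ehv by simp
    also have "\<dots> = h (gen v) \<cdot> h (gen z [^]\<^bsub>A\<^esub> (if j \<in> T then - 1 else 1 :: int))"
      by (rule auto_mult[OF ha gv(1) gz(3)])
    also have "h (gen z [^]\<^bsub>A\<^esub> (if j \<in> T then - 1 else 1 :: int)) = h (gen z) [^]\<^bsub>A\<^esub> (if j \<in> T then - 1 else 1 :: int)"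
      using group_hom.hom_int_pow[of A A h "gen z"] ha gz(1) group_A
      by (simp add: auto_def group_hom_def group_hom_axioms_def)
    finally show ?thesis .
  qed
  have ne: "\<exists>v. v \<in> B j" if "j < k" for j
    using B_two[OF that] by (metis card.empty ex_in_conv not_numeral_le_zero)
  have hc: "h x \<in> carrier A" if "x \<in> carrier A" for x using auto_closed[OF ha that] .
  obtain v where v: "v \<in> B (k - 1)" using ne[OF i(2)] by blast
  have gv: "h (gen v) \<in> carrier A" using hc gen_carrier v B_sub[OF i(2)] by blast
  have hz: "h (gen z) = gen z"
    using h_trans[OF i(2) v] i(3,4) gv gz(1) hc[OF gz(1)] by simp
  show "i \<in> T"
  proof (rule ccontr)
    assume "i \<notin> T"
    obtain w where w: "w \<in> B i" using ne[OF i(1)] by blast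
    have gw: "h (gen w) \<in> carrier A" using hc gen_carrier w B_sub[OF i(1)] by blast
    have "gen z [^]\<^bsub>A\<^esub> (- 1 :: int) = gen z [^]\<^bsub>A\<^esub> (1 :: int)"
      using h_trans[OF i(1) w] iS \<open>i \<notin> T\<close> gw gz(1,3) unfolding hz by simp
    then have "expo {z} (gen z [^]\<^bsub>A\<^esub> (- 1 :: int)) = expo {z} (gen z [^]\<^bsub>A\<^esub> (1 :: int))" by (rule arg_cong)
    then show False unfolding expo_pow[OF gz(1)] using expo(2)[OF z_V(1), of "{z}"] by simp
  qed
qed

lemma Out_exceeds_power: "N < 2 ^ (k - 1) \<Longrightarrow> order_exceeds (Out G) N"
  by (rule group.Out_exceeds[OF group_G, of "Pow {..<k - 1}" N twist])
     (simp_all add: card_Pow twist_auto twist_conj_subset)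

lemma nontrivial_center: "center A \<noteq> {\<epsilon>}"
proof -
  have "gen z \<in> center A" using gz Z_comm unfolding center_def by blast
  then show ?thesis using gen_ne_one[OF z_V(1)] by blast
qed

end

section \<open>The graphs\<close>

text \<open>Storing the index in the first component makes the blocks disjoint and leaves the pairs
  beginning with \<open>k\<close> for the vertices outside the free factors.\<close>

definition blk :: "nat \<Rightarrow> nat \<Rightarrow> nat set" where
  "blk i n = (\<lambda>j. prod_encode (i, j)) ` {..<n}"

text \<open>The summand 2 makes the ranks strictly increasing and at least two.\<close>

definition block_edges :: "nat \<Rightarrow> (nat \<times> nat) set" where
  "block_edges k = (\<Union>i<k. \<Union>j\<in>{..<k} - {i}. blk i (i + 2) \<times> blk j (j + 2))"

lemma blk_index: "v \<in> blk i n \<Longrightarrow> fst (prod_decode v) = i"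
  by (auto simp: blk_def)

lemma card_blk: "card (blk i n) = n"
  unfolding blk_def by (subst card_image) (auto intro: inj_onI)

lemma finite_blk: "finite (blk i n)"
  by (simp add: blk_def)

lemma block_edges_iff:
  "(v, w) \<in> block_edges k \<longleftrightarrow>
    (\<exists>i j. i < k \<and> j < k \<and> i \<noteq> j \<and> v \<in> blk i (i + 2) \<and> w \<in> blk j (j + 2))"
  by (auto simp: block_edges_def)

lemma block_edges_index:
  assumes "(v, w) \<in> block_edges k" shows "fst (prod_decode v) \<noteq> fst (prod_decode w)"
proof -
  obtain i j where ij: "i \<noteq> j" "v \<in> blk i (i + 2)" "w \<in> blk j (j + 2)"
    using assms unfolding block_edges_iff by blast
  show ?thesis using ij(1) blk_index[OF ij(2)] blk_index[OF ij(3)] by simp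
qed

lemma centreless_graph:
  assumes "2 \<le> k"
  shows "\<exists>V E. simplicial_graph V E \<and>
    (\<exists>c1 c2. raag_free_square V E k (\<lambda>i. blk i (i + 2)) c1 c2)"
proof (intro exI conjI)
  let ?c = "prod_encode (k, 0)" and ?d = "prod_encode (k, 1)"
  let ?U = "\<Union>i<k. blk i (i + 2)"
  let ?V = "?U \<union> {?c, ?d}" and ?E = "block_edges k \<union> {(?c, ?d), (?d, ?c)}"
  have cd: "?c \<noteq> ?d" by simp
  have U: "fst (prod_decode v) < k" if "v \<in> ?U" for v 
  proof -
    from that obtain i where i: "i < k" "v \<in> blk i (i + 2)" by blast
    show ?thesis using blk_index[OF i(2)] i(1) by simp
  qed
  have cU: "?c \<notin> ?U" "?d \<notin> ?U" using U[of ?c] U[of ?d] by auto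
  have E0: "block_edges k \<subseteq> ?U \<times> ?U" by (auto simp: block_edges_def)
  show "simplicial_graph ?V ?E"
    unfolding simplicial_graph_def
  proof (intro conjI)
    show "finite ?V" using finite_blk by simp
    show "?E \<subseteq> ?V \<times> ?V" using E0 by auto
    show "sym ?E" by (rule symI) (auto simp: block_edges_iff)
    show "irrefl ?E"
    proof (rule irreflI)
      fix v show "(v, v) \<notin> ?E" using cd block_edges_index[of v v k] by auto
    qed
  qed
  interpret raag_blocks ?V ?E k "\<lambda>i. blk i (i + 2)" "{}"
  proof
    show "?E \<subseteq> ?V \<times> ?V" using E0 by auto
    show "blk i (i + 2) \<inter> blk j (j + 2) = {}" if "i \<noteq> j" for i j
      using that blk_index[of _ i] blk_index[of _ j] by blast
    show "(v, w) \<notin> ?E" if "i < k" "v \<in> blk i (i + 2)" "w \<in> blk i (i + 2)" for i v w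
    proof -
      have "v \<noteq> ?c" "v \<noteq> ?d" using that cU by auto
      moreover have "(v, w) \<notin> block_edges k"
        using block_edges_index[of v w k] blk_index[OF that(2)] blk_index[OF that(3)] by auto
      ultimately show ?thesis by blast
    qed
  qed (auto simp: finite_blk card_blk block_edges_iff)
  show "raag_free_square ?V ?E k (\<lambda>i. blk i (i + 2)) ?c ?d"
  proof (intro raag_free_square.intro raag_free_square_axioms.intro raag_blocks_axioms)
    have W: "W = ?U" unfolding W_def by simp
    show "?V = W \<union> {?c, ?d}" "?c \<notin> W" "?d \<notin> W" using W cU by simp_all
    show "?c \<noteq> ?d" by (rule cd)
    show "(w, c) \<notin> ?E \<and> (c, w) \<notin> ?E" if "w \<in> W" "c \<in> {?c, ?d}" for w c
    proof -
      have "c \<notin> ?U" "w \<in> ?U" using that W cU by auto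
      then show ?thesis using E0 that cU by blast
    qed
  qed (use assms in auto)
qed

lemma central_graph:
  "\<exists>V E. simplicial_graph V E \<and> (\<exists>z. raag_center V E k (\<lambda>i. blk i (i + 2)) z)"
proof (intro exI conjI)
  let ?c = "prod_encode (k, 0)"
  let ?U = "\<Union>i<k. blk i (i + 2)"
  let ?V = "?U \<union> {?c}" and ?E = "block_edges k \<union> ?U \<times> {?c} \<union> {?c} \<times> ?U"
  have U: "fst (prod_decode v) < k" if "v \<in> ?U" for v 
  proof -
    from that obtain i where i: "i < k" "v \<in> blk i (i + 2)" by blast
    show ?thesis using blk_index[OF i(2)] i(1) by simp
  qed
  have cU: "?c \<notin> ?U" using U[of ?c] by auto
  have E0: "block_edges k \<subseteq> ?U \<times> ?U" by (auto simp: block_edges_def)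
  show "simplicial_graph ?V ?E"
    unfolding simplicial_graph_def
  proof (intro conjI)
    show "finite ?V" using finite_blk by simp
    show "?E \<subseteq> ?V \<times> ?V" using E0 by auto
    show "sym ?E" by (rule symI) (auto simp: block_edges_iff)
    show "irrefl ?E"
    proof (rule irreflI)
      fix v show "(v, v) \<notin> ?E" using cU block_edges_index[of v v k] by blast
    qed
  qed
  interpret raag_blocks ?V ?E k "\<lambda>i. blk i (i + 2)" "{?c}"
  proof
    show "?E \<subseteq> ?V \<times> ?V" using E0 by auto
    show "blk i (i + 2) \<inter> blk j (j + 2) = {}" if "i \<noteq> j" for i j
      using that blk_index[of _ i] blk_index[of _ j] by blast
    show "blk i (i + 2) \<inter> {?c} = {}" if "i < k" for i using that cU by blast
    show "(v, w) \<notin> ?E" if "i < k" "v \<in> blk i (i + 2)" "w \<in> blk i (i + 2)" for i v w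
    proof -
      have "v \<noteq> ?c" "w \<noteq> ?c" using that cU by auto
      moreover have "(v, w) \<notin> block_edges k"
        using block_edges_index[of v w k] blk_index[OF that(2)] blk_index[OF that(3)] by auto
      ultimately show ?thesis by blast
    qed
  qed (auto simp: finite_blk card_blk block_edges_iff)
  show "raag_center ?V ?E k (\<lambda>i. blk i (i + 2)) ?c"
    by (intro raag_center.intro raag_center_axioms.intro raag_blocks_axioms) (rule W_def[symmetric])
qed

theorem theoremA:
  shows "\<forall>N :: nat.
     (\<exists>(V :: nat set) E. simplicial_graph V E \<and>
        order_exceeds (Out (AutoGroup (RAAG V E))) N \<and>
        center (RAAG V E) = {\<one>\<^bsub>RAAG V E\<^esub>}) \<and>
     (\<exists>(V :: nat set) E. simplicial_graph V E \<and>
        order_exceeds (Out (AutoGroup (RAAG V E))) N \<and>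
        center (RAAG V E) \<noteq> {\<one>\<^bsub>RAAG V E\<^esub>})"
proof (intro allI conjI)
  fix N :: nat
  \<comment> \<open>In the central case \<open>k - 1 = N + 1\<close> blocks carry free signs; the
    other case also calls for \<open>2 \<le> k\<close>.\<close>
  let ?k = "N + 2"
  have less: "N < 2 ^ ?k" "N < 2 ^ (?k - 1)"
    using less_exp[of N] by (simp_all add: less_trans[OF less_exp])
  obtain V E c1 c2 where 1: "simplicial_graph V E"
    "raag_free_square V E ?k (\<lambda>i. blk i (i + 2)) c1 c2"
    using centreless_graph[of ?k] by auto
  show "\<exists>(V :: nat set) E. simplicial_graph V E \<and>
        order_exceeds (Out (AutoGroup (RAAG V E))) N \<and> center (RAAG V E) = {\<one>\<^bsub>RAAG V E\<^esub>}"
    using 1(1) raag_free_square.Out_exceeds_power[OF 1(2) less(1)]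
      raag_free_square.trivial_center[OF 1(2)] by blast
  obtain V' E' z where 2: "simplicial_graph V' E'" "raag_center V' E' ?k (\<lambda>i. blk i (i + 2)) z"
    using central_graph[of ?k] by blast
  show "\<exists>(V :: nat set) E. simplicial_graph V E \<and>
        order_exceeds (Out (AutoGroup (RAAG V E))) N \<and> center (RAAG V E) \<noteq> {\<one>\<^bsub>RAAG V E\<^esub>}"
    using 2(1) raag_center.Out_exceeds_power[OF 2(2) less(2)]
      raag_center.nontrivial_center[OF 2(2)] by blast
qed

end
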